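(* Let $\Gamma$ and $\Lambda$ be discrete groups with $\Lambda$ non-trivial and $\Gamma$ non-amenable. Then the wreath product $\Lambda\wr\Gamma$ is not weakly amenable. Also, the group $\mathrm{SL}(2,\mathbb{Z})\ltimes\mathbb{Z}^2$ is not weakly amenable.
   Context: $\Lambda\wr\Gamma=\bigl(\bigoplus_{\Gamma}\Lambda\bigr)\rtimes\Gamma$, where $\Gamma$ acts by translating the coordinates; $\mathrm{SL}(2,\mathbb{Z})\ltimes\mathbb{Z}^2$ is formed with respect to the linear action of $\mathrm{SL}(2,\mathbb{Z})$ on $\mathbb{Z}^2$. Both are regarded as discrete groups. The Fourier algebra $\mathcal{A}G$ of a locally compact group $G$ consists of all functions $\varphi$ on $G$ of the form $\varphi(x)=\langle\lambda(x)\xi,\eta\rangle$ with $\xi,\eta\in L^2(G)$, where $\lambda$ is the left regular representation. A continuous function $\varphi$ on $G$ is a Herz--Schur multiplier if there are a Hilbert space $\mathcal{H}$ and bounded continuous functions $\xi,\eta\colon G\to\mathcal{H}$ such that $\varphi(y^{-1}x)=\langle\xi(x),\eta(y)\rangle$ for all $x,y\in G$; its norm $\|\varphi\|_{\mathrm{cb}}$ is the infimum of $\|\xi\|_\infty\|\eta\|_\infty$ over all such $\mathcal{H},\xi,\eta$. Every element of $\mathcal{A}G$ is a Herz--Schur multiplier. The group $G$ is weakly amenable if there is a net $(\varphi_n)$ in $\mathcal{A}G$ converging to $1$ uniformly on compact sets with $\sup_n\|\varphi_n\|_{\mathrm{cb}}<+\infty$. *)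

theory Defs
  imports "HOL-Analysis.Analysis" "HOL-Algebra.Product_Groups" "HOL-Library.Function_Algebras"
begin

definition hnorm :: "('h \<Rightarrow> 'h \<Rightarrow> complex) \<Rightarrow> 'h \<Rightarrow> real"
  where "hnorm ip v = sqrt (Re (ip v v))"

text \<open>A Hilbert space is a subspace \<open>H\<close> of a complex vector space together with an inner product
  on \<open>H\<close>, linear in the first argument, for which \<open>H\<close> is complete.\<close>

locale complex_hilbert_space = vector_space scale
  for scale :: "complex \<Rightarrow> 'h::ab_group_add \<Rightarrow> 'h" +
  fixes H :: "'h set" and ip :: "'h \<Rightarrow> 'h \<Rightarrow> complex"
  assumes subspace_carrier: "subspace H"
    and ip_add_left: "\<lbrakk>x \<in> H; y \<in> H; z \<in> H\<rbrakk> \<Longrightarrow> ip (x + y) z = ip x z + ip y z"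
    and ip_scale_left: "\<lbrakk>x \<in> H; y \<in> H\<rbrakk> \<Longrightarrow> ip (scale c x) y = c * ip x y"
    and ip_cnj: "\<lbrakk>x \<in> H; y \<in> H\<rbrakk> \<Longrightarrow> ip y x = cnj (ip x y)"
    and ip_self_nonneg: "x \<in> H \<Longrightarrow> 0 \<le> Re (ip x x)"
    and ip_self_eq_0: "\<lbrakk>x \<in> H; ip x x = 0\<rbrakk> \<Longrightarrow> x = 0"
    and complete_carrier:
      "\<lbrakk>\<And>n::nat. X n \<in> H; \<And>e. e > 0 \<Longrightarrow> \<exists>N. \<forall>m\<ge>N. \<forall>n\<ge>N. hnorm ip (X m - X n) < e\<rbrakk>
       \<Longrightarrow> \<exists>x\<in>H. (\<lambda>n. hnorm ip (X n - x)) \<longlonglongrightarrow> 0"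
begin

lemma zero_mem: "0 \<in> H"
  and add_mem: "\<lbrakk>x \<in> H; y \<in> H\<rbrakk> \<Longrightarrow> x + y \<in> H"
  and scale_mem: "x \<in> H \<Longrightarrow> scale c x \<in> H"
  and diff_mem: "\<lbrakk>x \<in> H; y \<in> H\<rbrakk> \<Longrightarrow> x - y \<in> H"
  using subspace_carrier
  by (auto intro: subspace_0 subspace_add subspace_scale subspace_diff)

lemma ip_add_right: "\<lbrakk>x \<in> H; y \<in> H; z \<in> H\<rbrakk> \<Longrightarrow> ip z (x + y) = ip z x + ip z y"
  by (metis add_mem complex_cnj_add ip_add_left ip_cnj)

lemma ip_scale_right: "\<lbrakk>x \<in> H; y \<in> H\<rbrakk> \<Longrightarrow> ip y (scale c x) = cnj c * ip y x"
  by (metis scale_mem complex_cnj_mult ip_scale_left ip_cnj)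

lemma ip_diff_left:
  assumes "x \<in> H" "y \<in> H" "z \<in> H"
  shows "ip (x - y) z = ip x z - ip y z"
  using ip_add_left[of "x - y" y z] assms diff_mem by simp

lemma ip_diff_right:
  assumes "x \<in> H" "y \<in> H" "z \<in> H"
  shows "ip z (x - y) = ip z x - ip z y"
  using ip_add_right[of "x - y" y z] assms diff_mem by simp

lemma ip_zero_left: "z \<in> H \<Longrightarrow> ip 0 z = 0"
  using ip_diff_left[of z z z] by simp

lemma ip_self_real: "x \<in> H \<Longrightarrow> ip x x = of_real ((hnorm ip x)\<^sup>2)"
  using ip_cnj[of x x] ip_self_nonneg[of x]
  by (simp add: hnorm_def complex_eq_iff)

lemma Cauchy_Schwarz:
  assumes x: "x \<in> H" and y: "y \<in> H"
  shows "cmod (ip x y) \<le> hnorm ip x * hnorm ip y"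
proof (cases "y = 0")
  case True
  then have "ip x y = 0"
    using ip_zero_left[OF x] ip_cnj[OF y x] True by simp
  then show ?thesis
    using ip_self_nonneg x y by (simp add: hnorm_def)
next
  case False
  define b where "b = (hnorm ip y)\<^sup>2"
  have yy: "ip y y = of_real b"
    using ip_self_real[OF y] by (simp add: b_def)
  have b0: "b > 0"
    using ip_self_eq_0[OF y] False yy unfolding b_def by (auto simp: less_le)
  define c where "c = ip x y / of_real b"
  have m: "scale c y \<in> H" by (rule scale_mem[OF y])
  have "ip (x - scale c y) (x - scale c y)
      = ip x x - cnj c * ip x y - c * ip y x + c * cnj c * ip y y"
    using x y m diff_mem[OF x m]
    by (simp add: ip_diff_left ip_diff_right ip_scale_left ip_scale_right algebra_simps)
  also have "\<dots> = ip x x - ip x y * cnj (ip x y) / of_real b"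
    using b0 by (simp add: yy ip_cnj[OF x y] c_def field_simps)
  also have "\<dots> = of_real ((hnorm ip x)\<^sup>2 - (cmod (ip x y))\<^sup>2 / b)"
    by (simp add: ip_self_real[OF x] flip: complex_norm_square)
  finally have "0 \<le> (hnorm ip x)\<^sup>2 - (cmod (ip x y))\<^sup>2 / b"
    using ip_self_nonneg[OF diff_mem[OF x m]] by simp
  then have "(cmod (ip x y))\<^sup>2 \<le> (hnorm ip x * hnorm ip y)\<^sup>2"
    using b0 by (simp add: field_simps b_def)
  then show ?thesis
    by (rule power2_le_imp_le) (simp add: hnorm_def ip_self_nonneg x y)
qed

end

definition fscale :: "complex \<Rightarrow> ('s \<Rightarrow> complex) \<Rightarrow> 's \<Rightarrow> complex"
  where "fscale c v = (\<lambda>s. c * v s)"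

lemma vector_space_fscale: "vector_space fscale"
  by unfold_locales (auto simp: fscale_def fun_eq_iff algebra_simps)

definition amenable :: "('g, 'm) monoid_scheme \<Rightarrow> bool"
  where "amenable G \<longleftrightarrow>
    (\<exists>m :: ('g \<Rightarrow> real) \<Rightarrow> real.
      let B = {f. bounded (f ` carrier G)} in
      (\<forall>f\<in>B. \<forall>h\<in>B. m (\<lambda>t. f t + h t) = m f + m h) \<and>
      (\<forall>c. \<forall>f\<in>B. m (\<lambda>t. c * f t) = c * m f) \<and>
      (\<forall>f\<in>B. (\<forall>t\<in>carrier G. 0 \<le> f t) \<longrightarrow> 0 \<le> m f) \<and>
      m (\<lambda>t. 1) = 1 \<and>
      (\<forall>x\<in>carrier G. \<forall>f\<in>B. m (\<lambda>t. f (inv\<^bsub>G\<^esub> x \<otimes>\<^bsub>G\<^esub> t)) = m f))"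

definition l2 :: "('g, 'm) monoid_scheme \<Rightarrow> ('g \<Rightarrow> complex) set"
  where "l2 G = {\<xi>. (\<lambda>t. (cmod (\<xi> t))\<^sup>2) summable_on carrier G}"

definition left_regular ::
    "('g, 'm) monoid_scheme \<Rightarrow> 'g \<Rightarrow> ('g \<Rightarrow> complex) \<Rightarrow> 'g \<Rightarrow> complex"
  where "left_regular G x \<xi> = (\<lambda>t. \<xi> (inv\<^bsub>G\<^esub> x \<otimes>\<^bsub>G\<^esub> t))"

text \<open>Functions on \<open>G\<close> are functions on the whole type; their values off the carrier are irrelevant.\<close>

definition fourier_algebra :: "('g, 'm) monoid_scheme \<Rightarrow> ('g \<Rightarrow> complex) set"
  where "fourier_algebra G =
    {\<phi>. \<exists>\<xi>\<in>l2 G. \<exists>\<eta>\<in>l2 G. \<forall>x\<in>carrier G.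
      \<phi> x = (\<Sum>\<^sub>\<infinity>t\<in>carrier G. left_regular G x \<xi> t * cnj (\<eta> t))}"

definition sup_norm ::
    "('g, 'm) monoid_scheme \<Rightarrow> ('h \<Rightarrow> 'h \<Rightarrow> complex) \<Rightarrow> ('g \<Rightarrow> 'h) \<Rightarrow> real"
  where "sup_norm G ip \<xi> = (SUP x\<in>carrier G. hnorm ip (\<xi> x))"

definition herz_schur_representation ::
    "('g, 'm) monoid_scheme \<Rightarrow> ('g \<Rightarrow> complex) \<Rightarrow> (complex \<Rightarrow> 'h::ab_group_add \<Rightarrow> 'h) \<Rightarrow>
     'h set \<Rightarrow> ('h \<Rightarrow> 'h \<Rightarrow> complex) \<Rightarrow> ('g \<Rightarrow> 'h) \<Rightarrow> ('g \<Rightarrow> 'h) \<Rightarrow> bool"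
  where "herz_schur_representation G \<phi> sc H ip \<xi> \<eta> \<longleftrightarrow>
    complex_hilbert_space sc H ip \<and>
    \<xi> \<in> carrier G \<rightarrow> H \<and> bdd_above ((\<lambda>x. hnorm ip (\<xi> x)) ` carrier G) \<and>
    \<eta> \<in> carrier G \<rightarrow> H \<and> bdd_above ((\<lambda>x. hnorm ip (\<eta> x)) ` carrier G) \<and>
    (\<forall>x\<in>carrier G. \<forall>y\<in>carrier G. \<phi> (inv\<^bsub>G\<^esub> y \<otimes>\<^bsub>G\<^esub> x) = ip (\<xi> x) (\<eta> y))"

text \<open>HOL cannot quantify over the type underlying the Hilbert space. The infimum is therefore
  taken over the Hilbert spaces whose elements are functions on \<open>'g + 'g\<close>, with pointwise linear
  structure and an arbitrary inner product. This loses nothing, since a vector of the closed span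
  of the ranges of \<open>\<xi>\<close> and \<open>\<eta>\<close> is determined by its inner products with these two
  families: by \<open>cb_norm_le\<close> below, Hilbert spaces on other types do not lower the infimum. The value is \<open>\<infinity>\<close> if \<open>\<phi>\<close> is not a Herz--Schur
  multiplier.\<close>

definition cb_norm :: "('g, 'm) monoid_scheme \<Rightarrow> ('g \<Rightarrow> complex) \<Rightarrow> ennreal"
  where "cb_norm G \<phi> =
    Inf {ennreal (sup_norm G ip \<xi> * sup_norm G ip \<eta>) | (H :: ('g + 'g \<Rightarrow> complex) set) ip \<xi> \<eta>.
      herz_schur_representation G \<phi> fscale H ip \<xi> \<eta>}"

lemma cb_norm_le:
  fixes scale :: "complex \<Rightarrow> 'h::ab_group_add \<Rightarrow> 'h" and \<phi> :: "'g \<Rightarrow> complex"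
  assumes rep: "herz_schur_representation G \<phi> scale H ip \<xi> \<eta>"
  shows "cb_norm G \<phi> \<le> ennreal (sup_norm G ip \<xi> * sup_norm G ip \<eta>)"
proof -
  interpret complex_hilbert_space scale H ip
    using rep by (simp add: herz_schur_representation_def)
  have \<xi>: "\<And>x. x \<in> carrier G \<Longrightarrow> \<xi> x \<in> H" and \<eta>: "\<And>x. x \<in> carrier G \<Longrightarrow> \<eta> x \<in> H"
    using rep by (auto simp: herz_schur_representation_def)
  define P where
    "P = {w \<in> H. \<forall>x\<in>carrier G. ip w (\<xi> x) = 0 \<and> ip w (\<eta> x) = 0}"
  define M where "M = {v \<in> H. \<forall>w\<in>P. ip v w = 0}"
  define F :: "'h \<Rightarrow> 'g + 'g \<Rightarrow> complex" where
    "F v = case_sum (\<lambda>x. if x \<in> carrier G then ip v (\<xi> x) else 0)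
                    (\<lambda>x. if x \<in> carrier G then ip v (\<eta> x) else 0)" for v
  define R where "R = inv_into M F"
  define ip' where "ip' = (\<lambda>a b. ip (R a) (R b))"
  have PH: "P \<subseteq> H" and MH: "M \<subseteq> H" by (auto simp: P_def M_def)
  have PH': "\<And>v. v \<in> P \<Longrightarrow> v \<in> H" and MH': "\<And>v. v \<in> M \<Longrightarrow> v \<in> H" by (auto simp: P_def M_def)
  have M_add: "x + y \<in> M" if "x \<in> M" "y \<in> M" for x y
    using that PH' by (auto simp: M_def add_mem ip_add_left)
  have M_diff: "x - y \<in> M" if "x \<in> M" "y \<in> M" for x y
    using that PH' by (auto simp: M_def diff_mem ip_diff_left)
  have M_scale: "scale c x \<in> M" if "x \<in> M" for x c
    using that PH' by (auto simp: M_def scale_mem ip_scale_left)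
  have M_zero: "0 \<in> M"
    using PH' by (auto simp: M_def zero_mem ip_zero_left)
  have \<xi>M: "\<xi> x \<in> M" and \<eta>M: "\<eta> x \<in> M" if x: "x \<in> carrier G" for x
  proof -
    have "ip (\<xi> x) w = 0 \<and> ip (\<eta> x) w = 0" if "w \<in> P" for w
      using that x ip_cnj[of w "\<xi> x"] ip_cnj[of w "\<eta> x"] \<xi>[OF x] \<eta>[OF x] by (auto simp: P_def)
    then show "\<xi> x \<in> M" "\<eta> x \<in> M" using \<xi>[OF x] \<eta>[OF x] by (auto simp: M_def)
  qed
  have F_add: "F (x + y) = F x + F y" if "x \<in> M" "y \<in> M" for x y
    using that by (auto simp: MH' \<xi> \<eta> F_def fun_eq_iff ip_add_left split: sum.split)
  have F_diff: "F (x - y) = F x - F y" if "x \<in> M" "y \<in> M" for x y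
    using that by (auto simp: MH' \<xi> \<eta> F_def fun_eq_iff ip_diff_left split: sum.split)
  have F_scale: "F (scale c x) = fscale c (F x)" if "x \<in> M" for x c
    using that by (auto simp: MH' \<xi> \<eta> F_def fscale_def fun_eq_iff ip_scale_left split: sum.split)
  have F_inj: "inj_on F M"
  proof (rule inj_onI)
    fix x y assume xy: "x \<in> M" "y \<in> M" "F x = F y"
    then have "F (x - y) = 0" by (simp add: F_diff)
    then have z: "F (x - y) s = 0" for s by simp
    have "ip (x - y) (\<xi> g) = 0 \<and> ip (x - y) (\<eta> g) = 0" if "g \<in> carrier G" for g
      using z[of "Inl g"] z[of "Inr g"] that by (simp add: F_def)
    then have "x - y \<in> P"
      using MH'[OF M_diff[OF xy(1,2)]] by (simp add: P_def)
    then have "ip (x - y) (x - y) = 0"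
      using M_diff[OF xy(1,2)] by (simp add: M_def)
    then show "x = y"
      using ip_self_eq_0[OF MH'[OF M_diff[OF xy(1,2)]]] by simp
  qed
  have R: "R (F x) = x" if "x \<in> M" for x
    using that F_inj by (simp add: R_def)
  have ip': "ip' (F x) (F y) = ip x y" if "x \<in> M" "y \<in> M" for x y
    using that by (simp add: ip'_def R)
  have hn: "hnorm ip' (F x) = hnorm ip x" if "x \<in> M" for x
    using that by (simp add: hnorm_def ip')
  interpret V: vector_space "fscale :: complex \<Rightarrow> ('g + 'g \<Rightarrow> complex) \<Rightarrow> _"
    by (rule vector_space_fscale)
  have "complex_hilbert_space fscale (F ` M) ip'"
  proof
    have "0 = F 0" using F_diff[OF M_zero M_zero] by simp
    then have "0 \<in> F ` M" using M_zero by blast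
    moreover have "a + b \<in> F ` M" if "a \<in> F ` M" "b \<in> F ` M" for a b
      using that M_add by (auto simp flip: F_add)
    moreover have "fscale c a \<in> F ` M" if "a \<in> F ` M" for a c
      using that M_scale by (auto simp flip: F_scale)
    ultimately show "V.subspace (F ` M)"
      by (simp add: V.subspace_def)
    show "ip' (a + b) c = ip' a c + ip' b c"
      if "a \<in> F ` M" "b \<in> F ` M" "c \<in> F ` M" for a b c
      using that by (auto simp: ip' MH' M_add ip_add_left simp flip: F_add)
    show "ip' (fscale c a) b = c * ip' a b" if "a \<in> F ` M" "b \<in> F ` M" for a b c
      using that by (auto simp: ip' MH' M_scale ip_scale_left simp flip: F_scale)
    show "ip' b a = cnj (ip' a b)" if "a \<in> F ` M" "b \<in> F ` M" for a b
      using that by (auto simp: ip' intro!: ip_cnj MH')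
    show "0 \<le> Re (ip' a a)" if "a \<in> F ` M" for a
      using that by (auto simp: ip' intro!: ip_self_nonneg MH')
    show "a = 0" if a: "a \<in> F ` M" "ip' a a = 0" for a
    proof -
      obtain x where x: "x \<in> M" "a = F x" using a by auto
      then have "x = 0" using ip_self_eq_0[of x] a MH by (auto simp: ip')
      then show ?thesis using x \<open>0 = F 0\<close> by simp
    qed
    show "\<exists>a\<in>F ` M. (\<lambda>n. hnorm ip' (X n - a)) \<longlonglongrightarrow> 0"
      if X: "\<And>n::nat. X n \<in> F ` M"
        and C: "\<And>e. e > 0 \<Longrightarrow> \<exists>N. \<forall>m\<ge>N. \<forall>n\<ge>N. hnorm ip' (X m - X n) < e" for X
    proof -
      have "\<forall>n. \<exists>y. y \<in> M \<and> X n = F y" using X by blast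
      then obtain Y where Y: "\<And>n. Y n \<in> M" "\<And>n. X n = F (Y n)"
        by metis
      have XY: "hnorm ip' (X m - X n) = hnorm ip (Y m - Y n)" for m n
        by (simp add: Y M_diff hn flip: F_diff)
      obtain y where y: "y \<in> H" and lim: "(\<lambda>n. hnorm ip (Y n - y)) \<longlonglongrightarrow> 0"
        using complete_carrier[OF MH'[OF Y(1)] C[unfolded XY]] by blast
      have "y \<in> M"
      proof -
        have "ip y w = 0" if w: "w \<in> P" for w
        proof -
          have wH: "w \<in> H" using w PH by auto
          have YH: "Y n \<in> H" for n using Y(1) by (rule MH')
          have "ip y w = - ip (Y n - y) w" for n
            using Y(1)[of n] w y wH YH[of n] by (simp add: ip_diff_left M_def)
          then have "cmod (ip y w) \<le> hnorm ip (Y n - y) * hnorm ip w" for n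
            using Cauchy_Schwarz[OF diff_mem[OF YH[of n] y] wH] by (metis norm_minus_cancel)
          moreover have "(\<lambda>n. hnorm ip (Y n - y) * hnorm ip w) \<longlonglongrightarrow> 0"
            using tendsto_mult_right[OF lim, of "hnorm ip w"] by simp
          ultimately have "cmod (ip y w) \<le> 0"
            by (meson LIMSEQ_le_const)
          then show ?thesis by simp
        qed
        then show ?thesis using y by (simp add: M_def)
      qed
      then have "(\<lambda>n. hnorm ip' (X n - F y)) \<longlonglongrightarrow> 0"
        using lim by (simp add: Y M_diff hn flip: F_diff)
      then show ?thesis using \<open>y \<in> M\<close> by blast
    qed
  qed
  then have "herz_schur_representation G \<phi> fscale (F ` M) ip' (F \<circ> \<xi>) (F \<circ> \<eta>)"
    using rep \<xi>M \<eta>M by (simp add: herz_schur_representation_def hn ip' cong: image_cong_simp)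
  moreover have "sup_norm G ip' (F \<circ> \<xi>) = sup_norm G ip \<xi>"
    and "sup_norm G ip' (F \<circ> \<eta>) = sup_norm G ip \<eta>"
    using \<xi>M \<eta>M by (simp_all add: sup_norm_def hn cong: image_cong_simp)
  ultimately show ?thesis
    unfolding cb_norm_def
    by (intro Inf_lower CollectI exI[of _ "F ` M"] exI[of _ ip'] exI[of _ "F \<circ> \<xi>"] exI[of _ "F \<circ> \<eta>"])
      (simp only: simp_thms)
qed

text \<open>A net in a set \<open>A\<close> of functions is rendered by its filter of eventualities on the function
  space; \<open>weakly_amenable_if_net\<close> covers nets over arbitrary directed sets. The compact subsets
  of a discrete group are the finite ones.\<close>

definition weakly_amenable :: "('g, 'm) monoid_scheme \<Rightarrow> bool"
  where "weakly_amenable G \<longleftrightarrow>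
    (\<exists>A F. A \<subseteq> fourier_algebra G \<and> (SUP \<phi>\<in>A. cb_norm G \<phi>) < \<infinity> \<and>
      F \<noteq> bot \<and> F \<le> principal A \<and>
      (\<forall>K. K \<subseteq> carrier G \<and> finite K \<longrightarrow> uniform_limit K (\<lambda>\<phi>. \<phi>) (\<lambda>x. 1) F))"

lemma weakly_amenable_if_net:
  fixes J :: "'i set" and r :: "'i \<Rightarrow> 'i \<Rightarrow> bool" and \<phi> :: "'i \<Rightarrow> 'g \<Rightarrow> complex"
  assumes "J \<noteq> {}"
    and refl: "\<And>i. i \<in> J \<Longrightarrow> r i i"
    and trans: "\<And>i j k. \<lbrakk>i \<in> J; j \<in> J; k \<in> J; r i j; r j k\<rbrakk> \<Longrightarrow> r i k"
    and directed: "\<And>i j. \<lbrakk>i \<in> J; j \<in> J\<rbrakk> \<Longrightarrow> \<exists>k\<in>J. r i k \<and> r j k"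
    and "\<And>i. i \<in> J \<Longrightarrow> \<phi> i \<in> fourier_algebra G"
    and "(SUP i\<in>J. cb_norm G (\<phi> i)) < \<infinity>"
    and conv: "\<And>K e. \<lbrakk>K \<subseteq> carrier G; finite K; e > 0\<rbrakk> \<Longrightarrow>
      \<exists>i\<in>J. \<forall>j\<in>J. r i j \<longrightarrow> (\<forall>x\<in>K. dist (\<phi> j x) 1 < e)"
  shows "weakly_amenable G"
proof -
  define T where "T i = \<phi> ` {j \<in> J. r i j}" for i
  define F where "F = (INF i\<in>J. principal (T i))"
  have ev: "eventually P F \<longleftrightarrow> (\<exists>i\<in>J. \<forall>j\<in>J. r i j \<longrightarrow> P (\<phi> j))" for P
  proof -
    have "eventually P F \<longleftrightarrow> (\<exists>i\<in>J. eventually P (principal (T i)))"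
      unfolding F_def
    proof (rule eventually_INF_base[OF \<open>J \<noteq> {}\<close>])
      fix a b assume "a \<in> J" "b \<in> J"
      then obtain k where k: "k \<in> J" "r a k" "r b k" using directed by blast
      then have "T k \<subseteq> T a \<inter> T b"
        using trans[OF \<open>a \<in> J\<close> k(1)] trans[OF \<open>b \<in> J\<close> k(1)] by (auto simp: T_def)
      then show "\<exists>x\<in>J. principal (T x) \<le> inf (principal (T a)) (principal (T b))"
        using k by auto
    qed
    then show ?thesis by (auto simp: eventually_principal T_def)
  qed
  have "F \<noteq> bot"
    using refl by (auto simp: trivial_limit_def ev)
  moreover have "F \<le> principal (\<phi> ` J)"
    using \<open>J \<noteq> {}\<close> by (auto simp: le_principal ev)
  moreover have "uniform_limit K (\<lambda>\<phi>. \<phi>) (\<lambda>x. 1) F" if "K \<subseteq> carrier G" "finite K" for K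
    using conv[OF that] by (auto simp: uniform_limit_iff ev)
  moreover have "\<phi> ` J \<subseteq> fourier_algebra G"
    using assms(5) by blast
  moreover have "(SUP \<psi>\<in>\<phi> ` J. cb_norm G \<psi>) < \<infinity>"
    using assms(6) by (simp add: image_image)
  ultimately show ?thesis
    unfolding weakly_amenable_def by blast
qed

definition semidirect_product ::
    "('n, 'a) monoid_scheme \<Rightarrow> ('h, 'b) monoid_scheme \<Rightarrow> ('h \<Rightarrow> 'n \<Rightarrow> 'n) \<Rightarrow> ('n \<times> 'h) monoid"
  where "semidirect_product N H \<alpha> =
    \<lparr>carrier = carrier N \<times> carrier H,
     monoid.mult = (\<lambda>(n, h) (n', h'). (n \<otimes>\<^bsub>N\<^esub> \<alpha> h n', h \<otimes>\<^bsub>H\<^esub> h')),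
     one = (\<one>\<^bsub>N\<^esub>, \<one>\<^bsub>H\<^esub>)\<rparr>"

lemma group_semidirect_product:
  assumes "group N" "group H"
    and closed: "\<And>h n. \<lbrakk>h \<in> carrier H; n \<in> carrier N\<rbrakk> \<Longrightarrow> \<alpha> h n \<in> carrier N"
    and mult: "\<And>h n n'. \<lbrakk>h \<in> carrier H; n \<in> carrier N; n' \<in> carrier N\<rbrakk>
      \<Longrightarrow> \<alpha> h (n \<otimes>\<^bsub>N\<^esub> n') = \<alpha> h n \<otimes>\<^bsub>N\<^esub> \<alpha> h n'"
    and comp: "\<And>h h' n. \<lbrakk>h \<in> carrier H; h' \<in> carrier H; n \<in> carrier N\<rbrakk>
      \<Longrightarrow> \<alpha> (h \<otimes>\<^bsub>H\<^esub> h') n = \<alpha> h (\<alpha> h' n)"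
    and one: "\<And>n. n \<in> carrier N \<Longrightarrow> \<alpha> \<one>\<^bsub>H\<^esub> n = n"
  shows "group (semidirect_product N H \<alpha>)"
proof -
  interpret N: group N by fact
  interpret H: group H by fact
  show ?thesis
  proof (rule groupI)
    show "\<exists>y\<in>carrier (semidirect_product N H \<alpha>).
        y \<otimes>\<^bsub>semidirect_product N H \<alpha>\<^esub> x = \<one>\<^bsub>semidirect_product N H \<alpha>\<^esub>"
      if "x \<in> carrier (semidirect_product N H \<alpha>)" for x
    proof -
      have "x \<in> carrier N \<times> carrier H"
        using that by (simp add: semidirect_product_def)
      then obtain n h where x: "x = (n, h)" "n \<in> carrier N" "h \<in> carrier H"
        by blast
      let ?y = "(inv\<^bsub>N\<^esub> (\<alpha> (inv\<^bsub>H\<^esub> h) n), inv\<^bsub>H\<^esub> h)"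
      have "?y \<in> carrier (semidirect_product N H \<alpha>)"
        and "?y \<otimes>\<^bsub>semidirect_product N H \<alpha>\<^esub> x = \<one>\<^bsub>semidirect_product N H \<alpha>\<^esub>"
        using x closed by (simp_all add: semidirect_product_def)
      then show ?thesis by blast
    qed
  qed (auto simp: semidirect_product_def closed mult comp one N.m_assoc H.m_assoc)
qed

definition wreath_product ::
    "('a, 'c) monoid_scheme \<Rightarrow> ('b, 'd) monoid_scheme \<Rightarrow> (('b \<Rightarrow> 'a) \<times> 'b) monoid"
  where "wreath_product \<Lambda> \<Gamma> =
    semidirect_product (sum_group (carrier \<Gamma>) (\<lambda>_. \<Lambda>)) \<Gamma>
      (\<lambda>g f. \<lambda>t\<in>carrier \<Gamma>. f (inv\<^bsub>\<Gamma>\<^esub> g \<otimes>\<^bsub>\<Gamma>\<^esub> t))"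

lemma group_wreath_product:
  assumes "group \<Lambda>" "group \<Gamma>"
  shows "group (wreath_product \<Lambda> \<Gamma>)"
proof -
  interpret L: group \<Lambda> by fact
  interpret G: group \<Gamma> by fact
  show ?thesis
    unfolding wreath_product_def
  proof (rule group_semidirect_product)
    fix g f assume g: "g \<in> carrier \<Gamma>" and f: "f \<in> carrier (sum_group (carrier \<Gamma>) (\<lambda>_. \<Lambda>))"
    have "{t \<in> carrier \<Gamma>. f (inv\<^bsub>\<Gamma>\<^esub> g \<otimes>\<^bsub>\<Gamma>\<^esub> t) \<noteq> \<one>\<^bsub>\<Lambda>\<^esub>}
        \<subseteq> (\<lambda>s. g \<otimes>\<^bsub>\<Gamma>\<^esub> s) ` {s \<in> carrier \<Gamma>. f s \<noteq> \<one>\<^bsub>\<Lambda>\<^esub>}"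
    proof
      fix t assume t: "t \<in> {t \<in> carrier \<Gamma>. f (inv\<^bsub>\<Gamma>\<^esub> g \<otimes>\<^bsub>\<Gamma>\<^esub> t) \<noteq> \<one>\<^bsub>\<Lambda>\<^esub>}"
      then have "t = g \<otimes>\<^bsub>\<Gamma>\<^esub> (inv\<^bsub>\<Gamma>\<^esub> g \<otimes>\<^bsub>\<Gamma>\<^esub> t)"
        using g by (simp flip: G.m_assoc)
      then show "t \<in> (\<lambda>s. g \<otimes>\<^bsub>\<Gamma>\<^esub> s) ` {s \<in> carrier \<Gamma>. f s \<noteq> \<one>\<^bsub>\<Lambda>\<^esub>}"
        using t g by blast
    qed
    moreover have "finite {s \<in> carrier \<Gamma>. f s \<noteq> \<one>\<^bsub>\<Lambda>\<^esub>}"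
      using f by (simp add: carrier_sum_group)
    ultimately have "finite {t \<in> carrier \<Gamma>. f (inv\<^bsub>\<Gamma>\<^esub> g \<otimes>\<^bsub>\<Gamma>\<^esub> t) \<noteq> \<one>\<^bsub>\<Lambda>\<^esub>}"
      by (meson finite_imageI finite_subset)
    then show "(\<lambda>t\<in>carrier \<Gamma>. f (inv\<^bsub>\<Gamma>\<^esub> g \<otimes>\<^bsub>\<Gamma>\<^esub> t)) \<in> carrier (sum_group (carrier \<Gamma>) (\<lambda>_. \<Lambda>))"
      using f g by (auto simp: carrier_sum_group PiE_iff cong: conj_cong)
  next
    show "group (sum_group (carrier \<Gamma>) (\<lambda>_. \<Lambda>))" using assms by simp
  next
    fix g g' f assume "g \<in> carrier \<Gamma>" "g' \<in> carrier \<Gamma>"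
    then show "(\<lambda>t\<in>carrier \<Gamma>. f (inv\<^bsub>\<Gamma>\<^esub> (g \<otimes>\<^bsub>\<Gamma>\<^esub> g') \<otimes>\<^bsub>\<Gamma>\<^esub> t)) =
      (\<lambda>t\<in>carrier \<Gamma>. (\<lambda>t\<in>carrier \<Gamma>. f (inv\<^bsub>\<Gamma>\<^esub> g' \<otimes>\<^bsub>\<Gamma>\<^esub> t)) (inv\<^bsub>\<Gamma>\<^esub> g \<otimes>\<^bsub>\<Gamma>\<^esub> t))"
      by (auto simp: G.inv_mult_group G.m_assoc intro!: restrict_ext)
  next
    fix f assume "f \<in> carrier (sum_group (carrier \<Gamma>) (\<lambda>_. \<Lambda>))"
    then show "(\<lambda>t\<in>carrier \<Gamma>. f (inv\<^bsub>\<Gamma>\<^esub> \<one>\<^bsub>\<Gamma>\<^esub> \<otimes>\<^bsub>\<Gamma>\<^esub> t)) = f"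
      by (auto simp: carrier_sum_group PiE_iff fun_eq_iff extensional_def)
  qed (simp_all add: assms fun_eq_iff)
qed

definition SL2Z :: "(int^2^2) monoid"
  where "SL2Z = \<lparr>carrier = {A. det A = 1}, monoid.mult = (**), one = mat 1\<rparr>"

definition Z2 :: "(int^2) monoid"
  where "Z2 = \<lparr>carrier = UNIV, monoid.mult = (+), one = 0\<rparr>"

definition SL2Z_Z2 :: "((int^2) \<times> (int^2^2)) monoid"
  where "SL2Z_Z2 = semidirect_product Z2 SL2Z (*v)"

lemma group_SL2Z: "group SL2Z"
proof (rule groupI)
  show "\<exists>B\<in>carrier SL2Z. B \<otimes>\<^bsub>SL2Z\<^esub> A = \<one>\<^bsub>SL2Z\<^esub>" if "A \<in> carrier SL2Z" for A
  proof -
    let ?B = "vector [vector [A$2$2, - (A$1$2)], vector [- (A$2$1), A$1$1]] :: int^2^2"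
    have "A$1$1 * A$2$2 - A$1$2 * A$2$1 = 1"
      using that by (simp add: SL2Z_def det_2)
    then have "det ?B = 1" "?B ** A = mat 1"
      by (simp_all add: det_2 vec_eq_iff forall_2 matrix_matrix_mult_def mat_def sum_2 algebra_simps)
    then show ?thesis by (auto simp: SL2Z_def)
  qed
qed (auto simp: SL2Z_def det_mul det_I matrix_mul_assoc matrix_mul_lid)

lemma group_SL2Z_Z2: "group SL2Z_Z2"
  unfolding SL2Z_Z2_def
proof (rule group_semidirect_product)
  show "group Z2"
  proof (rule groupI)
    show "\<exists>y\<in>carrier Z2. y \<otimes>\<^bsub>Z2\<^esub> x = \<one>\<^bsub>Z2\<^esub>" for x
      by (rule bexI[of _ "- x"]) (simp_all add: Z2_def)
  qed (auto simp: Z2_def add.assoc)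
  show "group SL2Z" by (rule group_SL2Z)
  show "A *v (n \<otimes>\<^bsub>Z2\<^esub> n') = (A *v n) \<otimes>\<^bsub>Z2\<^esub> (A *v n')" for A n n'
    by (simp add: Z2_def matrix_vector_right_distrib)
  show "(A \<otimes>\<^bsub>SL2Z\<^esub> B) *v n = A *v (B *v n)" for A B n
    by (simp add: SL2Z_def matrix_vector_mul_assoc)
  show "\<one>\<^bsub>SL2Z\<^esub> *v n = n" for n
    by (simp add: SL2Z_def)
qed (simp add: Z2_def)

end

theory Submission
  imports Defs "HOL-Algebra.Multiplicative_Group" "HOL-Real_Asymp.Real_Asymp"
begin

text \<open>Both groups contain an abelian normal subgroup \<open>N\<close>, possibly after passing to a subgroup of the
  wreath product, and weak amenability would produce a mean on \<open>N\<close> minus the identity that is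
  invariant under conjugation (theorem \<open>kernel_approximable_conjugation_invariant_mean\<close>). For
  \<open>SL(2,\<int>) \<ltimes> \<int>\<^sup>2\<close> this would be a mean on the non-zero vectors of \<open>\<int>\<^sup>2\<close> invariant under
  \<open>SL(2,\<int>)\<close>, which the action on the four quadrants excludes (\<open>no_SL2Z_invariant_mean\<close>). For the
  wreath product \<open>N\<close> is a sum of cyclic groups over \<open>\<Gamma>\<close>, and the supports of its elements carry the
  mean over to an invariant mean on \<open>\<Gamma>\<close>, which is not amenable.

  The mean on \<open>N\<close> comes from an optimality argument. Among the bounds for which functions with such
  Herz--Schur norms approximate \<open>1\<close>, let \<open>C\<close> be the infimum, and let
  \<open>\<phi> (inv y \<otimes> x) = \<langle>\<xi> x, \<eta> y\<rangle>\<close> be close to \<open>1\<close> on a large finite set with a bound close to \<open>C\<close>. The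
  averages of the translates of \<open>\<phi>\<close> also approximate \<open>1\<close>, hence cannot have a much smaller bound. So the
  average of the vectors \<open>\<xi> (x \<otimes> g)\<close>, for \<open>g\<close> in a given finite set, has almost maximal length for
  some \<open>x\<close>, and by uniform convexity these vectors nearly coincide; likewise for \<open>\<eta>\<close>
  (\<open>almost_invariant_kernels\<close>). As \<open>N\<close> is amenable, the inner products can be made invariant
  under \<open>N\<close> beforehand, so that the vectors \<open>\<xi> (x \<otimes> a \<otimes> g)\<close> and \<open>\<xi> (x \<otimes> a)\<close> are close uniformly for \<open>a\<close> in
  \<open>N\<close>. It follows that the transform \<open>f\<close> of the restriction of \<open>\<phi>\<close> to \<open>N\<close>, a function on the dual of
  \<open>N\<close>, is almost invariant under conjugation in \<open>L\<^sup>1\<close>, with \<open>L\<^sup>1\<close>-norm bounded independently of \<open>\<phi>\<close>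
  (\<open>mean_norm_transform_le\<close>, \<open>transform_almost_invariant\<close>). Then \<open>sqrt \<bar>f\<bar>\<close> is almost invariant in
  \<open>L\<^sup>2\<close>, and the squares of its Fourier coefficients are the weights of an almost invariant mean on
  \<open>N\<close>. Enough of its mass lies off the identity, since otherwise \<open>sqrt \<bar>f\<bar>\<close> would be nearly constant
  and \<open>f\<close> could not have many Fourier coefficients close to \<open>1\<close> (\<open>variance_sqrt_norm_ge\<close>).

  Three devices keep all this elementary. Elements of the Fourier algebra are truncated to finitely
  supported functions, so that \<open>f\<close> is a trigonometric polynomial. Vectors in Hilbert spaces are
  represented by their Gram matrices, which can be averaged. Integration over the dual of \<open>N\<close> is
  an invariant mean on the discrete group of all characters.\<close>

section \<open>Finitely additive means\<close>

lemma bounded_fun_add [intro]: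
  fixes f h :: "'x \<Rightarrow> 'b::real_normed_vector"
  assumes "bounded (f ` X)" "bounded (h ` X)"
  shows "bounded ((\<lambda>t. f t + h t) ` X)"
proof -
  obtain a b where "\<forall>t\<in>X. norm (f t) \<le> a" "\<forall>t\<in>X. norm (h t) \<le> b"
    using assms by (auto simp: bounded_iff)
  then have "norm (f t + h t) \<le> a + b" if "t \<in> X" for t
    using that norm_triangle_le[of "f t" "h t" "a + b"] by fastforce
  then show ?thesis by (auto simp: bounded_iff)
qed

lemma bounded_fun_mult [intro]:
  fixes f h :: "'x \<Rightarrow> 'b::real_normed_algebra"
  assumes "bounded (f ` X)" "bounded (h ` X)"
  shows "bounded ((\<lambda>t. f t * h t) ` X)"
proof -
  obtain a b where *: "\<forall>t\<in>X. norm (f t) \<le> a" "\<forall>t\<in>X. norm (h t) \<le> b"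
    using assms by (auto simp: bounded_iff)
  then have "norm (f t * h t) \<le> a * b" if "t \<in> X" for t
    by (meson "*" mult_mono norm_ge_zero norm_mult_ineq order_trans that)
  then show ?thesis by (auto simp: bounded_iff)
qed

lemma bounded_fun_const [intro, simp]: "bounded ((\<lambda>t. c) ` X)"
  by (rule finite_imp_bounded) (rule finite_subset[of _ "{c}"], auto)

lemma bounded_fun_le:
  assumes "bounded (f ` X)" "\<And>t. t \<in> X \<Longrightarrow> norm (h t) \<le> norm (f t)"
  shows "bounded (h ` X)"
  using assms unfolding bounded_iff by (auto intro: order_trans)

lemma bounded_fun_leI: "(\<And>t. t \<in> X \<Longrightarrow> norm (h t) \<le> B) \<Longrightarrow> bounded (h ` X)"
  by (auto simp: bounded_iff)

lemma bounded_fun_minus [intro]: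
  fixes f :: "'x \<Rightarrow> 'b::real_normed_vector"
  shows "bounded (f ` X) \<Longrightarrow> bounded ((\<lambda>t. - f t) ` X)"
  by (erule bounded_fun_le) simp

lemma bounded_fun_diff [intro]:
  fixes f h :: "'x \<Rightarrow> 'b::real_normed_vector"
  assumes "bounded (f ` X)" "bounded (h ` X)"
  shows "bounded ((\<lambda>t. f t - h t) ` X)"
  using bounded_fun_add[OF assms(1) bounded_fun_minus[OF assms(2)]] by simp

lemma bounded_fun_sum [intro]:
  fixes f :: "'i \<Rightarrow> 'x \<Rightarrow> 'b::real_normed_vector"
  assumes "\<And>i. i \<in> I \<Longrightarrow> bounded (f i ` X)"
  shows "bounded ((\<lambda>t. \<Sum>i\<in>I. f i t) ` X)"
  using assms by (induction I rule: infinite_finite_induct) auto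

lemma bounded_fun_norm [intro]:
  "bounded (f ` X) \<Longrightarrow> bounded ((\<lambda>t. norm (f t)) ` X)"
  by (erule bounded_fun_le) simp

lemma bounded_fun_abs [intro]:
  fixes f :: "'x \<Rightarrow> real"
  shows "bounded (f ` X) \<Longrightarrow> bounded ((\<lambda>t. \<bar>f t\<bar>) ` X)"
  by (erule bounded_fun_le) simp

lemma bounded_fun_power [intro]:
  fixes f :: "'x \<Rightarrow> real"
  assumes "bounded (f ` X)"
  shows "bounded ((\<lambda>t. (f t) ^ n) ` X)"
  using assms by (induction n) auto

lemma bounded_fun_Re [intro]: "bounded (f ` X) \<Longrightarrow> bounded ((\<lambda>t. Re (f t)) ` X)"
  by (erule bounded_fun_le) (simp add: abs_Re_le_cmod)

lemma bounded_fun_Im [intro]: "bounded (f ` X) \<Longrightarrow> bounded ((\<lambda>t. Im (f t)) ` X)"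
  by (erule bounded_fun_le) (simp add: abs_Im_le_cmod)

lemma bounded_fun_cnj [intro]: "bounded (f ` X) \<Longrightarrow> bounded ((\<lambda>t. cnj (f t)) ` X)"
  by (erule bounded_fun_le) simp

lemma bounded_fun_reindex:
  "bounded (f ` X) \<Longrightarrow> (\<And>t. t \<in> X \<Longrightarrow> T t \<in> X) \<Longrightarrow> bounded ((\<lambda>t. f (T t)) ` X)"
  by (rule bounded_subset) auto

locale mean =
  fixes X :: "'x set" and m :: "('x \<Rightarrow> real) \<Rightarrow> real"
  assumes add: "bounded (f ` X) \<Longrightarrow> bounded (h ` X) \<Longrightarrow> m (\<lambda>t. f t + h t) = m f + m h"
    and scale: "bounded (f ` X) \<Longrightarrow> m (\<lambda>t. c * f t) = c * m f"
    and nonneg: "bounded (f ` X) \<Longrightarrow> (\<And>t. t \<in> X \<Longrightarrow> 0 \<le> f t) \<Longrightarrow> 0 \<le> m f"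
    and one: "m (\<lambda>t. 1) = 1"
begin

lemma const: "m (\<lambda>t. c) = c"
  using scale[of "\<lambda>t. 1" c] one by simp

lemma diff: "bounded (f ` X) \<Longrightarrow> bounded (h ` X) \<Longrightarrow> m (\<lambda>t. f t - h t) = m f - m h"
  using add[of f "\<lambda>t. (-1) * h t"] scale[of h "-1"] bounded_fun_minus[of h X] by simp

lemma uminus: "bounded (f ` X) \<Longrightarrow> m (\<lambda>t. - f t) = - m f"
  using scale[of f "-1"] by simp

lemma mono:
  assumes "bounded (f ` X)" "bounded (h ` X)" "\<And>t. t \<in> X \<Longrightarrow> f t \<le> h t"
  shows "m f \<le> m h"
  using nonneg[of "\<lambda>t. h t - f t"] diff[of h f] assms by (simp add: bounded_fun_diff)

lemma cong: "bounded (f ` X) \<Longrightarrow> (\<And>t. t \<in> X \<Longrightarrow> f t = h t) \<Longrightarrow> m f = m h"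
  by (intro antisym mono) (auto cong: image_cong_simp)

lemma le_const: "bounded (f ` X) \<Longrightarrow> (\<And>t. t \<in> X \<Longrightarrow> f t \<le> c) \<Longrightarrow> m f \<le> c"
  using mono[of f "\<lambda>t. c"] by (simp add: const)

lemma abs_le: "bounded (f ` X) \<Longrightarrow> bounded (h ` X) \<Longrightarrow> (\<And>t. t \<in> X \<Longrightarrow> \<bar>f t\<bar> \<le> h t) \<Longrightarrow> \<bar>m f\<bar> \<le> m h"
  using mono[of f h] mono[of "\<lambda>t. - f t" h] uminus[of f] by (force simp: abs_le_iff)

lemma sum:
  assumes "\<And>i. i \<in> I \<Longrightarrow> bounded (f i ` X)"
  shows "m (\<lambda>t. \<Sum>i\<in>I. f i t) = (\<Sum>i\<in>I. m (f i))"
  using assms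
proof (induction I rule: infinite_finite_induct)
  case (insert i I)
  then show ?case using add[of "f i" "\<lambda>t. \<Sum>i\<in>I. f i t"] by (simp add: bounded_fun_sum)
qed (simp_all add: const)

definition cmean :: "('x \<Rightarrow> complex) \<Rightarrow> complex"
  where "cmean F = Complex (m (\<lambda>t. Re (F t))) (m (\<lambda>t. Im (F t)))"

lemma Re_cmean [simp]: "Re (cmean F) = m (\<lambda>t. Re (F t))"
  and Im_cmean [simp]: "Im (cmean F) = m (\<lambda>t. Im (F t))"
  by (simp_all add: cmean_def)

lemma cmean_diff:
  "bounded (F ` X) \<Longrightarrow> bounded (F' ` X) \<Longrightarrow> cmean (\<lambda>t. F t - F' t) = cmean F - cmean F'"
  by (simp add: complex_eq_iff diff bounded_fun_Re bounded_fun_Im)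

lemma cmean_scale: "bounded (F ` X) \<Longrightarrow> cmean (\<lambda>t. c * F t) = c * cmean F"
proof -
  assume F: "bounded (F ` X)"
  have b: "bounded ((\<lambda>t. a * Re (F t)) ` X)" "bounded ((\<lambda>t. a * Im (F t)) ` X)" for a
    using F by auto
  show ?thesis
    using F by (simp add: complex_eq_iff add diff scale b bounded_fun_Re bounded_fun_Im)
qed

lemma cmean_const: "cmean (\<lambda>t. c) = c"
  by (simp add: complex_eq_iff const)

lemma cmean_cnj: "bounded (F ` X) \<Longrightarrow> cmean (\<lambda>t. cnj (F t)) = cnj (cmean F)"
  by (simp add: complex_eq_iff uminus bounded_fun_Im)

lemma cmean_of_real: "cmean (\<lambda>t. of_real (f t)) = of_real (m f)"
  by (simp add: complex_eq_iff const)

lemma cmean_sum: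
  assumes "\<And>i. i \<in> I \<Longrightarrow> bounded (F i ` X)"
  shows "cmean (\<lambda>t. \<Sum>i\<in>I. F i t) = (\<Sum>i\<in>I. cmean (F i))"
  using assms by (simp add: complex_eq_iff sum bounded_fun_Re bounded_fun_Im)

lemma cmean_cong: "bounded (F ` X) \<Longrightarrow> (\<And>t. t \<in> X \<Longrightarrow> F t = F' t) \<Longrightarrow> cmean F = cmean F'"
  using cong[of "\<lambda>t. Re (F t)" "\<lambda>t. Re (F' t)"] cong[of "\<lambda>t. Im (F t)" "\<lambda>t. Im (F' t)"]
  by (simp add: complex_eq_iff bounded_fun_Re bounded_fun_Im)

text \<open>Rotating the value of the mean onto the positive real axis reduces the estimate to real parts.\<close>

lemma norm_cmean_le:
  assumes F: "bounded (F ` X)" and h: "bounded (h ` X)" and le: "\<And>t. t \<in> X \<Longrightarrow> cmod (F t) \<le> h t"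
  shows "cmod (cmean F) \<le> m h"
proof -
  define u where "u = (if cmean F = 0 then 1 else cnj (cmean F) / cmod (cmean F))"
  have u: "cmod u = 1" by (simp add: u_def norm_divide)
  have "u * cmean F = of_real (cmod (cmean F))"
    using complex_norm_square[of "cmean F"] by (auto simp: u_def field_simps power2_eq_square)
  then have "cmod (cmean F) = Re (cmean (\<lambda>t. u * F t))"
    using F by (simp add: cmean_scale)
  also have "\<dots> = m (\<lambda>t. Re (u * F t))" by simp
  also have "\<dots> \<le> m h"
  proof (rule mono)
    show "bounded ((\<lambda>t. Re (u * F t)) ` X)"
      using F by (intro bounded_fun_Re bounded_fun_mult) auto
    show "Re (u * F t) \<le> h t" if "t \<in> X" for t
      using complex_Re_le_cmod[of "u * F t"] le[OF that] u by (simp add: norm_mult)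
  qed (rule h)
  finally show ?thesis .
qed

end

lemma amenable_iff_mean:
  "amenable G \<longleftrightarrow> (\<exists>m. mean (carrier G) m \<and>
    (\<forall>x\<in>carrier G. \<forall>f. bounded (f ` carrier G) \<longrightarrow> m (\<lambda>t. f (inv\<^bsub>G\<^esub> x \<otimes>\<^bsub>G\<^esub> t)) = m f))"
  unfolding amenable_def mean_def Let_def Ball_def mem_Collect_eq by (rule arg_cong[of _ _ Ex]) (rule ext, blast)

text \<open>Means are invariant in the limit as soon as they are approximately invariant: the means form
  a compact set for pointwise convergence, in which exact invariance is an intersection of closed
  conditions.\<close>

lemma mean_limit:
  fixes X :: "'x set" and T :: "'i \<Rightarrow> 'x \<Rightarrow> 'x"
  assumes T: "\<And>g t. g \<in> H \<Longrightarrow> t \<in> X \<Longrightarrow> T g t \<in> X"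
    and approx: "\<And>E e. finite E \<Longrightarrow> E \<subseteq> H \<Longrightarrow> e > 0 \<Longrightarrow>
      \<exists>m. mean X m \<and> (\<forall>g\<in>E. \<forall>f. (\<forall>t\<in>X. \<bar>f t\<bar> \<le> 1) \<longrightarrow> \<bar>m (\<lambda>t. f (T g t)) - m f\<bar> \<le> e)"
  shows "\<exists>m. mean X m \<and> (\<forall>g\<in>H. \<forall>f. bounded (f ` X) \<longrightarrow> m (\<lambda>t. f (T g t)) = m f)"
proof -
  \<comment> \<open>The means, set to zero at unbounded functions, lie in the compact product \<open>P\<close> of these intervals.\<close>
  define b :: "('x \<Rightarrow> real) \<Rightarrow> real" where
    "b f = (if bounded (f ` X) then SOME c. \<forall>t\<in>X. \<bar>f t\<bar> \<le> c else 0)" for f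
  have b: "\<bar>f t\<bar> \<le> b f" if f: "bounded (f ` X)" and t: "t \<in> X" for f t
  proof -
    have "\<exists>c. \<forall>t\<in>X. \<bar>f t\<bar> \<le> c" using f by (auto simp: bounded_iff)
    then have "\<forall>t\<in>X. \<bar>f t\<bar> \<le> b f" unfolding b_def by (simp add: f) (rule someI_ex)
    then show ?thesis using t by blast
  qed
  define P where "P = (\<Pi>\<^sub>E f\<in>(UNIV :: ('x \<Rightarrow> real) set). {- b f .. b f})"
  have "compactin (product_topology (\<lambda>i. euclidean) UNIV) P"
    unfolding P_def by (simp add: compactin_PiE)
  then have P: "compact P"
    unfolding euclidean_product_topology by simp
  have cont: "continuous_on UNIV (\<lambda>m::('x \<Rightarrow> real) \<Rightarrow> real. m f)" for f by simp
  define M where "M = {m :: ('x \<Rightarrow> real) \<Rightarrow> real. mean X m}"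
  have M: "closed M"
  proof -
    have "M = {m. (\<forall>f h. bounded (f ` X) \<longrightarrow> bounded (h ` X) \<longrightarrow> m (\<lambda>t. f t + h t) = m f + m h) \<and>
      (\<forall>f c. bounded (f ` X) \<longrightarrow> m (\<lambda>t. c * f t) = c * m f) \<and>
      (\<forall>f. bounded (f ` X) \<longrightarrow> (\<forall>t. t \<in> X \<longrightarrow> 0 \<le> f t) \<longrightarrow> 0 \<le> m f) \<and> m (\<lambda>t. 1) = 1}"
      unfolding M_def mean_def by blast
    then show ?thesis
      by (simp only:) (intro closed_Collect_conj closed_Collect_all closed_Collect_imp open_Collect_const
          closed_Collect_eq closed_Collect_le continuous_intros cont)
  qed
  define A where "A = (\<lambda>(g, e). M \<inter> {m. \<forall>f. (\<forall>t\<in>X. \<bar>f t\<bar> \<le> 1) \<longrightarrow> \<bar>m (\<lambda>t. f (T g t)) - m f\<bar> \<le> e})"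
  have A: "closed (A i)" for i
    unfolding A_def split_beta
    by (intro closed_Int M closed_Collect_all closed_Collect_imp open_Collect_const closed_Collect_le
        continuous_intros cont)
  have in_P: "\<exists>m'. mean X m' \<and> m' \<in> P \<and> (\<forall>f. bounded (f ` X) \<longrightarrow> m' f = m f)" if m: "mean X m" for m
  proof -
    interpret mean X m by fact
    define m' where "m' f = (if bounded (f ` X) then m f else 0)" for f
    have "mean X m'"
      by unfold_locales (auto simp: m'_def bounded_fun_add add scale one nonneg bounded_fun_mult)
    moreover have "m' f \<in> {- b f .. b f}" for f
    proof (cases "bounded (f ` X)")
      case True
      then have "\<bar>m f\<bar> \<le> m (\<lambda>t. b f)" using b by (intro abs_le) auto
      then show ?thesis by (auto simp: m'_def True const)
    qed (simp add: m'_def b_def)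
    ultimately show ?thesis by (intro exI[of _ m']) (auto simp: P_def m'_def)
  qed
  have "P \<inter> (\<Inter>i\<in>insert None (Some ` (H \<times> {0<..})). case i of None \<Rightarrow> M | Some i \<Rightarrow> A i) \<noteq> {}"
  proof (rule compact_imp_fip_image[OF P])
    show "closed (case i of None \<Rightarrow> M | Some i \<Rightarrow> A i)" for i using A M by (auto split: option.split)
    fix I' assume I': "finite I'" "I' \<subseteq> insert None (Some ` (H \<times> {0::real<..}))"
    define J where "J = {i. Some i \<in> I'}"
    have J: "finite J" using I'(1) unfolding J_def by (rule finite_vimageI[of _ Some, unfolded vimage_def]) simp
    have JH: "J \<subseteq> H \<times> {0<..}" using I'(2) by (auto simp: J_def)
    define e where "e = Min (insert 1 (snd ` J))"
    have e: "e > 0" "\<And>i. i \<in> J \<Longrightarrow> e \<le> snd i" using J JH by (auto simp: e_def)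
    obtain m where m: "mean X m" "\<And>g f. g \<in> fst ` J \<Longrightarrow> (\<forall>t\<in>X. \<bar>f t\<bar> \<le> 1) \<Longrightarrow> \<bar>m (\<lambda>t. f (T g t)) - m f\<bar> \<le> e"
      using approx[of "fst ` J" e] J JH e(1) by fastforce
    obtain m' where m': "mean X m'" "m' \<in> P" "\<And>f. bounded (f ` X) \<Longrightarrow> m' f = m f"
      using in_P[OF m(1)] by blast
    have "m' \<in> A i" if i: "i \<in> J" for i
    proof -
      have "\<bar>m' (\<lambda>t. f (T (fst i) t)) - m' f\<bar> \<le> snd i" if f: "\<forall>t\<in>X. \<bar>f t\<bar> \<le> 1" for f
      proof -
        have bf: "bounded (f ` X)" using f by (auto simp: bounded_iff)
        have "bounded ((\<lambda>t. f (T (fst i) t)) ` X)"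
          by (rule bounded_fun_reindex[OF bf]) (use T JH i in auto)
        then show ?thesis using m(2)[of "fst i" f] i f e(2)[OF i] m'(3) bf by force
      qed
      then show ?thesis using m'(1) by (auto simp: A_def M_def split_beta)
    qed
    then have "m' \<in> P \<inter> (\<Inter>i\<in>I'. case i of None \<Rightarrow> M | Some i \<Rightarrow> A i)"
      using m' by (auto simp: M_def J_def split: option.split)
    then show "P \<inter> (\<Inter>i\<in>I'. case i of None \<Rightarrow> M | Some i \<Rightarrow> A i) \<noteq> {}" by blast
  qed
  then obtain m where mM: "m \<in> M" and mA: "\<And>g e. g \<in> H \<Longrightarrow> e > 0 \<Longrightarrow> m \<in> A (g, e)"
    by fastforce
  interpret mean X m using mM by (simp add: M_def)
  have "m (\<lambda>t. f (T g t)) = m f" if g: "g \<in> H" and f: "bounded (f ` X)" for g f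
  proof -
    obtain B where B: "B > 0" "\<forall>t\<in>X. \<bar>f t\<bar> \<le> B" using f by (auto simp: bounded_pos)
    have f': "bounded ((\<lambda>t. f (T g t)) ` X)" by (rule bounded_fun_reindex[OF f]) (rule T[OF g])
    have "\<forall>t\<in>X. \<bar>1 / B * f t\<bar> \<le> 1" using B by (auto simp: abs_mult)
    then have "\<bar>m (\<lambda>t. 1 / B * f (T g t)) - m (\<lambda>t. 1 / B * f t)\<bar> \<le> e" if "e > 0" for e
    proof -
      have "m \<in> A (g, e)" using mA[OF g that] .
      then have "\<forall>f. (\<forall>t\<in>X. \<bar>f t\<bar> \<le> 1) \<longrightarrow> \<bar>m (\<lambda>t. f (T g t)) - m f\<bar> \<le> e" by (simp add: A_def)
      from this[rule_format, of "\<lambda>t. 1 / B * f t"] show ?thesis using \<open>\<forall>t\<in>X. \<bar>1 / B * f t\<bar> \<le> 1\<close> by blast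
    qed
    then have "\<bar>m (\<lambda>t. 1 / B * f (T g t)) - m (\<lambda>t. 1 / B * f t)\<bar> \<le> 0"
      by (meson dense_ge)
    then show ?thesis using B(1) unfolding scale[OF f'] scale[OF f] by simp
  qed
  then show ?thesis using mM by (auto simp: M_def)
qed

section \<open>Abelian groups: almost invariant sets and characters\<close>

text \<open>The products of powers of finitely many elements, with exponents up to \<open>n\<close>, grow polynomially
  in \<open>n\<close>. So for some \<open>n\<close> the next such set is hardly larger, and a generator moves few elements
  out of the set.\<close>

lemma comm_group_almost_invariant_set:
  fixes N :: "('g, 'm) monoid_scheme" (structure)
  assumes "comm_group N" and A: "finite A" "A \<subseteq> carrier N" and e: "(e::real) > 0"
  shows "\<exists>F. finite F \<and> F \<noteq> {} \<and> F \<subseteq> carrier N \<and>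
    (\<forall>a\<in>A. real (card {c\<in>F. a \<otimes> c \<notin> F}) \<le> e * real (card F))"
proof -
  interpret comm_group N by fact
  define p :: "('g \<Rightarrow> nat) \<Rightarrow> 'g" where "p k = finprod N (\<lambda>a. a [^] k a) A" for k
  define B where "B n = p ` (A \<rightarrow>\<^sub>E {..n})" for n :: nat
  have fin: "finite (B n)" for n by (simp add: B_def A finite_PiE)
  have ne: "B n \<noteq> {}" for n by (auto simp: B_def PiE_eq_empty_iff)
  have pow: "(\<lambda>a. a [^] k a) \<in> A \<rightarrow> carrier N" for k :: "'g \<Rightarrow> nat"
    using A(2) by auto
  have sub: "B n \<subseteq> carrier N" for n using finprod_closed[OF pow] by (auto simp: B_def p_def)
  have mono: "B n \<subseteq> B (Suc n)" for n
    unfolding B_def by (intro image_mono PiE_mono) auto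
  have step: "a \<otimes> c \<in> B (Suc n)" if a: "a \<in> A" and c: "c \<in> B n" for a c n
  proof -
    obtain k where k: "k \<in> A \<rightarrow>\<^sub>E {..n}" "c = p k" using c by (auto simp: B_def)
    define k' where "k' = (\<lambda>b\<in>A. if a = b then Suc (k b) else k b)"
    have "p k' = finprod N (\<lambda>b. (if a = b then b else \<one>) \<otimes> b [^] k b) A"
      unfolding p_def k'_def using A
      by (intro finprod_cong') (auto simp: m_comm subset_iff)
    also have "\<dots> = finprod N (\<lambda>b. if a = b then b else \<one>) A \<otimes> p k"
      unfolding p_def using A by (intro finprod_multf) auto
    also have "finprod N (\<lambda>b. if a = b then b else \<one>) A = a"
      using finprod_singleton[of a A "\<lambda>b. b"] A a by auto
    finally have "a \<otimes> c = p k'" using k by simp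
    moreover have "k' \<in> A \<rightarrow>\<^sub>E {..Suc n}" using k(1) by (auto simp: k'_def PiE_iff le_Suc_eq)
    ultimately show ?thesis by (simp add: B_def)
  qed
  have growth: "card (B n) \<le> (n + 1) ^ card A" for n
  proof -
    have "card (B n) \<le> card (A \<rightarrow>\<^sub>E {..n})" unfolding B_def by (rule card_image_le) (simp add: A finite_PiE)
    then show ?thesis using A by (simp add: card_PiE)
  qed
  have "\<exists>n. real (card (B (Suc n))) \<le> (1 + e) * real (card (B n))"
  proof (rule ccontr)
    assume "\<not> ?thesis"
    then have *: "(1 + e) * real (card (B n)) \<le> real (card (B (Suc n)))" for n
      by (meson linear)
    have "(1 + e) ^ n \<le> real (card (B n))" for n
    proof (induction n)
      case 0
      then show ?case using ne[of 0] fin[of 0] by (simp add: Suc_leI card_gt_0_iff)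
    next
      case (Suc n)
      have "(1 + e) ^ Suc n \<le> (1 + e) * real (card (B n))" using Suc e by simp
      then show ?case using * order_trans by blast
    qed
    moreover have "real (card (B n)) \<le> (real n + 1) ^ card A" for n
      using growth[of n] by (metis of_nat_1 of_nat_add of_nat_le_iff of_nat_power)
    ultimately have "(1 + e) ^ n \<le> (real n + 1) ^ card A" for n
      using order_trans by blast
    moreover have "eventually (\<lambda>n. (real n + 1) ^ card A < (1 + e) ^ n) sequentially"
      using e by real_asymp
    ultimately show False
      by (metis (no_types, lifting) eventually_False_sequentially eventually_mono linorder_not_le)
  qed
  then obtain n where n: "real (card (B (Suc n))) \<le> (1 + e) * real (card (B n))" by blast
  have "real (card {c\<in>B n. a \<otimes> c \<notin> B n}) \<le> e * real (card (B n))" if a: "a \<in> A" for a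
  proof -
    have "card {c\<in>B n. a \<otimes> c \<notin> B n} \<le> card (B (Suc n) - B n)"
    proof (rule card_inj_on_le)
      show "inj_on (\<lambda>c. a \<otimes> c) {c\<in>B n. a \<otimes> c \<notin> B n}"
        using a A sub[of n] by (auto simp: inj_on_def subset_iff)
    qed (use fin step[OF a] in auto)
    also have "\<dots> = card (B (Suc n)) - card (B n)"
      using fin mono by (simp add: card_Diff_subset)
    finally show ?thesis using n card_mono[OF fin mono, of n] by (simp add: algebra_simps)
  qed
  then show ?thesis using fin ne sub by (intro exI[of _ "B n"]) auto
qed

text \<open>Uniform averages over almost invariant sets are approximately invariant means.\<close>

lemma comm_group_amenable:
  fixes N (structure)
  assumes "comm_group N" shows "amenable N"
  unfolding amenable_iff_mean
proof (rule mean_limit)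
  interpret comm_group N by fact
  show "inv g \<otimes> t \<in> carrier N" if "g \<in> carrier N" "t \<in> carrier N" for g t using that by simp
  fix E and e :: real assume E: "finite E" "E \<subseteq> carrier N" and e: "e > 0"
  obtain F where F: "finite F" "F \<noteq> {}" "F \<subseteq> carrier N"
    and few': "\<forall>b\<in>m_inv N ` E. real (card {c\<in>F. b \<otimes> c \<notin> F}) \<le> e / 2 * real (card F)"
  proof -
    have "finite (m_inv N ` E)" "m_inv N ` E \<subseteq> carrier N" "e / 2 > 0" using E e by auto
    from comm_group_almost_invariant_set[OF assms this] show ?thesis using that by blast
  qed
  have few: "real (card {c\<in>F. inv a \<otimes> c \<notin> F}) \<le> e / 2 * real (card F)" if "a \<in> E" for a
    using few' that by blast
  define m where "m f = (\<Sum>c\<in>F. f c) / real (card F)" for f :: "_ \<Rightarrow> real"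
  have "mean (carrier N) m"
  proof
    show "0 \<le> m f" if "bounded (f ` carrier N)" "\<And>t. t \<in> carrier N \<Longrightarrow> 0 \<le> f t" for f
      using that F unfolding m_def by (intro divide_nonneg_nonneg sum_nonneg) auto
  qed (use F in \<open>auto simp: m_def sum.distrib add_divide_distrib sum_distrib_left\<close>)
  have appr: "\<bar>m (\<lambda>t. f (inv a \<otimes> t)) - m f\<bar> \<le> e"
    if a: "a \<in> E" and f: "\<forall>t\<in>carrier N. \<bar>f t\<bar> \<le> 1" for a f
  proof -
    define L where "L = (\<lambda>c. inv a \<otimes> c) ` F"
    have a': "inv a \<in> carrier N" using a E by auto
    have inj: "inj_on (\<lambda>c. inv a \<otimes> c) F"
      using a' F by (auto simp: inj_on_def subset_iff)
    have L: "finite L" "L \<subseteq> carrier N" "card L = card F"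
      using F a' inj by (auto simp: L_def card_image)
    have LF: "L - F = (\<lambda>c. inv a \<otimes> c) ` {c\<in>F. inv a \<otimes> c \<notin> F}"
      by (auto simp: L_def)
    have "card (L - F) \<le> card {c\<in>F. inv a \<otimes> c \<notin> F}"
      unfolding LF by (rule card_image_le) (use F in auto)
    then have 1: "real (card (L - F)) \<le> e / 2 * real (card F)" using few[OF a] by linarith
    have 2: "card (F - L) = card (L - F)"
      using L F by (metis card_le_sym_Diff order_antisym order_refl)
    have "(\<Sum>c\<in>F. f (inv a \<otimes> c)) = sum f L"
      unfolding L_def by (simp add: sum.reindex[OF inj])
    then have "(\<Sum>c\<in>F. f (inv a \<otimes> c)) - sum f F = sum f (L - F) - sum f (F - L)"
      using sum.Int_Diff[OF L(1), of f F] sum.Int_Diff[OF F(1), of f L] by (simp add: Int_commute)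
    moreover have bd: "\<bar>sum f S\<bar> \<le> real (card S)" if "S \<subseteq> carrier N" for S
    proof -
      have "\<bar>sum f S\<bar> \<le> (\<Sum>s\<in>S. \<bar>f s\<bar>)" by (rule sum_abs)
      also have "\<dots> \<le> (\<Sum>s\<in>S. 1)" using f that by (intro sum_mono) auto
      finally show ?thesis by simp
    qed
    moreover have "L - F \<subseteq> carrier N" "F - L \<subseteq> carrier N" using L F by auto
    note bd[OF this(1)] bd[OF this(2)]
    ultimately have "\<bar>(\<Sum>c\<in>F. f (inv a \<otimes> c)) - sum f F\<bar> \<le> e * real (card F)"
      using 1 2 \<open>\<bar>sum f (L - F)\<bar> \<le> _\<close> \<open>\<bar>sum f (F - L)\<bar> \<le> _\<close> by simp
    moreover have "card F > 0" using F by (simp add: card_gt_0_iff)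
    ultimately show ?thesis
      unfolding m_def by (simp flip: diff_divide_distrib add: pos_divide_le_eq)
  qed
  show "\<exists>m. mean (carrier N) m \<and> (\<forall>g\<in>E. \<forall>f. (\<forall>t\<in>carrier N. \<bar>f t\<bar> \<le> 1) \<longrightarrow>
      \<bar>m (\<lambda>t. f (inv g \<otimes> t)) - m f\<bar> \<le> e)"
    using \<open>mean (carrier N) m\<close> appr by (intro exI[of _ m]) simp
qed

text \<open>The value \<open>1\<close> off the carrier makes every character a unique function.\<close>

definition dual :: "('g, 'm) monoid_scheme \<Rightarrow> ('g \<Rightarrow> complex) monoid"
  where "dual N = \<lparr>carrier = {\<theta>. (\<forall>a\<in>carrier N. cmod (\<theta> a) = 1) \<and> (\<forall>a. a \<notin> carrier N \<longrightarrow> \<theta> a = 1) \<and>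
      (\<forall>a\<in>carrier N. \<forall>b\<in>carrier N. \<theta> (a \<otimes>\<^bsub>N\<^esub> b) = \<theta> a * \<theta> b)},
    monoid.mult = (\<lambda>\<theta> \<psi> a. \<theta> a * \<psi> a), one = (\<lambda>a. 1)\<rparr>"

lemma mult_dual [simp]: "\<theta> \<otimes>\<^bsub>dual N\<^esub> \<psi> = (\<lambda>a. \<theta> a * \<psi> a)"
  and one_dual [simp]: "\<one>\<^bsub>dual N\<^esub> = (\<lambda>a. 1)"
  by (simp_all add: dual_def)

lemma dual_norm: "\<theta> \<in> carrier (dual N) \<Longrightarrow> cmod (\<theta> a) = 1"
  by (cases "a \<in> carrier N") (auto simp: dual_def)

lemma dual_mult: "\<theta> \<in> carrier (dual N) \<Longrightarrow> a \<in> carrier N \<Longrightarrow> b \<in> carrier N \<Longrightarrow> \<theta> (a \<otimes>\<^bsub>N\<^esub> b) = \<theta> a * \<theta> b"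
  by (auto simp: dual_def)

lemma dual_cnj_mult: "\<theta> \<in> carrier (dual N) \<Longrightarrow> cnj (\<theta> a) * \<theta> a = 1" "\<theta> \<in> carrier (dual N) \<Longrightarrow> \<theta> a * cnj (\<theta> a) = 1"
  using complex_norm_square[of "\<theta> a"] by (simp_all add: dual_norm mult.commute)

lemma cnj_dual: "\<theta> \<in> carrier (dual N) \<Longrightarrow> (\<lambda>a. cnj (\<theta> a)) \<in> carrier (dual N)"
  by (auto simp: dual_def)

lemma comm_group_dual: "comm_group (dual N)"
proof (rule comm_groupI)
  show "\<exists>\<psi>\<in>carrier (dual N). \<psi> \<otimes>\<^bsub>dual N\<^esub> \<theta> = \<one>\<^bsub>dual N\<^esub>" if "\<theta> \<in> carrier (dual N)" for \<theta>
    using that by (intro bexI[OF _ cnj_dual]) (auto simp: dual_cnj_mult)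
  show "\<theta> \<otimes>\<^bsub>dual N\<^esub> \<psi> \<in> carrier (dual N)" if "\<theta> \<in> carrier (dual N)" "\<psi> \<in> carrier (dual N)" for \<theta> \<psi>
    using that by (simp add: dual_def norm_mult)
qed (simp_all add: dual_def ac_simps fun_eq_iff)

lemma inv_dual: "\<theta> \<in> carrier (dual N) \<Longrightarrow> inv\<^bsub>dual N\<^esub> \<theta> = (\<lambda>a. cnj (\<theta> a))"
  by (rule group.inv_equality[OF comm_group.axioms(2)[OF comm_group_dual]])
    (simp_all add: cnj_dual dual_cnj_mult)

lemma dual_inv:
  assumes "group N" "\<theta> \<in> carrier (dual N)" "a \<in> carrier N"
  shows "\<theta> (inv\<^bsub>N\<^esub> a) = cnj (\<theta> a)" "\<theta> \<one>\<^bsub>N\<^esub> = 1"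
proof -
  interpret group N by fact
  have "\<theta> \<one>\<^bsub>N\<^esub> * \<theta> \<one>\<^bsub>N\<^esub> = \<theta> \<one>\<^bsub>N\<^esub>" using dual_mult[OF assms(2), of "\<one>\<^bsub>N\<^esub>" "\<one>\<^bsub>N\<^esub>"] by simp
  moreover have "\<theta> \<one>\<^bsub>N\<^esub> \<noteq> 0" using dual_norm[OF assms(2), of "\<one>\<^bsub>N\<^esub>"] by auto
  ultimately show 1: "\<theta> \<one>\<^bsub>N\<^esub> = 1" by simp
  have "\<theta> (inv\<^bsub>N\<^esub> a) * \<theta> a = 1" using dual_mult[OF assms(2), of "inv\<^bsub>N\<^esub> a" a] assms(3) 1 by simp
  then show "\<theta> (inv\<^bsub>N\<^esub> a) = cnj (\<theta> a)"
    by (metis assms(2) dual_cnj_mult(2) mult.assoc mult.commute mult.right_neutral)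
qed

text \<open>The invariant mean on the discrete group of characters plays the role of the Haar integral on
  the dual: invariance and the existence of enough characters already imply that characters are
  orthogonal.\<close>

locale dual_mean = N: comm_group N + mean "carrier (dual N)" M for N :: "('g, 'm) monoid_scheme" (structure) and M +
  assumes separates: "a \<in> carrier N \<Longrightarrow> a \<noteq> \<one>\<^bsub>N\<^esub> \<Longrightarrow> \<exists>\<theta>\<in>carrier (dual N). \<theta> a \<noteq> 1"
    and invariant: "\<psi> \<in> carrier (dual N) \<Longrightarrow> bounded (f ` carrier (dual N)) \<Longrightarrow>
      M (\<lambda>\<theta>. f (\<lambda>a. \<psi> a * \<theta> a)) = M f"

lemma dual_mean_exists:
  assumes "comm_group N" "\<And>a. a \<in> carrier N \<Longrightarrow> a \<noteq> \<one>\<^bsub>N\<^esub> \<Longrightarrow> \<exists>\<theta>\<in>carrier (dual N). \<theta> a \<noteq> 1"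
  shows "\<exists>M. dual_mean N M"
proof -
  obtain M where M: "mean (carrier (dual N)) M"
    "\<And>\<psi> f. \<psi> \<in> carrier (dual N) \<Longrightarrow> bounded (f ` carrier (dual N)) \<Longrightarrow>
       M (\<lambda>\<theta>. f (inv\<^bsub>dual N\<^esub> \<psi> \<otimes>\<^bsub>dual N\<^esub> \<theta>)) = M f"
    using comm_group_amenable[OF comm_group_dual] unfolding amenable_iff_mean by blast
  have "M (\<lambda>\<theta>. f (\<lambda>a. \<psi> a * \<theta> a)) = M f"
    if "\<psi> \<in> carrier (dual N)" "bounded (f ` carrier (dual N))" for \<psi> f
    using M(2)[OF cnj_dual[OF that(1)] that(2)] that(1) by (simp add: inv_dual cnj_dual)
  then show ?thesis
    using assms M(1) by (auto simp: dual_mean_def dual_mean_axioms_def)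
qed

context dual_mean
begin

abbreviation "X \<equiv> carrier (dual N)"

lemma bounded_char [intro, simp]: "bounded ((\<lambda>\<theta>. \<theta> a) ` X)"
  by (rule bounded_fun_leI[of _ _ 1]) (simp add: dual_norm)

lemma bounded_cnj_char [intro, simp]: "bounded ((\<lambda>\<theta>. cnj (\<theta> a)) ` X)"
  by (rule bounded_fun_leI[of _ _ 1]) (simp add: dual_norm)

lemma cmean_char:
  assumes a: "a \<in> carrier N"
  shows "cmean (\<lambda>\<theta>. \<theta> a) = (if a = \<one> then 1 else 0)"
proof (cases "a = \<one>")
  case True
  have "cmean (\<lambda>\<theta>. \<theta> a) = cmean (\<lambda>\<theta>. 1)"
    using True dual_inv(2)[OF N.group_axioms _ a] by (intro cmean_cong) auto
  then show ?thesis using True by (simp add: cmean_const)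
next
  case False
  obtain \<psi> where \<psi>: "\<psi> \<in> X" "\<psi> a \<noteq> 1" using separates[OF a False] by blast
  have "\<psi> a * cmean (\<lambda>\<theta>. \<theta> a) = cmean (\<lambda>\<theta>. \<psi> a * \<theta> a)" by (simp add: cmean_scale)
  also have "\<dots> = cmean (\<lambda>\<theta>. \<theta> a)"
    using invariant[OF \<psi>(1), of "\<lambda>\<theta>. Re (\<theta> a)"] invariant[OF \<psi>(1), of "\<lambda>\<theta>. Im (\<theta> a)"]
    by (simp only: complex_eq_iff Re_cmean Im_cmean) (simp add: bounded_fun_Re bounded_fun_Im)
  finally show ?thesis using \<psi>(2) False by simp
qed

lemma cmean_orthogonal:
  assumes a: "a \<in> carrier N" and b: "b \<in> carrier N"
  shows "cmean (\<lambda>\<theta>. \<theta> a * cnj (\<theta> b)) = (if a = b then 1 else 0)"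
proof -
  have "cmean (\<lambda>\<theta>. \<theta> (a \<otimes> inv b)) = cmean (\<lambda>\<theta>. \<theta> a * cnj (\<theta> b))"
    using a b by (intro cmean_cong bounded_char) (simp add: dual_mult dual_inv[OF N.group_axioms])
  moreover have "a \<otimes> inv b = \<one> \<longleftrightarrow> a = b"
    using a b by (metis N.inv_equality N.inv_inv N.r_inv N.inv_closed)
  ultimately show ?thesis using cmean_char[of "a \<otimes> inv b"] a b by simp
qed

end

section \<open>Positive kernels\<close>

text \<open>Families indexed by numbers may repeat points, so that pulling a kernel back needs no
  injectivity.\<close>

definition pos_kernel :: "('s \<Rightarrow> 's \<Rightarrow> complex) \<Rightarrow> bool"
  where "pos_kernel K \<longleftrightarrow> (\<forall>s t. K t s = cnj (K s t)) \<and>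
    (\<forall>n (c :: nat \<Rightarrow> complex) s. 0 \<le> Re (\<Sum>i<n. \<Sum>j<n. c i * cnj (c j) * K (s i) (s j)))"

lemma pos_kernel_cnj: "pos_kernel K \<Longrightarrow> K t s = cnj (K s t)"
  unfolding pos_kernel_def by blast

lemma pos_kernel_sum_nonneg:
  assumes K: "pos_kernel K" and I: "finite I"
  shows "0 \<le> Re (\<Sum>i\<in>I. \<Sum>j\<in>I. c i * cnj (c j) * K (s i) (s j))"
proof -
  obtain h where h: "bij_betw h {..<card I} I"
    using ex_bij_betw_nat_finite[OF I] by (auto simp: atLeast0LessThan)
  have "(\<Sum>i\<in>I. \<Sum>j\<in>I. c i * cnj (c j) * K (s i) (s j)) =
      (\<Sum>i<card I. \<Sum>j<card I. c (h i) * cnj (c (h j)) * K (s (h i)) (s (h j)))"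
    by (simp add: sum.reindex_bij_betw[OF h, symmetric])
  moreover have "0 \<le> Re (\<Sum>i<card I. \<Sum>j<card I. c (h i) * cnj (c (h j)) * K (s (h i)) (s (h j)))"
    using K unfolding pos_kernel_def by (elim conjE allE[of _ "card I"] allE[of _ "\<lambda>i. c (h i)"] allE[of _ "\<lambda>i. s (h i)"])
  ultimately show ?thesis by simp
qed

lemma pos_kernelI:
  assumes "\<And>s t. K t s = cnj (K s t)"
    and "\<And>n (c :: nat \<Rightarrow> complex) s. 0 \<le> Re (\<Sum>i<n. \<Sum>j<n. c i * cnj (c j) * K (s i) (s j))"
  shows "pos_kernel K"
  using assms unfolding pos_kernel_def by blast

lemma pos_kernel_diag: "pos_kernel K \<Longrightarrow> 0 \<le> Re (K s s)"
  using pos_kernel_sum_nonneg[of K "{()}" "\<lambda>_. 1" "\<lambda>_. s"] by simp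

lemma pos_kernel_add:
  assumes K: "pos_kernel K" and L: "pos_kernel L"
  shows "pos_kernel (\<lambda>s t. K s t + L s t)"
proof (rule pos_kernelI)
  show "K t s + L t s = cnj (K s t + L s t)" for s t
    using pos_kernel_cnj[OF K, of t s] pos_kernel_cnj[OF L, of t s] by simp
  show "0 \<le> Re (\<Sum>i<n. \<Sum>j<n. c i * cnj (c j) * (K (s i) (s j) + L (s i) (s j)))"
    for n :: nat and c :: "nat \<Rightarrow> complex" and s
    using pos_kernel_sum_nonneg[OF K, of "{..<n}" c s] pos_kernel_sum_nonneg[OF L, of "{..<n}" c s]
    by (simp add: distrib_left sum.distrib)
qed

text \<open>A positive kernel is a Gram matrix. Here its vectors are replaced by finite linear
  combinations, such as averages or differences of translates.\<close>

lemma pos_kernel_pullback: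
  assumes K: "pos_kernel K" and J: "finite J"
  shows "pos_kernel (\<lambda>s t. \<Sum>j\<in>J. \<Sum>k\<in>J. w s j * cnj (w t k) * K (p s j) (p t k))"
proof (rule pos_kernelI)
  show "(\<Sum>j\<in>J. \<Sum>k\<in>J. w t j * cnj (w s k) * K (p t j) (p s k)) =
      cnj (\<Sum>j\<in>J. \<Sum>k\<in>J. w s j * cnj (w t k) * K (p s j) (p t k))" for s t
    by (subst sum.swap) (simp add: pos_kernel_cnj[OF K] mult.commute flip: pos_kernel_cnj[OF K])
  fix n :: nat and c :: "nat \<Rightarrow> complex" and s
  have "(\<Sum>i<n. \<Sum>i'<n. c i * cnj (c i') * (\<Sum>j\<in>J. \<Sum>k\<in>J. w (s i) j * cnj (w (s i') k) * K (p (s i) j) (p (s i') k)))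
      = (\<Sum>i<n. \<Sum>j\<in>J. \<Sum>i'<n. \<Sum>k\<in>J. (c i * w (s i) j) * cnj (c i' * w (s i') k) * K (p (s i) j) (p (s i') k))"
    by (intro sum.cong refl, subst sum.swap) (simp add: sum_distrib_left mult_ac)
  also have "\<dots> = (\<Sum>x\<in>{..<n} \<times> J. \<Sum>y\<in>{..<n} \<times> J. (c (fst x) * w (s (fst x)) (snd x)) *
      cnj (c (fst y) * w (s (fst y)) (snd y)) * K (p (s (fst x)) (snd x)) (p (s (fst y)) (snd y)))"
    by (simp add: sum.cartesian_product')
  finally show "0 \<le> Re (\<Sum>i<n. \<Sum>i'<n. c i * cnj (c i') *
      (\<Sum>j\<in>J. \<Sum>k\<in>J. w (s i) j * cnj (w (s i') k) * K (p (s i) j) (p (s i') k)))"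
    using pos_kernel_sum_nonneg[OF K, of "{..<n} \<times> J" "\<lambda>x. c (fst x) * w (s (fst x)) (snd x)"
        "\<lambda>x. p (s (fst x)) (snd x)"] J by simp
qed

lemma pos_kernel_reindex: "pos_kernel K \<Longrightarrow> pos_kernel (\<lambda>s t. w s * cnj (w t) * K (p s) (p t))"
  using pos_kernel_pullback[of K "{()}" "\<lambda>s _. w s" "\<lambda>s _. p s"] by simp

text \<open>The Cauchy--Schwarz inequality for two finite combinations, in the form of a weighted
  inequality between arithmetic and geometric mean, which is stable under taking means.\<close>

lemma pos_kernel_cross_le:
  assumes K: "pos_kernel K" and I: "finite I" and J: "finite J" and u: "u > 0"
  shows "2 * cmod (\<Sum>i\<in>I. \<Sum>j\<in>J. c i * cnj (d j) * K (s i) (t j)) \<le>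
    Re (\<Sum>i\<in>I. \<Sum>i'\<in>I. c i * cnj (c i') * K (s i) (s i')) / u +
    u * Re (\<Sum>j\<in>J. \<Sum>j'\<in>J. d j * cnj (d j') * K (t j) (t j'))"
proof -
  define S where "S = (\<Sum>i\<in>I. \<Sum>j\<in>J. c i * cnj (d j) * K (s i) (t j))"
  define P where "P = (\<Sum>i\<in>I. \<Sum>i'\<in>I. c i * cnj (c i') * K (s i) (s i'))"
  define Q where "Q = (\<Sum>j\<in>J. \<Sum>j'\<in>J. d j * cnj (d j') * K (t j) (t j'))"
  define z where "z = (if S = 0 then 1 else cnj S / cmod S)"
  have z: "cnj z * z = 1"
    using complex_norm_square[of S] by (auto simp: z_def field_simps power2_eq_square)
  have zS: "z * S = cmod S"
    using complex_norm_square[of S] by (auto simp: z_def field_simps power2_eq_square)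
  have S': "(\<Sum>j\<in>J. \<Sum>i\<in>I. d j * cnj (c i) * K (t j) (s i)) = cnj S"
    unfolding S_def by (subst sum.swap) (simp add: pos_kernel_cnj[OF K, of "t _" "s _"] mult_ac)
  obtain r :: complex where r: "r \<noteq> 0" "cnj r = r" "r * r = u"
  proof
    show "complex_of_real (sqrt u) * complex_of_real (sqrt u) = u"
      using u by (simp flip: of_real_mult)
  qed (use u in auto)
  define C where "C = case_sum (\<lambda>i. z / r * c i) (\<lambda>j. - r * d j)"
  define T where "T = case_sum s t"
  have ss: "z / r * c i * cnj (z / r * c i') * k = (c i * cnj (c i') * k) / u" for i i' k
  proof -
    have "z / r * c i * cnj (z / r * c i') * k = (cnj z * z) * (c i * cnj (c i') * k) / (r * r)"
      using r(1) by (simp add: r(2))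
    then show ?thesis by (simp only: z r(3) mult_1)
  qed
  have st: "z / r * c i * cnj (- r * d j) * k = - z * (c i * cnj (d j) * k)"
    and ts: "- r * d j * cnj (z / r * c i) * k = - cnj z * (d j * cnj (c i) * k)" for i j k
    using r(1,2) by simp_all
  have tt: "- r * d j * cnj (- r * d j') * k = u * (d j * cnj (d j') * k)" for j j' k
    using r(2) by (simp flip: r(3))
  have "(\<Sum>x\<in>I <+> J. \<Sum>y\<in>I <+> J. C x * cnj (C y) * K (T x) (T y)) =
     (\<Sum>i\<in>I. \<Sum>i'\<in>I. z / r * c i * cnj (z / r * c i') * K (s i) (s i'))
   + (\<Sum>i\<in>I. \<Sum>j\<in>J. z / r * c i * cnj (- r * d j) * K (s i) (t j))
   + ((\<Sum>j\<in>J. \<Sum>i\<in>I. - r * d j * cnj (z / r * c i) * K (t j) (s i))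
   + (\<Sum>j\<in>J. \<Sum>j'\<in>J. - r * d j * cnj (- r * d j') * K (t j) (t j')))"
    using I J by (simp only: sum.Plus C_def T_def sum.distrib sum.case comp_def add_ac)
  also have "\<dots> = P / u + - z * S + (- cnj z * cnj S + u * Q)"
    unfolding ss st ts tt P_def Q_def S'[symmetric]
    by (simp only: S_def sum_distrib_left sum_divide_distrib)
  finally have "0 \<le> Re (P / u + - z * S + (- cnj z * cnj S + u * Q))"
    using pos_kernel_sum_nonneg[OF K, of "I <+> J" C T] I J by simp
  moreover have "cnj z * cnj S = cmod S" using arg_cong[OF zS, of cnj] by simp
  ultimately show ?thesis
    using zS unfolding S_def[symmetric] P_def[symmetric] Q_def[symmetric] by simp
qed

text \<open>This replaces the direct integral of a family of Hilbert spaces.\<close>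

lemma pos_kernel_mean:
  assumes "mean X m" and K: "\<And>x. x \<in> X \<Longrightarrow> pos_kernel (K x)"
    and bounded: "\<And>s t. bounded ((\<lambda>x. K x s t) ` X)"
  shows "pos_kernel (\<lambda>s t. mean.cmean m (\<lambda>x. K x s t))"
proof (rule pos_kernelI)
  interpret mean X m by fact
  show "cmean (\<lambda>x. K x t s) = cnj (cmean (\<lambda>x. K x s t))" for s t
  proof -
    have "cmean (\<lambda>x. K x t s) = cmean (\<lambda>x. cnj (K x s t))"
      by (rule cmean_cong[OF bounded]) (rule pos_kernel_cnj[OF K])
    then show ?thesis by (simp only: cmean_cnj[OF bounded])
  qed
  fix n and c :: "nat \<Rightarrow> complex" and s
  have "(\<Sum>i<n. \<Sum>j<n. c i * cnj (c j) * cmean (\<lambda>x. K x (s i) (s j))) =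
      cmean (\<lambda>x. \<Sum>i<n. \<Sum>j<n. c i * cnj (c j) * K x (s i) (s j))"
    by (simp add: cmean_sum cmean_scale bounded bounded_fun_sum bounded_fun_mult)
  moreover have "0 \<le> m (\<lambda>x. Re (\<Sum>i<n. \<Sum>j<n. c i * cnj (c j) * K x (s i) (s j)))"
    using pos_kernel_sum_nonneg[OF K]
    by (intro nonneg bounded_fun_Re bounded_fun_sum bounded_fun_mult bounded bounded_fun_const) auto
  ultimately show "0 \<le> Re (\<Sum>i<n. \<Sum>j<n. c i * cnj (c j) * cmean (\<lambda>x. K x (s i) (s j)))"
    by simp
qed

section \<open>Transforms\<close>

context dual_mean
begin

lemma mean_quadratic:
  assumes F: "finite F" "F \<subseteq> carrier N"
  shows "M (\<lambda>\<theta>. Re (\<Sum>b\<in>F. \<Sum>b'\<in>F. \<theta> b * cnj (\<theta> b') * k b b')) = Re (\<Sum>b\<in>F. k b b)"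
proof -
  have bd: "bounded ((\<lambda>\<theta>. \<theta> b * cnj (\<theta> b')) ` X)" for b b'
    by (intro bounded_fun_mult) auto
  have "cmean (\<lambda>\<theta>. \<Sum>b\<in>F. \<Sum>b'\<in>F. k b b' * (\<theta> b * cnj (\<theta> b'))) = (\<Sum>b\<in>F. \<Sum>b'\<in>F. k b b' * (if b = b' then 1 else 0))"
    using F by (simp add: cmean_sum cmean_scale bd bounded_fun_sum bounded_fun_mult cmean_orthogonal subset_iff)
  also have "\<dots> = (\<Sum>b\<in>F. k b b)" using F by (simp add: if_distrib cong: if_cong)
  finally have "Re (cmean (\<lambda>\<theta>. \<Sum>b\<in>F. \<Sum>b'\<in>F. k b b' * (\<theta> b * cnj (\<theta> b')))) = Re (\<Sum>b\<in>F. k b b)"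
    by (rule arg_cong)
  then show ?thesis by (simp only: Re_cmean mult.commute[of "k _ _"])
qed

text \<open>Up to a small error, \<open>D\<close> may be averaged over an almost invariant set \<open>F\<close>. Then its transform is,
  at each character, an inner product of two sums over \<open>F\<close> twisted by this character, whose square
  norms have mean value at most \<open>p\<close> and \<open>q\<close> per element of \<open>F\<close> by orthogonality. This is the
  inequality between the \<open>L\<^sup>1\<close>-norm on the dual and the norm of the Fourier algebra.\<close>

lemma mean_norm_transform_le:
  fixes K :: "'g + 'g \<Rightarrow> 'g + 'g \<Rightarrow> complex"
  assumes K: "pos_kernel K" and A: "finite A" "A \<subseteq> carrier N"
    and D: "\<And>a. a \<in> carrier N \<Longrightarrow> a \<notin> A \<Longrightarrow> D a = 0"
    and cross: "\<And>a b. a \<in> carrier N \<Longrightarrow> b \<in> carrier N \<Longrightarrow> K (Inl a) (Inr b) = D (inv b \<otimes> a)"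
    and p: "\<And>a. a \<in> carrier N \<Longrightarrow> Re (K (Inl a) (Inl a)) \<le> p"
    and q: "\<And>a. a \<in> carrier N \<Longrightarrow> Re (K (Inr a) (Inr a)) \<le> q"
    and u: "u > 0"
  shows "M (\<lambda>\<theta>. cmod (\<Sum>a\<in>A. D a * \<theta> a)) \<le> (p / u + u * q) / 2"
proof (rule field_le_epsilon)
  fix e :: real assume e: "e > 0"
  define S where "S = (\<Sum>a\<in>A. cmod (D a))"
  have S: "S \<ge> 0" by (simp add: S_def sum_nonneg)
  define e' where "e' = e / (S + 1)"
  have e': "e' > 0" "S * e' \<le> e" using e S by (auto simp: e'_def field_simps)
  obtain F where F: "finite F" "F \<noteq> {}" "F \<subseteq> carrier N"
    and few: "\<forall>a\<in>A. real (card {c\<in>F. a \<otimes> c \<notin> F}) \<le> e' * real (card F)"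
    using comm_group_almost_invariant_set[OF N.comm_group_axioms A e'(1)] by blast
  have n: "real (card F) > 0" using F by (simp add: card_gt_0_iff)
  define W where "W \<theta> = (\<Sum>b\<in>F. \<Sum>c\<in>F. \<theta> b * cnj (\<theta> c) * K (Inl b) (Inr c))" for \<theta>
  define U where "U \<theta> = Re (\<Sum>b\<in>F. \<Sum>c\<in>F. \<theta> b * cnj (\<theta> c) * K (Inl b) (Inl c))" for \<theta>
  define V where "V \<theta> = Re (\<Sum>b\<in>F. \<Sum>c\<in>F. \<theta> b * cnj (\<theta> c) * K (Inr b) (Inr c))" for \<theta>
  have bU: "bounded (U ` X)" and bV: "bounded (V ` X)"
    unfolding U_def V_def by (intro bounded_fun_Re bounded_fun_sum bounded_fun_mult; simp)+
  have MU: "M U \<le> card F * p"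
  proof -
    have "M U = (\<Sum>b\<in>F. Re (K (Inl b) (Inl b)))" unfolding U_def by (subst mean_quadratic[OF F(1,3)]) simp
    also have "\<dots> \<le> (\<Sum>b\<in>F. p)" using p F by (intro sum_mono) auto
    finally show ?thesis by simp
  qed
  have MV: "M V \<le> card F * q"
  proof -
    have "M V = (\<Sum>b\<in>F. Re (K (Inr b) (Inr b)))" unfolding V_def by (subst mean_quadratic[OF F(1,3)]) simp
    also have "\<dots> \<le> (\<Sum>b\<in>F. q)" using q F by (intro sum_mono) auto
    finally show ?thesis by simp
  qed
  have point: "cmod (\<Sum>a\<in>A. D a * \<theta> a) \<le> e + 1 / card F * (1 / (2 * u) * U \<theta> + u / 2 * V \<theta>)" if \<theta>: "\<theta> \<in> X" for \<theta>
  proof -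
    define g where "g a = D a * \<theta> a" for a
    have inner: "(\<Sum>b\<in>F. \<theta> b * cnj (\<theta> c) * K (Inl b) (Inr c)) = (\<Sum>a\<in>A. if a \<otimes> c \<in> F then g a else 0)"
      if c: "c \<in> F" for c
    proof -
      have cN: "c \<in> carrier N" using c F by auto
      have "(\<Sum>b\<in>F. \<theta> b * cnj (\<theta> c) * K (Inl b) (Inr c)) = (\<Sum>b\<in>F. g (inv c \<otimes> b))"
        using F cN \<theta> by (intro sum.cong refl) (auto simp: g_def cross dual_mult dual_inv[OF N.group_axioms] mult_ac)
      also have "\<dots> = (\<Sum>a\<in>(\<lambda>b. inv c \<otimes> b) ` F. g a)"
        using F cN by (subst sum.reindex) (auto simp: inj_on_def subset_iff)
      also have "\<dots> = (\<Sum>a\<in>{a\<in>A. a \<otimes> c \<in> F}. g a)"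
      proof (rule sum.mono_neutral_right)
        have "a \<in> (\<lambda>b. inv c \<otimes> b) ` F" if "a \<in> A" "a \<otimes> c \<in> F" for a
        proof (rule image_eqI)
          show "a = inv c \<otimes> (a \<otimes> c)"
          proof -
            have a: "a \<in> carrier N" using that A by auto
            have "inv c \<otimes> (a \<otimes> c) = inv c \<otimes> (c \<otimes> a)"
              using a cN by (simp add: N.m_comm)
            then show ?thesis using a cN by (simp flip: N.m_assoc)
          qed
        qed (use that in auto)
        then show "{a \<in> A. a \<otimes> c \<in> F} \<subseteq> (\<lambda>b. inv c \<otimes> b) ` F" by blast
        have "inv c \<otimes> b \<otimes> c = b" if "b \<in> F" for b
        proof -
          have b: "b \<in> carrier N" using that F by auto
          have "inv c \<otimes> b \<otimes> c = c \<otimes> (inv c \<otimes> b)"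
            using b cN by (simp add: N.m_comm)
          then show ?thesis using b cN by (simp flip: N.m_assoc)
        qed
        moreover have "D (inv c \<otimes> b) = 0" if "b \<in> F" "inv c \<otimes> b \<notin> A" for b
          using that F(3) cN by (intro D) auto
        ultimately show "\<forall>i\<in>(\<lambda>b. inv c \<otimes> b) ` F - {a \<in> A. a \<otimes> c \<in> F}. g i = 0"
          by (auto simp: g_def)
      qed (use F in auto)
      also have "\<dots> = (\<Sum>a\<in>A. if a \<otimes> c \<in> F then g a else 0)"
        using A by (simp add: sum.inter_filter)
      finally show ?thesis .
    qed
    have "W \<theta> = (\<Sum>c\<in>F. \<Sum>a\<in>A. if a \<otimes> c \<in> F then g a else 0)"
      unfolding W_def by (subst sum.swap) (simp add: inner)
    moreover have "card F * (\<Sum>a\<in>A. g a) = (\<Sum>c\<in>F. \<Sum>a\<in>A. g a)" by simp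
    ultimately have "card F * (\<Sum>a\<in>A. g a) - W \<theta> = (\<Sum>c\<in>F. \<Sum>a\<in>A. if a \<otimes> c \<in> F then 0 else g a)"
      by (simp only: sum_subtractf[symmetric]) (intro sum.cong refl, simp)
    also have "cmod \<dots> \<le> (\<Sum>c\<in>F. \<Sum>a\<in>A. if a \<otimes> c \<in> F then 0 else cmod (D a))"
    proof (rule order_trans[OF norm_sum], rule sum_mono)
      show "cmod (\<Sum>a\<in>A. if a \<otimes> c \<in> F then 0 else g a) \<le> (\<Sum>a\<in>A. if a \<otimes> c \<in> F then 0 else cmod (D a))" for c
        by (rule sum_norm_le) (simp add: g_def norm_mult dual_norm[OF \<theta>])
    qed
    also have "\<dots> = (\<Sum>a\<in>A. cmod (D a) * card {c\<in>F. a \<otimes> c \<notin> F})"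
    proof (subst sum.swap, intro sum.cong refl)
      fix a
      have "(\<Sum>c\<in>F. if a \<otimes> c \<in> F then 0 else cmod (D a)) = (\<Sum>c\<in>{c\<in>F. a \<otimes> c \<notin> F}. cmod (D a))"
        by (subst sum.inter_filter[OF F(1)], intro sum.cong refl, simp)
      then show "(\<Sum>c\<in>F. if a \<otimes> c \<in> F then 0 else cmod (D a)) = cmod (D a) * card {c\<in>F. a \<otimes> c \<notin> F}"
        by simp
    qed
    also have "\<dots> \<le> (\<Sum>a\<in>A. cmod (D a) * (e' * card F))"
      using few by (intro sum_mono mult_left_mono) auto
    also have "\<dots> = S * e' * card F" by (simp only: S_def sum_distrib_right mult.assoc)
    also have "\<dots> \<le> e * card F" using e'(2) by (intro mult_right_mono) auto
    finally have "cmod (card F * (\<Sum>a\<in>A. g a)) \<le> e * card F + cmod (W \<theta>)"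
      using norm_triangle_sub[of "card F * (\<Sum>a\<in>A. g a)" "W \<theta>"] by linarith
    moreover have "2 * cmod (W \<theta>) \<le> U \<theta> / u + u * V \<theta>"
      unfolding W_def U_def V_def by (rule pos_kernel_cross_le[OF K F(1) F(1) u])
    then have "cmod (W \<theta>) \<le> 1 / (2 * u) * U \<theta> + u / 2 * V \<theta>" by simp
    then have "1 / card F * cmod (W \<theta>) \<le> 1 / card F * (1 / (2 * u) * U \<theta> + u / 2 * V \<theta>)"
      by (rule mult_left_mono) simp
    moreover have "cmod (\<Sum>a\<in>A. g a) \<le> e + 1 / card F * cmod (W \<theta>)"
      if "card F * cmod (\<Sum>a\<in>A. g a) \<le> e * card F + cmod (W \<theta>)"
      using that n by (simp add: field_simps)
    ultimately show ?thesis unfolding g_def[symmetric] by (simp add: norm_mult)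
  qed
  have "M (\<lambda>\<theta>. cmod (\<Sum>a\<in>A. D a * \<theta> a)) \<le> M (\<lambda>\<theta>. e + 1 / card F * (1 / (2 * u) * U \<theta> + u / 2 * V \<theta>))"
  proof (rule mono)
    show "bounded ((\<lambda>\<theta>. cmod (\<Sum>a\<in>A. D a * \<theta> a)) ` X)"
      by (intro bounded_fun_norm bounded_fun_sum bounded_fun_mult) auto
    show "bounded ((\<lambda>\<theta>. e + 1 / card F * (1 / (2 * u) * U \<theta> + u / 2 * V \<theta>)) ` X)"
      by (intro bounded_fun_add bounded_fun_mult bounded_fun_const bU bV)
  qed (rule point)
  also have "\<dots> = e + 1 / card F * (1 / (2 * u) * M U + u / 2 * M V)"
  proof -
    have b: "bounded ((\<lambda>\<theta>. 1 / (2 * u) * U \<theta>) ` X)" "bounded ((\<lambda>\<theta>. u / 2 * V \<theta>) ` X)"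
      by (intro bounded_fun_mult bounded_fun_const bU bV)+
    note b' = bounded_fun_add[OF b]
    show ?thesis
      by (simp only: add[OF bounded_fun_const bounded_fun_mult[OF bounded_fun_const b']]
          const scale[OF b'] add[OF b] scale[OF bU] scale[OF bV])
  qed
  also have "\<dots> \<le> e + 1 / card F * (1 / (2 * u) * (card F * p) + u / 2 * (card F * q))"
    by (rule add_left_mono, rule mult_left_mono, rule add_mono; rule mult_left_mono[OF MU] mult_left_mono[OF MV] divide_nonneg_nonneg)
      (use u in simp_all)
  also have "\<dots> = (p / u + u * q) / 2 + e" using n u by (simp add: field_simps)
  finally show "M (\<lambda>\<theta>. cmod (\<Sum>a\<in>A. D a * \<theta> a)) \<le> (p / u + u * q) / 2 + e" .
qed

end

section \<open>Weak amenability in terms of kernels\<close>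

text \<open>A Herz--Schur representation is recorded by the Gram matrix of its vectors \<open>\<xi> x\<close>, indexed by
  \<open>Inl x\<close>, and \<open>\<eta> y\<close>, indexed by \<open>Inr y\<close>. Means of Gram matrices are Gram matrices again, whereas
  means of vectors would require the completion of new inner product spaces.\<close>

definition schur_kernel ::
    "('g, 'm) monoid_scheme \<Rightarrow> ('g \<Rightarrow> complex) \<Rightarrow> real \<Rightarrow> real \<Rightarrow> ('g + 'g \<Rightarrow> 'g + 'g \<Rightarrow> complex) \<Rightarrow> bool"
  where "schur_kernel G \<phi> p q K \<longleftrightarrow> pos_kernel K \<and>
    (\<forall>x\<in>carrier G. Re (K (Inl x) (Inl x)) \<le> p \<and> Re (K (Inr x) (Inr x)) \<le> q) \<and>
    (\<forall>x\<in>carrier G. \<forall>y\<in>carrier G. K (Inl x) (Inr y) = \<phi> (inv\<^bsub>G\<^esub> y \<otimes>\<^bsub>G\<^esub> x))"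

text \<open>A form of weak amenability with finitely supported functions, which restricts to subgroups at
  once and turns transforms on abelian subgroups into finite sums.\<close>

definition kernel_approximable :: "('g, 'm) monoid_scheme \<Rightarrow> real \<Rightarrow> bool"
  where "kernel_approximable G c \<longleftrightarrow>
    (\<forall>S e. finite S \<and> S \<subseteq> carrier G \<and> e > 0 \<longrightarrow>
      (\<exists>\<phi> K. finite {x\<in>carrier G. \<phi> x \<noteq> 0} \<and> (\<forall>x\<in>S. cmod (\<phi> x - 1) \<le> e) \<and> schur_kernel G \<phi> 1 c K))"

lemma schur_kernel_add:
  "schur_kernel G \<phi> p q K \<Longrightarrow> schur_kernel G \<psi> p' q' L \<Longrightarrow>
    schur_kernel G (\<lambda>x. \<phi> x + \<psi> x) (p + p') (q + q') (\<lambda>s t. K s t + L s t)"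
  unfolding schur_kernel_def by (auto intro: pos_kernel_add add_mono)

lemma schur_kernel_mono:
  "schur_kernel G \<phi> p q K \<Longrightarrow> p \<le> p' \<Longrightarrow> q \<le> q' \<Longrightarrow> schur_kernel G \<phi> p' q' K"
  unfolding schur_kernel_def by force

text \<open>Rescaling the vectors on both sides by inverse factors.\<close>

lemma schur_kernel_rescale:
  assumes K: "schur_kernel G \<phi> p q K" and r: "r > 0"
  shows "\<exists>K. schur_kernel G \<phi> (p / r) (q * r) K"
proof -
  obtain u :: complex where u: "cnj u = u" "u * u = r" "u \<noteq> 0"
  proof
    show "complex_of_real (sqrt r) * complex_of_real (sqrt r) = r"
      using r by (simp flip: of_real_mult)
  qed (use r in auto)
  define w where "w = case_sum (\<lambda>x::'a. 1 / u) (\<lambda>x::'a. u)"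
  define L where "L s t = w s * cnj (w t) * K s t" for s t
  have "pos_kernel L"
    unfolding L_def using K pos_kernel_reindex[of K w "\<lambda>s. s"] by (simp add: schur_kernel_def)
  moreover have "L (Inl x) (Inl y) = K (Inl x) (Inl y) / r" for x y
    by (simp add: L_def w_def u(1) flip: u(2))
  moreover have "L (Inr x) (Inr y) = r * K (Inr x) (Inr y)" for x y
    by (simp add: L_def w_def u(1) flip: u(2))
  moreover have "L (Inl x) (Inr y) = K (Inl x) (Inr y)" for x y
    using u(3) by (simp add: L_def w_def u(1))
  ultimately have "schur_kernel G \<phi> (p / r) (q * r) L"
    using K r by (auto simp: schur_kernel_def divide_right_mono mult.commute)
  then show ?thesis by blast
qed

lemma (in complex_hilbert_space) sum_mem: "(\<And>i. i \<in> I \<Longrightarrow> v i \<in> H) \<Longrightarrow> (\<Sum>i\<in>I. v i) \<in> H"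
  by (induction I rule: infinite_finite_induct) (auto intro: zero_mem add_mem)

lemma (in complex_hilbert_space) ip_sum_left:
  "(\<And>i. i \<in> I \<Longrightarrow> v i \<in> H) \<Longrightarrow> z \<in> H \<Longrightarrow> ip (\<Sum>i\<in>I. v i) z = (\<Sum>i\<in>I. ip (v i) z)"
  by (induction I rule: infinite_finite_induct) (auto simp: ip_zero_left ip_add_left sum_mem)

lemma (in complex_hilbert_space) pos_kernel_gram:
  assumes v: "\<And>s. v s \<in> H"
  shows "pos_kernel (\<lambda>s t. ip (v s) (v t))"
proof (rule pos_kernelI)
  show "ip (v t) (v s) = cnj (ip (v s) (v t))" for s t by (rule ip_cnj) (rule v)+
  fix n :: nat and c :: "nat \<Rightarrow> complex" and s
  define z where "z = (\<Sum>i<n. scale (c i) (v (s i)))"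
  have zH: "z \<in> H" unfolding z_def by (intro sum_mem scale_mem v)
  have "ip z z = (\<Sum>i<n. c i * ip (v (s i)) z)"
    by (subst z_def, subst ip_sum_left) (simp_all add: ip_scale_left v scale_mem zH)
  also have "\<dots> = (\<Sum>i<n. c i * cnj (ip z (v (s i))))"
    by (intro sum.cong refl, subst ip_cnj[of z]) (simp_all add: v zH)
  also have "\<dots> = (\<Sum>i<n. c i * cnj (\<Sum>j<n. c j * ip (v (s j)) (v (s i))))"
    by (simp add: z_def ip_sum_left ip_scale_left v scale_mem)
  also have "\<dots> = (\<Sum>i<n. \<Sum>j<n. c i * cnj (c j) * ip (v (s i)) (v (s j)))"
  proof -
    have "cnj (ip (v (s j)) (v (s i))) = ip (v (s i)) (v (s j))" for i j
      by (rule ip_cnj[symmetric]) (rule v)+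
    then show ?thesis by (simp add: sum_distrib_left mult_ac)
  qed
  finally show "0 \<le> Re (\<Sum>i<n. \<Sum>j<n. c i * cnj (c j) * ip (v (s i)) (v (s j)))"
    using ip_self_nonneg[OF zH] by simp
qed

text \<open>The vectors are rescaled so that those on the left have length at most \<open>1\<close>.\<close>

lemma cb_norm_schur_kernel:
  fixes \<phi> :: "'g \<Rightarrow> complex"
  assumes "group G" and less: "cb_norm G \<phi> < ennreal C"
  shows "\<exists>K. schur_kernel G \<phi> 1 (C\<^sup>2) K"
proof -
  interpret group G by fact
  obtain H :: "('g + 'g \<Rightarrow> complex) set" and ip \<xi> \<eta> where
    rep: "herz_schur_representation G \<phi> fscale H ip \<xi> \<eta>"
    and ST: "ennreal (sup_norm G ip \<xi> * sup_norm G ip \<eta>) < ennreal C"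
    using less unfolding cb_norm_def Inf_less_iff by blast
  interpret complex_hilbert_space fscale H ip
    using rep by (simp add: herz_schur_representation_def)
  define S where "S = sup_norm G ip \<xi>"
  define T where "T = sup_norm G ip \<eta>"
  have \<xi>: "\<xi> x \<in> H" "hnorm ip (\<xi> x) \<le> S" and \<eta>: "\<eta> x \<in> H" "hnorm ip (\<eta> x) \<le> T"
    and \<phi>: "y \<in> carrier G \<Longrightarrow> \<phi> (inv\<^bsub>G\<^esub> y \<otimes>\<^bsub>G\<^esub> x) = ip (\<xi> x) (\<eta> y)" if "x \<in> carrier G" for x y
    using rep that unfolding herz_schur_representation_def S_def T_def sup_norm_def
    by (auto intro!: cSUP_upper)
  have hn: "hnorm ip v \<ge> 0" if "v \<in> H" for v
    using ip_self_nonneg[OF that] by (simp add: hnorm_def)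
  have Re_ip: "Re (ip v v) = (hnorm ip v)\<^sup>2" if "v \<in> H" for v
    using ip_self_nonneg[OF that] by (simp add: hnorm_def)
  have S0: "S \<ge> 0" and T0: "T \<ge> 0"
    using \<xi>[OF one_closed] \<eta>[OF one_closed] hn by (meson order_trans)+
  have STC: "S * T \<le> C" using ST S0 T0 by (simp add: S_def T_def ennreal_less_iff)
  show ?thesis
  proof (cases "S = 0")
    case True
    have "\<phi> (inv\<^bsub>G\<^esub> y \<otimes>\<^bsub>G\<^esub> x) = 0" if "x \<in> carrier G" "y \<in> carrier G" for x y
    proof -
      have "cmod (ip (\<xi> x) (\<eta> y)) \<le> hnorm ip (\<xi> x) * hnorm ip (\<eta> y)"
        using that \<xi> \<eta> by (intro Cauchy_Schwarz) auto
      also have "hnorm ip (\<xi> x) = 0" using \<xi>[OF that(1)] hn True by (meson order_antisym)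
      finally show ?thesis using \<phi>[OF that] by simp
    qed
    then have "schur_kernel G \<phi> 1 (C\<^sup>2) (\<lambda>s t. 0)"
      by (auto simp: schur_kernel_def intro!: pos_kernelI)
    then show ?thesis by blast
  next
    case False
    then have S: "S > 0" using S0 by simp
    define v where "v = case_sum (\<lambda>x. if x \<in> carrier G then \<xi> x else 0) (\<lambda>x. if x \<in> carrier G then \<eta> x else 0)"
    have v: "v s \<in> H" for s using \<xi> \<eta> zero_mem by (cases s) (auto simp: v_def)
    have "schur_kernel G \<phi> (S\<^sup>2) (T\<^sup>2) (\<lambda>s t. ip (v s) (v t))"
      unfolding schur_kernel_def
    proof (intro conjI ballI)
      show "pos_kernel (\<lambda>s t. ip (v s) (v t))" by (rule pos_kernel_gram) (rule v)
      fix x assume x: "x \<in> carrier G"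
      show "Re (ip (v (Inl x)) (v (Inl x))) \<le> S\<^sup>2" "Re (ip (v (Inr x)) (v (Inr x))) \<le> T\<^sup>2"
        using x \<xi>[OF x] \<eta>[OF x] hn by (auto simp: v_def Re_ip intro!: power_mono)
      show "ip (v (Inl x)) (v (Inr y)) = \<phi> (inv\<^bsub>G\<^esub> y \<otimes>\<^bsub>G\<^esub> x)" if "y \<in> carrier G" for y
        using x that \<phi> by (simp add: v_def)
    qed
    from schur_kernel_rescale[OF this, of "S\<^sup>2"] S
    obtain K where K: "schur_kernel G \<phi> (S\<^sup>2 / S\<^sup>2) (T\<^sup>2 * S\<^sup>2) K" by auto
    have TSC: "T\<^sup>2 * S\<^sup>2 \<le> C\<^sup>2"
      using power_mono[OF STC, of 2] S0 T0 by (simp add: power_mult_distrib mult.commute)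
    have "schur_kernel G \<phi> 1 (C\<^sup>2) K" by (rule schur_kernel_mono[OF K _ TSC]) (use S in simp)
    then show ?thesis by blast
  qed
qed

subsection \<open>Coefficients of the regular representation\<close>

lemma l2_summable_mult:
  assumes "(\<lambda>t. (cmod (u t))\<^sup>2) summable_on T" "(\<lambda>t. (cmod (v t))\<^sup>2) summable_on T"
  shows "(\<lambda>t. u t * cnj (v t)) summable_on T"
proof (rule abs_summable_summable)
  have "(\<lambda>t. norm ((cmod (u t))\<^sup>2 + (cmod (v t))\<^sup>2)) summable_on T"
    using summable_on_add[OF assms] by simp
  moreover have "norm (u t * cnj (v t)) \<le> norm ((cmod (u t))\<^sup>2 + (cmod (v t))\<^sup>2)" for t
  proof -
    have "2 * (cmod (u t) * cmod (v t)) \<le> (cmod (u t))\<^sup>2 + (cmod (v t))\<^sup>2"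
      using sum_squares_bound[of "cmod (u t)" "cmod (v t)"] by simp
    moreover have "0 \<le> cmod (u t) * cmod (v t)" by simp
    ultimately have "cmod (u t) * cmod (v t) \<le> (cmod (u t))\<^sup>2 + (cmod (v t))\<^sup>2" by linarith
    then show ?thesis by (simp add: norm_mult)
  qed
  ultimately show "(\<lambda>t. norm (u t * cnj (v t))) summable_on T"
    by (rule Infinite_Sum.abs_summable_on_comparison_test)
qed

lemma has_sum_finite_sum:
  fixes f :: "'i \<Rightarrow> 't \<Rightarrow> 'b::topological_comm_monoid_add"
  assumes "\<And>i. i \<in> I \<Longrightarrow> (f i has_sum s i) T"
  shows "((\<lambda>t. \<Sum>i\<in>I. f i t) has_sum (\<Sum>i\<in>I. s i)) T"
  using assms by (induction I rule: infinite_finite_induct) (auto intro: has_sum_add)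

lemma pos_kernel_l2:
  assumes u: "\<And>s. (\<lambda>t. (cmod (u s t))\<^sup>2) summable_on T"
  shows "pos_kernel (\<lambda>s s'. \<Sum>\<^sub>\<infinity>t\<in>T. u s t * cnj (u s' t))"
proof (rule pos_kernelI)
  show "(\<Sum>\<^sub>\<infinity>t\<in>T. u s' t * cnj (u s t)) = cnj (\<Sum>\<^sub>\<infinity>t\<in>T. u s t * cnj (u s' t))" for s s'
    by (simp add: mult.commute flip: infsum_cnj)
  fix n :: nat and c :: "nat \<Rightarrow> complex" and s
  have "((\<lambda>t. \<Sum>i<n. \<Sum>j<n. c i * cnj (c j) * (u (s i) t * cnj (u (s j) t))) has_sum
      (\<Sum>i<n. \<Sum>j<n. c i * cnj (c j) * (\<Sum>\<^sub>\<infinity>t\<in>T. u (s i) t * cnj (u (s j) t)))) T"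
    by (intro has_sum_finite_sum has_sum_cmult_right has_sum_infsum l2_summable_mult u)
  moreover have "(\<Sum>i<n. \<Sum>j<n. c i * cnj (c j) * (u (s i) t * cnj (u (s j) t))) =
      of_real ((cmod (\<Sum>i<n. c i * u (s i) t))\<^sup>2)" for t
    unfolding complex_norm_square by (simp add: sum_product mult_ac)
  ultimately have "((\<lambda>t. of_real ((cmod (\<Sum>i<n. c i * u (s i) t))\<^sup>2)) has_sum
      (\<Sum>i<n. \<Sum>j<n. c i * cnj (c j) * (\<Sum>\<^sub>\<infinity>t\<in>T. u (s i) t * cnj (u (s j) t)))) T"
    by simp
  from has_sum_Re[OF this]
  show "0 \<le> Re (\<Sum>i<n. \<Sum>j<n. c i * cnj (c j) * (\<Sum>\<^sub>\<infinity>t\<in>T. u (s i) t * cnj (u (s j) t)))"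
    by (rule has_sum_nonneg) simp
qed

lemma (in group) bij_betw_left_mult: "x \<in> carrier G \<Longrightarrow> bij_betw (\<lambda>t. x \<otimes> t) (carrier G) (carrier G)"
  by (rule bij_betw_byWitness[of _ "\<lambda>t. inv x \<otimes> t"]) (auto simp flip: m_assoc)

text \<open>The vectors are the left translates of \<open>a\<close> and \<open>b\<close>.\<close>

lemma (in group) schur_kernel_coefficient:
  assumes a: "(\<lambda>t. (cmod (a t))\<^sup>2) summable_on carrier G" and b: "(\<lambda>t. (cmod (b t))\<^sup>2) summable_on carrier G"
  shows "\<exists>K. schur_kernel G (\<lambda>x. \<Sum>\<^sub>\<infinity>t\<in>carrier G. left_regular G x a t * cnj (b t))
    (\<Sum>\<^sub>\<infinity>t\<in>carrier G. (cmod (a t))\<^sup>2) (\<Sum>\<^sub>\<infinity>t\<in>carrier G. (cmod (b t))\<^sup>2) K"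
proof -
  define u where "u = case_sum (\<lambda>x t. if x \<in> carrier G then a (inv x \<otimes> t) else 0)
      (\<lambda>x t. if x \<in> carrier G then b (inv x \<otimes> t) else 0)"
  have u: "(\<lambda>t. (cmod (u s t))\<^sup>2) summable_on carrier G" for s
  proof (cases s)
    case (Inl x)
    show ?thesis
      using summable_on_reindex_bij_betw[OF bij_betw_left_mult[of "inv x"], of "\<lambda>t. (cmod (a t))\<^sup>2"] a
      by (cases "x \<in> carrier G") (simp_all add: u_def Inl)
  next
    case (Inr x)
    show ?thesis
      using summable_on_reindex_bij_betw[OF bij_betw_left_mult[of "inv x"], of "\<lambda>t. (cmod (b t))\<^sup>2"] b
      by (cases "x \<in> carrier G") (simp_all add: u_def Inr)
  qed
  define K where "K s s' = (\<Sum>\<^sub>\<infinity>t\<in>carrier G. u s t * cnj (u s' t))" for s s'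
  have "pos_kernel K" unfolding K_def by (rule pos_kernel_l2) (rule u)
  moreover have diag: "Re (K s s) = (\<Sum>\<^sub>\<infinity>t\<in>carrier G. (cmod (u s t))\<^sup>2)" for s
    unfolding K_def by (subst infsum_Re[symmetric, OF l2_summable_mult[OF u u]])
      (simp flip: complex_norm_square add: complex_mult_cnj cmod_power2)
  moreover have "Re (K (Inl x) (Inl x)) = (\<Sum>\<^sub>\<infinity>t\<in>carrier G. (cmod (a t))\<^sup>2)"
    "Re (K (Inr x) (Inr x)) = (\<Sum>\<^sub>\<infinity>t\<in>carrier G. (cmod (b t))\<^sup>2)" if "x \<in> carrier G" for x
    using that infsum_reindex_bij_betw[OF bij_betw_left_mult[of "inv x"], of "\<lambda>t. (cmod (a t))\<^sup>2"]
      infsum_reindex_bij_betw[OF bij_betw_left_mult[of "inv x"], of "\<lambda>t. (cmod (b t))\<^sup>2"]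
    by (simp_all add: diag u_def)
  moreover have "K (Inl x) (Inr y) = (\<Sum>\<^sub>\<infinity>t\<in>carrier G. left_regular G (inv y \<otimes> x) a t * cnj (b t))"
    if x: "x \<in> carrier G" and y: "y \<in> carrier G" for x y
  proof -
    have "K (Inl x) (Inr y) = (\<Sum>\<^sub>\<infinity>t\<in>carrier G. a (inv x \<otimes> t) * cnj (b (inv y \<otimes> t)))"
      using x y by (simp add: K_def u_def)
    also have "\<dots> = (\<Sum>\<^sub>\<infinity>t\<in>carrier G. a (inv x \<otimes> (y \<otimes> t)) * cnj (b (inv y \<otimes> (y \<otimes> t))))"
      by (rule infsum_reindex_bij_betw[OF bij_betw_left_mult[OF y], symmetric])
    also have "\<dots> = (\<Sum>\<^sub>\<infinity>t\<in>carrier G. left_regular G (inv y \<otimes> x) a t * cnj (b t))"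
      using x y by (intro infsum_cong) (simp add: left_regular_def inv_mult_group m_assoc, simp flip: m_assoc)
    finally show ?thesis .
  qed
  ultimately have "schur_kernel G (\<lambda>x. \<Sum>\<^sub>\<infinity>t\<in>carrier G. left_regular G x a t * cnj (b t))
    (\<Sum>\<^sub>\<infinity>t\<in>carrier G. (cmod (a t))\<^sup>2) (\<Sum>\<^sub>\<infinity>t\<in>carrier G. (cmod (b t))\<^sup>2) K"
    by (simp add: schur_kernel_def)
  then show ?thesis by blast
qed

lemma l2_tail:
  assumes f: "(\<lambda>t. (cmod (f t))\<^sup>2) summable_on T" and e: "e > 0"
  shows "\<exists>F. finite F \<and> F \<subseteq> T \<and> (\<Sum>\<^sub>\<infinity>t\<in>T. (cmod (if t \<in> F then 0 else f t))\<^sup>2) \<le> e"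
proof -
  obtain F where F: "finite F" "F \<subseteq> T"
    and d: "dist (\<Sum>t\<in>F. (cmod (f t))\<^sup>2) (\<Sum>\<^sub>\<infinity>t\<in>T. (cmod (f t))\<^sup>2) \<le> e"
    using infsum_finite_approximation[OF f e] by blast
  have "(\<Sum>\<^sub>\<infinity>t\<in>T. (cmod (if t \<in> F then 0 else f t))\<^sup>2) = (\<Sum>\<^sub>\<infinity>t\<in>T - F. (cmod (f t))\<^sup>2)"
    by (rule infsum_cong_neutral) auto
  moreover have "(\<Sum>\<^sub>\<infinity>t\<in>T - F. (cmod (f t))\<^sup>2) + (\<Sum>t\<in>F. (cmod (f t))\<^sup>2) = (\<Sum>\<^sub>\<infinity>t\<in>T. (cmod (f t))\<^sup>2)"
  proof -
    have "(T - F) \<inter> F = {}" "(T - F) \<union> F = T" using F by auto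
    then show ?thesis
      using infsum_Un_disjoint[of "\<lambda>t. (cmod (f t))\<^sup>2" "T - F" F] F summable_on_subset_banach[OF f, of "T - F"]
      by simp
  qed
  ultimately show ?thesis using F d by (intro exI[of _ F]) (simp add: dist_real_def)
qed

lemma l2_restrict: "(\<lambda>t. (cmod (f t))\<^sup>2) summable_on T \<Longrightarrow> (\<lambda>t. (cmod (if P t then f t else 0))\<^sup>2) summable_on T"
  "(\<lambda>t. (cmod (f t))\<^sup>2) summable_on T \<Longrightarrow> (\<lambda>t. (cmod (if P t then 0 else f t))\<^sup>2) summable_on T"
  by (rule summable_on_comparison_test[of "\<lambda>t. (cmod (f t))\<^sup>2"]; simp)+

text \<open>Both vectors of the coefficient are cut off outside finite sets. The difference is a sum of two
  coefficients, each with a short tail as one of its vectors; a factor \<open>B\<close> shifts length from the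
  other vector to the tail.\<close>

lemma (in group) fourier_algebra_truncation:
  assumes \<phi>: "\<phi> \<in> fourier_algebra G" and k: "k > 0"
  shows "\<exists>\<psi> K. finite {x\<in>carrier G. \<psi> x \<noteq> 0} \<and> schur_kernel G (\<lambda>x. \<psi> x - \<phi> x) k k K"
proof -
  define ip where "ip a b x = (\<Sum>\<^sub>\<infinity>t\<in>carrier G. left_regular G x a t * cnj (b t))" for a b x
  define sq where "sq a = (\<Sum>\<^sub>\<infinity>t\<in>carrier G. (cmod (a t))\<^sup>2)" for a :: "'a \<Rightarrow> complex"
  have sq0: "sq a \<ge> 0" for a unfolding sq_def by (rule infsum_nonneg) simp
  obtain \<xi> \<eta> where \<xi>: "(\<lambda>t. (cmod (\<xi> t))\<^sup>2) summable_on carrier G" and \<eta>: "(\<lambda>t. (cmod (\<eta> t))\<^sup>2) summable_on carrier G"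
    and \<phi>': "\<And>x. x \<in> carrier G \<Longrightarrow> \<phi> x = ip \<xi> \<eta> x"
    using \<phi> unfolding fourier_algebra_def l2_def ip_def by blast
  have small: "\<exists>K. schur_kernel G (ip a b) (k / 2) (k / 2) K"
    if a: "(\<lambda>t. (cmod (a t))\<^sup>2) summable_on carrier G" and b: "(\<lambda>t. (cmod (b t))\<^sup>2) summable_on carrier G"
      and r: "r > 0" "sq a / r \<le> k / 2" "sq b * r \<le> k / 2" for a b r
  proof -
    obtain K where "schur_kernel G (ip a b) (sq a) (sq b) K"
      using schur_kernel_coefficient[OF a b] unfolding ip_def sq_def by blast
    from schur_kernel_rescale[OF this r(1)] show ?thesis using schur_kernel_mono r(2,3) by blast
  qed
  define B where "B = 2 * (sq \<xi> + sq \<eta> + 1) / k"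
  have B: "B > 0" "sq \<xi> / B \<le> k / 2" "sq \<eta> / B \<le> k / 2"
    using k sq0[of \<xi>] sq0[of \<eta>] by (auto simp: B_def field_simps add_nonneg_pos)
  have kB: "k / (2 * B) > 0" using B k by simp
  obtain F where F: "finite F" "F \<subseteq> carrier G" "sq (\<lambda>t. if t \<in> F then 0 else \<xi> t) \<le> k / (2 * B)"
    using l2_tail[OF \<xi> kB] unfolding sq_def by blast
  obtain F' where F': "finite F'" "F' \<subseteq> carrier G" "sq (\<lambda>t. if t \<in> F' then 0 else \<eta> t) \<le> k / (2 * B)"
    using l2_tail[OF \<eta> kB] unfolding sq_def by blast
  define \<xi>1 where "\<xi>1 t = (if t \<in> F then \<xi> t else 0)" for t
  define \<eta>1 where "\<eta>1 t = (if t \<in> F' then \<eta> t else 0)" for t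
  define \<xi>2 where "\<xi>2 t = (if t \<in> F then 0 else - \<xi> t)" for t
  define \<eta>2 where "\<eta>2 t = (if t \<in> F' then 0 else - \<eta> t)" for t
  have s: "(\<lambda>t. (cmod (\<xi>1 t))\<^sup>2) summable_on carrier G" "(\<lambda>t. (cmod (\<eta>1 t))\<^sup>2) summable_on carrier G"
    "(\<lambda>t. (cmod (\<xi>2 t))\<^sup>2) summable_on carrier G" "(\<lambda>t. (cmod (\<eta>2 t))\<^sup>2) summable_on carrier G"
    using l2_restrict[OF \<xi>] l2_restrict[OF \<eta>] l2_restrict(2)[of "\<lambda>t. - \<xi> t"] l2_restrict(2)[of "\<lambda>t. - \<eta> t"] \<xi> \<eta>
    unfolding \<xi>1_def \<eta>1_def \<xi>2_def \<eta>2_def by simp_all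
  have q: "sq \<xi>2 = sq (\<lambda>t. if t \<in> F then 0 else \<xi> t)" "sq \<eta>2 = sq (\<lambda>t. if t \<in> F' then 0 else \<eta> t)"
    unfolding sq_def \<xi>2_def \<eta>2_def by (intro infsum_cong; simp)+
  have "sq \<xi>1 \<le> sq \<xi>"
    unfolding sq_def by (intro infsum_mono s \<xi>) (simp add: \<xi>1_def)
  then have "sq \<xi>1 / B \<le> sq \<xi> / B" using B(1) by (simp add: divide_right_mono)
  then have "sq \<xi>1 / B \<le> k / 2" using B(2) by linarith
  moreover have "sq \<eta>2 * B \<le> k / 2" using F'(3) B(1) by (simp add: q field_simps)
  ultimately obtain K1 where K1: "schur_kernel G (ip \<xi>1 \<eta>2) (k / 2) (k / 2) K1"
    using small[OF s(1,4) B(1)] by blast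
  have "sq \<xi>2 / (1 / B) \<le> k / 2" using F(3) B(1) by (simp add: q field_simps)
  moreover have "sq \<eta> * (1 / B) \<le> k / 2" using B by simp
  ultimately obtain K2 where K2: "schur_kernel G (ip \<xi>2 \<eta>) (k / 2) (k / 2) K2"
    using small[OF s(3) \<eta>, of "1 / B"] B(1) by auto
  define K where "K s t = K1 s t + K2 s t" for s t
  have K: "schur_kernel G (\<lambda>x. ip \<xi>1 \<eta>2 x + ip \<xi>2 \<eta> x) k k K"
    using schur_kernel_add[OF K1 K2] by (simp add: K_def[abs_def])
  have split: "ip \<xi>1 \<eta>1 x - \<phi> x = ip \<xi>1 \<eta>2 x + ip \<xi>2 \<eta> x" if x: "x \<in> carrier G" for x
  proof -
    have reg: "(\<lambda>t. (cmod (left_regular G x a t))\<^sup>2) summable_on carrier G"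
      if "(\<lambda>t. (cmod (a t))\<^sup>2) summable_on carrier G" for a
      unfolding left_regular_def
      using summable_on_reindex_bij_betw[OF bij_betw_left_mult[OF inv_closed[OF x]], of "\<lambda>t. (cmod (a t))\<^sup>2"] that by simp
    have hs: "((\<lambda>t. left_regular G x a t * cnj (b t)) has_sum ip a b x) (carrier G)"
      if "(\<lambda>t. (cmod (a t))\<^sup>2) summable_on carrier G" "(\<lambda>t. (cmod (b t))\<^sup>2) summable_on carrier G" for a b
      unfolding ip_def by (intro has_sum_infsum l2_summable_mult reg that)
    have 1: "((\<lambda>t. left_regular G x \<xi>1 t * cnj (\<eta>1 t)) has_sum ip \<xi>1 \<eta>1 x) (carrier G)"
      by (rule hs[OF s(1,2)])
    have 2: "((\<lambda>t. left_regular G x \<xi> t * cnj (\<eta> t) + (left_regular G x \<xi>1 t * cnj (\<eta>2 t) + left_regular G x \<xi>2 t * cnj (\<eta> t)))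
        has_sum (ip \<xi> \<eta> x + (ip \<xi>1 \<eta>2 x + ip \<xi>2 \<eta> x))) (carrier G)"
      by (rule has_sum_add[OF hs[OF \<xi> \<eta>] has_sum_add[OF hs[OF s(1,4)] hs[OF s(3) \<eta>]]])
    have "(\<lambda>t. left_regular G x \<xi>1 t * cnj (\<eta>1 t)) =
        (\<lambda>t. left_regular G x \<xi> t * cnj (\<eta> t) + (left_regular G x \<xi>1 t * cnj (\<eta>2 t) + left_regular G x \<xi>2 t * cnj (\<eta> t)))"
      by (auto simp: left_regular_def \<xi>1_def \<xi>2_def \<eta>1_def \<eta>2_def)
    with 1 have "((\<lambda>t. left_regular G x \<xi> t * cnj (\<eta> t) + (left_regular G x \<xi>1 t * cnj (\<eta>2 t) + left_regular G x \<xi>2 t * cnj (\<eta> t)))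
        has_sum ip \<xi>1 \<eta>1 x) (carrier G)" by simp
    from has_sum_unique[OF this 2] show ?thesis by (simp add: \<phi>'[OF x])
  qed
  have "schur_kernel G (\<lambda>x. ip \<xi>1 \<eta>1 x - \<phi> x) k k K"
    using K unfolding schur_kernel_def by (auto simp: split)
  moreover have "finite {x\<in>carrier G. ip \<xi>1 \<eta>1 x \<noteq> 0}"
  proof (rule finite_subset)
    show "{x\<in>carrier G. ip \<xi>1 \<eta>1 x \<noteq> 0} \<subseteq> (\<lambda>(t, s). t \<otimes> inv s) ` (F' \<times> F)"
    proof
      fix x assume x: "x \<in> {x\<in>carrier G. ip \<xi>1 \<eta>1 x \<noteq> 0}"
      have "\<exists>t\<in>carrier G. left_regular G x \<xi>1 t * cnj (\<eta>1 t) \<noteq> 0"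
      proof (rule ccontr)
        assume "\<not> ?thesis"
        then have "ip \<xi>1 \<eta>1 x = 0" unfolding ip_def by (intro infsum_0) auto
        then show False using x by simp
      qed
      then obtain t where t: "t \<in> carrier G" "inv x \<otimes> t \<in> F" "t \<in> F'"
        by (auto simp: left_regular_def \<xi>1_def \<eta>1_def split: if_splits)
      then have "x = t \<otimes> inv (inv x \<otimes> t)"
        using x by (simp add: inv_mult_group m_assoc[symmetric])
      then show "x \<in> (\<lambda>(t, s). t \<otimes> inv s) ` (F' \<times> F)" using t by force
    qed
  qed (use F F' in auto)
  ultimately show ?thesis by blast
qed

lemma schur_kernel_norm_le:
  assumes "group G" "schur_kernel G \<phi> p q K" "x \<in> carrier G"
  shows "2 * cmod (\<phi> x) \<le> p + q"
proof -
  interpret group G by fact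
  have \<phi>: "K (Inl x) (Inr \<one>\<^bsub>G\<^esub>) = \<phi> x" using assms(2,3) by (simp add: schur_kernel_def)
  have "2 * cmod (K (Inl x) (Inr \<one>\<^bsub>G\<^esub>)) \<le> Re (K (Inl x) (Inl x)) + Re (K (Inr \<one>\<^bsub>G\<^esub>) (Inr \<one>\<^bsub>G\<^esub>))"
    using pos_kernel_cross_le[of K "{()}" "{()}" 1 "\<lambda>_. 1" "\<lambda>_. 1" "\<lambda>_. Inl x" "\<lambda>_. Inr \<one>\<^bsub>G\<^esub>"] assms(2)
    by (simp add: schur_kernel_def)
  moreover have "Re (K (Inl x) (Inl x)) \<le> p" "Re (K (Inr \<one>\<^bsub>G\<^esub>) (Inr \<one>\<^bsub>G\<^esub>)) \<le> q"
    using assms(2,3) by (auto simp: schur_kernel_def)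
  ultimately show ?thesis unfolding \<phi> by linarith
qed

text \<open>Truncation changes an element of the Fourier algebra by a function with a small kernel, so the
  bounds of the approximating net survive it up to a constant.\<close>

lemma weakly_amenable_kernel_approximable:
  assumes "group G" "weakly_amenable G"
  shows "\<exists>c. kernel_approximable G c"
proof -
  interpret group G by fact
  obtain A F where A: "A \<subseteq> fourier_algebra G" "(SUP \<phi>\<in>A. cb_norm G \<phi>) < \<infinity>"
    and F: "F \<noteq> bot" "F \<le> principal A"
    and lim: "\<And>S. S \<subseteq> carrier G \<Longrightarrow> finite S \<Longrightarrow> uniform_limit S (\<lambda>\<phi>. \<phi>) (\<lambda>x. 1) F"
    using assms(2) unfolding weakly_amenable_def by blast
  obtain C where C: "(SUP \<phi>\<in>A. cb_norm G \<phi>) < ennreal C"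
  proof -
    define s where "s = (SUP \<phi>\<in>A. cb_norm G \<phi>)"
    obtain r where "s = ennreal r" "r \<ge> 0"
      using A(2) unfolding s_def[symmetric] by (cases s) auto
    then show ?thesis using that[of "r + 1"] unfolding s_def[symmetric] by (simp add: ennreal_less_iff)
  qed
  have "kernel_approximable G ((C\<^sup>2 + 1) * 2)"
    unfolding kernel_approximable_def
  proof (intro allI impI)
    fix S :: "'a set" and e :: real assume S: "finite S \<and> S \<subseteq> carrier G \<and> e > 0"
    have "eventually (\<lambda>\<phi>. \<phi> \<in> A \<and> (\<forall>x\<in>S. dist (\<phi> x) 1 < e / 2)) F"
    proof (rule eventually_conj)
      show "eventually (\<lambda>\<phi>. \<phi> \<in> A) F" using F(2) by (simp add: le_principal)
      have "uniform_limit S (\<lambda>\<phi>. \<phi>) (\<lambda>x. 1) F" "e / 2 > 0" using lim S by auto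
      then show "eventually (\<lambda>\<phi>. \<forall>x\<in>S. dist (\<phi> x) 1 < e / 2) F" by (rule uniform_limitD)
    qed
    from eventually_happens'[OF F(1) this] obtain \<phi> where \<phi>: "\<phi> \<in> A" "\<And>x. x \<in> S \<Longrightarrow> dist (\<phi> x) 1 < e / 2"
      by blast
    have "cb_norm G \<phi> < ennreal C" by (rule le_less_trans[OF SUP_upper[OF \<phi>(1)] C])
    then obtain K where K: "schur_kernel G \<phi> 1 (C\<^sup>2) K"
      using cb_norm_schur_kernel[OF assms(1)] by blast
    define k where "k = min 1 (e / 2)"
    have k: "0 < k" "k \<le> 1" "k \<le> e / 2" using S by (auto simp: k_def)
    obtain \<psi> L where \<psi>: "finite {x\<in>carrier G. \<psi> x \<noteq> 0}" and L: "schur_kernel G (\<lambda>x. \<psi> x - \<phi> x) k k L"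
      using fourier_algebra_truncation[of \<phi> k] A(1) \<phi>(1) k(1) by blast
    have "schur_kernel G \<psi> (1 + k) (C\<^sup>2 + k) (\<lambda>s t. K s t + L s t)"
      using schur_kernel_add[OF K L] by simp
    then have "schur_kernel G \<psi> 2 (C\<^sup>2 + 1) (\<lambda>s t. K s t + L s t)"
      by (rule schur_kernel_mono) (use k in auto)
    from schur_kernel_rescale[OF this, of 2] obtain K' where "schur_kernel G \<psi> 1 ((C\<^sup>2 + 1) * 2) K'"
      by auto
    moreover have "cmod (\<psi> x - 1) \<le> e" if x: "x \<in> S" for x
    proof -
      have "cmod (\<psi> x - \<phi> x) \<le> k" using schur_kernel_norm_le[OF assms(1) L, of x] S x by auto
      moreover have "cmod (\<phi> x - 1) \<le> e / 2" using \<phi>(2)[OF x] by (simp add: dist_norm)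
      ultimately show ?thesis using norm_triangle_le[of "\<psi> x - \<phi> x" "\<phi> x - 1" e] k(3) by simp
    qed
    ultimately show "\<exists>\<phi> K. finite {x \<in> carrier G. \<phi> x \<noteq> 0} \<and> (\<forall>x\<in>S. cmod (\<phi> x - 1) \<le> e) \<and>
        schur_kernel G \<phi> 1 ((C\<^sup>2 + 1) * 2) K"
      using \<psi> by blast
  qed
  then show ?thesis by blast
qed

lemma kernel_approximable_subgroup:
  assumes "group G" "subgroup H G" "kernel_approximable G c"
  shows "kernel_approximable (G\<lparr>carrier := H\<rparr>) c"
  unfolding kernel_approximable_def
proof (intro allI impI)
  interpret group G by fact
  interpret subgroup H G by fact
  fix S and e :: real assume S: "finite S \<and> S \<subseteq> carrier (G\<lparr>carrier := H\<rparr>) \<and> e > 0"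
  then have "finite S \<and> S \<subseteq> carrier G \<and> e > 0" using subset by auto
  from assms(3)[unfolded kernel_approximable_def, rule_format, OF this]
  obtain \<phi> K where *: "finite {x\<in>carrier G. \<phi> x \<noteq> 0}" "\<forall>x\<in>S. cmod (\<phi> x - 1) \<le> e" "schur_kernel G \<phi> 1 c K"
    by (elim exE conjE)
  have "finite {x\<in>carrier (G\<lparr>carrier := H\<rparr>). \<phi> x \<noteq> 0}"
    by (rule finite_subset[OF _ *(1)]) (use subset in auto)
  moreover have "schur_kernel (G\<lparr>carrier := H\<rparr>) \<phi> 1 c K"
    using *(3) unfolding schur_kernel_def by (simp add: m_inv_consistent[OF assms(2)])
  ultimately show "\<exists>\<phi> K. finite {x \<in> carrier (G\<lparr>carrier := H\<rparr>). \<phi> x \<noteq> 0} \<and> (\<forall>x\<in>S. cmod (\<phi> x - 1) \<le> e) \<and>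
      schur_kernel (G\<lparr>carrier := H\<rparr>) \<phi> 1 c K"
    using *(2) by (intro exI[of _ \<phi>] exI[of _ K] conjI)
qed

section \<open>Almost invariant kernels\<close>

definition kernel_dist :: "('s \<Rightarrow> 's \<Rightarrow> complex) \<Rightarrow> 's \<Rightarrow> 's \<Rightarrow> real"
  where "kernel_dist K s t = Re (K s s + K t t - K s t - K t s)"

lemma kernel_dist_nonneg: "pos_kernel K \<Longrightarrow> 0 \<le> kernel_dist K s t"
  using pos_kernel_sum_nonneg[of K "{True, False}" "\<lambda>b. if b then 1 else -1" "\<lambda>b. if b then s else t"]
  by (simp add: kernel_dist_def)

lemma pos_kernel_norm_le: "pos_kernel K \<Longrightarrow> 2 * cmod (K s t) \<le> Re (K s s) + Re (K t t)"
  using pos_kernel_cross_le[of K "{()}" "{()}" 1 "\<lambda>_. 1" "\<lambda>_. 1" "\<lambda>_. s" "\<lambda>_. t"] by simp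

text \<open>Uniform convexity of a ball with squared radius \<open>p\<close>: the squared distances between the vectors
  add up to at most twice the defect by which their sum fails to have maximal length.\<close>

lemma pos_kernel_average:
  fixes p :: real
  assumes K: "pos_kernel K" and J: "finite J" and diag: "\<And>j. j \<in> J \<Longrightarrow> Re (K (v j) (v j)) \<le> p"
  shows "Re (\<Sum>j\<in>J. \<Sum>k\<in>J. K (v j) (v k)) \<le> (real (card J))\<^sup>2 * p"
    and "\<lbrakk>j \<in> J; k \<in> J\<rbrakk> \<Longrightarrow> kernel_dist K (v j) (v k) \<le> 2 * ((real (card J))\<^sup>2 * p - Re (\<Sum>j\<in>J. \<Sum>k\<in>J. K (v j) (v k)))"
proof -
  define T where "T = Re (\<Sum>j\<in>J. \<Sum>k\<in>J. K (v j) (v k))"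
  have sw: "(\<Sum>j\<in>J. \<Sum>k\<in>J. Re (K (v k) (v j))) = T" unfolding T_def by (subst sum.swap) simp
  have D: "(\<Sum>j\<in>J. \<Sum>k\<in>J. kernel_dist K (v j) (v k)) = 2 * (card J * (\<Sum>j\<in>J. Re (K (v j) (v j)))) - 2 * T"
    using sw by (simp add: kernel_dist_def sum.distrib sum_subtractf sum_distrib_left sum_negf T_def)
  have "real (card J) * (\<Sum>j\<in>J. Re (K (v j) (v j))) \<le> real (card J) * (\<Sum>j\<in>J. p)"
    by (intro mult_left_mono sum_mono diag) auto
  then have "card J * (\<Sum>j\<in>J. Re (K (v j) (v j))) \<le> (real (card J))\<^sup>2 * p"
    by (simp add: power2_eq_square mult.assoc)
  then have *: "(\<Sum>j\<in>J. \<Sum>k\<in>J. kernel_dist K (v j) (v k)) \<le> 2 * ((real (card J))\<^sup>2 * p - T)"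
    unfolding D by simp
  have "0 \<le> (\<Sum>j\<in>J. \<Sum>k\<in>J. kernel_dist K (v j) (v k))"
    by (intro sum_nonneg kernel_dist_nonneg[OF K])
  then have "0 \<le> 2 * ((real (card J))\<^sup>2 * p - T)" using * by (rule order_trans)
  then show "T \<le> (real (card J))\<^sup>2 * p" by simp
  show "kernel_dist K (v j) (v k) \<le> 2 * ((real (card J))\<^sup>2 * p - T)" if "j \<in> J" "k \<in> J" for j k
  proof -
    have "kernel_dist K (v j) (v k) \<le> (\<Sum>k\<in>J. kernel_dist K (v j) (v k))"
      by (rule member_le_sum) (use that J kernel_dist_nonneg[OF K] in auto)
    also have "\<dots> \<le> (\<Sum>j\<in>J. \<Sum>k\<in>J. kernel_dist K (v j) (v k))"
      by (rule member_le_sum[of j J "\<lambda>j. \<Sum>k\<in>J. kernel_dist K (v j) (v k)"])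
        (use that J kernel_dist_nonneg[OF K] in \<open>auto intro!: sum_nonneg\<close>)
    finally show ?thesis using * by linarith
  qed
qed

definition left_invariant :: "('g, 'm) monoid_scheme \<Rightarrow> 'g set \<Rightarrow> ('g + 'g \<Rightarrow> 'g + 'g \<Rightarrow> complex) \<Rightarrow> bool"
  where "left_invariant G N K \<longleftrightarrow> (\<forall>a\<in>N. \<forall>s\<in>carrier G <+> carrier G. \<forall>t\<in>carrier G <+> carrier G.
    K (map_sum (\<lambda>x. a \<otimes>\<^bsub>G\<^esub> x) (\<lambda>x. a \<otimes>\<^bsub>G\<^esub> x) s) (map_sum (\<lambda>x. a \<otimes>\<^bsub>G\<^esub> x) (\<lambda>x. a \<otimes>\<^bsub>G\<^esub> x) t) = K s t)"

text \<open>The entries that represent \<open>\<phi>\<close> depend on \<open>inv y \<otimes> x\<close> only, so they survive averaging over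
  simultaneous left translations of \<open>x\<close> and \<open>y\<close>.\<close>

lemma (in group) schur_kernel_average_subgroup:
  assumes K: "schur_kernel G \<phi> p q K" and N: "subgroup N G" and comm: "comm_group (G\<lparr>carrier := N\<rparr>)"
  shows "\<exists>L. schur_kernel G \<phi> p q L \<and> left_invariant G N L"
proof -
  have NG: "N \<subseteq> carrier G" using N by (rule subgroup.subset)
  interpret A: comm_group "G\<lparr>carrier := N\<rparr>" by fact
  obtain m where m: "mean N m"
    and inv: "\<And>x f. x \<in> N \<Longrightarrow> bounded (f ` N) \<Longrightarrow> m (\<lambda>t. f (inv\<^bsub>G\<lparr>carrier := N\<rparr>\<^esub> x \<otimes> t)) = m f"
    using comm_group_amenable[OF comm] unfolding amenable_iff_mean by auto
  interpret m: mean N m by fact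
  have right: "m (\<lambda>t. f (t \<otimes> b)) = m f" if b: "b \<in> N" and f: "bounded (f ` N)" for b and f :: "'a \<Rightarrow> real"
  proof -
    have "m (\<lambda>t. f (b \<otimes> t)) = m f"
      using inv[OF A.inv_closed[simplified, OF b] f] A.inv_inv[of b] b by simp
    moreover have "m (\<lambda>t. f (t \<otimes> b)) = m (\<lambda>t. f (b \<otimes> t))"
    proof (rule m.cong)
      show "bounded ((\<lambda>t. f (t \<otimes> b)) ` N)"
        by (rule bounded_fun_reindex[OF f]) (rule subgroup.m_closed[OF N _ b])
      show "f (t \<otimes> b) = f (b \<otimes> t)" if "t \<in> N" for t using A.m_comm[of t b] that b by simp
    qed
    ultimately show ?thesis by simp
  qed
  define act where "act a = map_sum (\<lambda>x. a \<otimes> x) (\<lambda>x. a \<otimes> x)" for a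
  \<comment> \<open>Off the carrier nothing bounds the kernel; the weight removes these entries before averaging.\<close>
  define w :: "'a + 'a \<Rightarrow> complex" where "w s = (if s \<in> carrier G <+> carrier G then 1 else 0)" for s
  define B where "B a s t = w s * cnj (w t) * K (act a s) (act a t)" for a s t
  define L where "L s t = m.cmean (\<lambda>a. B a s t)" for s t
  have posK: "pos_kernel K" using K by (simp add: schur_kernel_def)
  have bd: "bounded ((\<lambda>a. B a s t) ` N)" for s t
  proof (cases "s \<in> carrier G <+> carrier G \<and> t \<in> carrier G <+> carrier G")
    case True
    have d: "Re (K (act a s) (act a s)) \<le> max p q" if "a \<in> N" "s \<in> carrier G <+> carrier G" for a s
      using K that NG by (force simp: schur_kernel_def act_def le_max_iff_disj)
    have "cmod (B a s t) \<le> max p q" if "a \<in> N" for a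
      using pos_kernel_norm_le[OF posK, of "act a s" "act a t"] d[OF that, of s] d[OF that, of t] True
      by (simp add: B_def w_def)
    then show ?thesis by (auto simp: bounded_iff)
  next
    case False
    then have "(\<lambda>a. B a s t) = (\<lambda>a. 0)" by (auto simp: B_def w_def)
    then show ?thesis by (simp only: bounded_fun_const)
  qed
  have "pos_kernel L"
    unfolding L_def
  proof (rule pos_kernel_mean[OF m _ bd])
    show "pos_kernel (B a)" for a
      unfolding B_def using pos_kernel_reindex[OF posK, of w "act a"] .
  qed
  moreover have "Re (L (Inl x) (Inl x)) \<le> p" "Re (L (Inr x) (Inr x)) \<le> q" if x: "x \<in> carrier G" for x
  proof -
    have le: "Re (L s s) \<le> r" if "\<And>a. a \<in> N \<Longrightarrow> Re (B a s s) \<le> r" for s r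
      unfolding L_def m.Re_cmean by (rule m.le_const[OF bounded_fun_Re[OF bd]]) (rule that)
    show "Re (L (Inl x) (Inl x)) \<le> p" "Re (L (Inr x) (Inr x)) \<le> q"
      by (rule le, use x NG K in \<open>auto simp: B_def w_def act_def schur_kernel_def\<close>)+
  qed
  moreover have "L (Inl x) (Inr y) = \<phi> (inv y \<otimes> x)" if x: "x \<in> carrier G" and y: "y \<in> carrier G" for x y
  proof -
    have "m.cmean (\<lambda>a. B a (Inl x) (Inr y)) = m.cmean (\<lambda>a. \<phi> (inv y \<otimes> x))"
    proof (rule m.cmean_cong[OF bd])
      fix a assume "a \<in> N"
      then have a: "a \<in> carrier G" using NG by auto
      have "inv a \<otimes> (a \<otimes> x) = x" using a x by (simp flip: m_assoc)
      then have "inv (a \<otimes> y) \<otimes> (a \<otimes> x) = inv y \<otimes> x"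
        using a x y by (simp add: inv_mult_group m_assoc)
      then show "B a (Inl x) (Inr y) = \<phi> (inv y \<otimes> x)"
        using K a x y by (auto simp: B_def w_def act_def schur_kernel_def)
    qed
    then show ?thesis by (simp add: L_def m.cmean_const)
  qed
  ultimately have 1: "schur_kernel G \<phi> p q L" by (simp add: schur_kernel_def)
  have "L (act b s) (act b t) = L s t"
    if b: "b \<in> N" and s: "s \<in> carrier G <+> carrier G" and t: "t \<in> carrier G <+> carrier G" for b s t
  proof -
    have bG: "b \<in> carrier G" using b NG by auto
    have st': "act b s \<in> carrier G <+> carrier G" "act b t \<in> carrier G <+> carrier G"
      using s t bG by (auto simp: act_def)
    have aa: "act a (act b s) = act (a \<otimes> b) s" if "a \<in> N" "s \<in> carrier G <+> carrier G" for a s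
      using that bG NG by (auto simp: act_def m_assoc subset_iff)
    have B: "B a (act b s) (act b t) = B (a \<otimes> b) s t" if "a \<in> N" for a
      using st' s t aa[OF that] by (simp add: B_def w_def)
    have "L (act b s) (act b t) = m.cmean (\<lambda>a. B (a \<otimes> b) s t)"
      unfolding L_def by (rule m.cmean_cong[OF bd]) (rule B)
    also have "\<dots> = L s t"
      unfolding L_def complex_eq_iff m.Re_cmean m.Im_cmean
      using right[OF b bounded_fun_Re[OF bd[of s t]]] right[OF b bounded_fun_Im[OF bd[of s t]]] by simp
    finally show ?thesis .
  qed
  then have "left_invariant G N L" by (simp add: left_invariant_def act_def)
  with 1 show ?thesis by blast
qed

definition two_sided_average :: "('g, 'm) monoid_scheme \<Rightarrow> 'g set \<Rightarrow> ('g \<Rightarrow> complex) \<Rightarrow> 'g \<Rightarrow> complex"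
  where "two_sided_average G E \<phi> x = (\<Sum>g\<in>E. \<Sum>h\<in>E. \<phi> (inv\<^bsub>G\<^esub> h \<otimes>\<^bsub>G\<^esub> x \<otimes>\<^bsub>G\<^esub> g)) / (of_nat (card E))\<^sup>2"

text \<open>Right translation of \<open>\<phi>\<close> by \<open>g\<close> replaces \<open>\<xi> x\<close> by \<open>\<xi> (x \<otimes> g)\<close>, and left translation acts in the
  same way on \<open>\<eta>\<close>. So the two-sided average is represented by the averages of these vectors, whose
  lengths are the quantities bounded here.\<close>

lemma (in group) schur_kernel_two_sided_average:
  assumes K: "schur_kernel G \<phi> p q K" and E: "finite E" "E \<noteq> {}" "E \<subseteq> carrier G"
    and p': "\<And>x. x \<in> carrier G \<Longrightarrow> Re (\<Sum>g\<in>E. \<Sum>h\<in>E. K (Inl (x \<otimes> g)) (Inl (x \<otimes> h))) \<le> (real (card E))\<^sup>2 * p'"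
    and q': "\<And>x. x \<in> carrier G \<Longrightarrow> Re (\<Sum>g\<in>E. \<Sum>h\<in>E. K (Inr (x \<otimes> g)) (Inr (x \<otimes> h))) \<le> (real (card E))\<^sup>2 * q'"
  shows "\<exists>L. schur_kernel G (two_sided_average G E \<phi>) p' q' L"
proof -
  define n :: complex where "n = of_nat (card E)"
  have n: "n \<noteq> 0" "cnj n = n" using E by (auto simp: n_def)
  define v where "v s g = map_sum (\<lambda>x. x \<otimes> g) (\<lambda>x. x \<otimes> g) s" for s g
  define L where "L s t = (\<Sum>g\<in>E. \<Sum>h\<in>E. 1 / n * cnj (1 / n) * K (v s g) (v t h))" for s t
  have L: "L s t = (\<Sum>g\<in>E. \<Sum>h\<in>E. K (v s g) (v t h)) / n\<^sup>2" for s t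
    using n by (simp add: L_def sum_divide_distrib power2_eq_square)
  have "pos_kernel L"
    unfolding L_def using K E by (intro pos_kernel_pullback) (auto simp: schur_kernel_def)
  moreover have "Re (L s s) \<le> r" if "Re (\<Sum>g\<in>E. \<Sum>h\<in>E. K (v s g) (v s h)) \<le> (real (card E))\<^sup>2 * r" for s r
  proof -
    have "n\<^sup>2 = of_real ((card E)\<^sup>2)" by (simp add: n_def)
    then have "Re (L s s) = Re (\<Sum>g\<in>E. \<Sum>h\<in>E. K (v s g) (v s h)) / (card E)\<^sup>2"
      unfolding L by (simp only: Re_divide_of_real)
    moreover have "0 < (real (card E))\<^sup>2" using E by (simp add: card_gt_0_iff)
    ultimately show ?thesis using that by (simp add: divide_le_eq mult.commute)
  qed
  moreover have "L (Inl x) (Inr y) = two_sided_average G E \<phi> (inv y \<otimes> x)"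
    if x: "x \<in> carrier G" and y: "y \<in> carrier G" for x y
  proof -
    have "K (v (Inl x) g) (v (Inr y) h) = \<phi> (inv h \<otimes> (inv y \<otimes> x) \<otimes> g)" if "g \<in> E" "h \<in> E" for g h
    proof -
      have gh: "g \<in> carrier G" "h \<in> carrier G" using that E by auto
      then have "K (v (Inl x) g) (v (Inr y) h) = \<phi> (inv (y \<otimes> h) \<otimes> (x \<otimes> g))"
        using K x y by (auto simp: v_def schur_kernel_def)
      then show ?thesis using gh x y by (simp add: inv_mult_group m_assoc)
    qed
    then show ?thesis by (simp add: L two_sided_average_def n_def)
  qed
  ultimately have "schur_kernel G (two_sided_average G E \<phi>) p' q' L"
    using p' q' by (simp add: schur_kernel_def v_def)
  then show ?thesis by blast
qed

lemma (in group) finite_translated_support: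
  assumes fin: "finite {x\<in>carrier G. \<phi> x \<noteq> 0}" and E: "finite E" "E \<subseteq> carrier G"
  shows "finite {x\<in>carrier G. \<exists>g\<in>E. \<exists>h\<in>E. \<phi> (inv h \<otimes> x \<otimes> g) \<noteq> 0}"
proof (rule finite_subset)
  show "{x\<in>carrier G. \<exists>g\<in>E. \<exists>h\<in>E. \<phi> (inv h \<otimes> x \<otimes> g) \<noteq> 0} \<subseteq>
      (\<lambda>(y, g, h). h \<otimes> y \<otimes> inv g) ` ({x\<in>carrier G. \<phi> x \<noteq> 0} \<times> E \<times> E)"
  proof
    fix x assume x: "x \<in> {x\<in>carrier G. \<exists>g\<in>E. \<exists>h\<in>E. \<phi> (inv h \<otimes> x \<otimes> g) \<noteq> 0}"
    then obtain g h where gh: "g \<in> E" "h \<in> E" "\<phi> (inv h \<otimes> x \<otimes> g) \<noteq> 0" by blast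
    have c: "g \<in> carrier G" "h \<in> carrier G" "x \<in> carrier G" using gh E x by auto
    have "h \<otimes> (inv h \<otimes> x) = x" using c by (simp flip: m_assoc)
    then have "x = h \<otimes> (inv h \<otimes> x \<otimes> g) \<otimes> inv g" using c by (simp add: m_assoc)
    moreover have "inv h \<otimes> x \<otimes> g \<in> carrier G" using c by simp
    ultimately show "x \<in> (\<lambda>(y, g, h). h \<otimes> y \<otimes> inv g) ` ({x\<in>carrier G. \<phi> x \<noteq> 0} \<times> E \<times> E)"
      using gh by (intro image_eqI[of _ _ "(inv h \<otimes> x \<otimes> g, g, h)"]) auto
  qed
qed (use fin E in auto)

lemma (in group) finite_support_two_sided_average:
  assumes fin: "finite {x\<in>carrier G. \<phi> x \<noteq> 0}" and E: "finite E" "E \<subseteq> carrier G"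
  shows "finite {x\<in>carrier G. two_sided_average G E \<phi> x \<noteq> 0}"
proof (rule finite_subset[OF _ finite_translated_support[OF fin E]])
  have "two_sided_average G E \<phi> x = 0" if "\<forall>g\<in>E. \<forall>h\<in>E. \<phi> (inv h \<otimes> x \<otimes> g) = 0" for x
    using that by (simp add: two_sided_average_def)
  then show "{x\<in>carrier G. two_sided_average G E \<phi> x \<noteq> 0} \<subseteq>
      {x\<in>carrier G. \<exists>g\<in>E. \<exists>h\<in>E. \<phi> (inv h \<otimes> x \<otimes> g) \<noteq> 0}"
    by blast
qed

lemma two_sided_average_near_1:
  assumes E: "finite E" "E \<noteq> {}" and e: "\<And>g h. g \<in> E \<Longrightarrow> h \<in> E \<Longrightarrow> cmod (\<phi> (inv\<^bsub>G\<^esub> h \<otimes>\<^bsub>G\<^esub> x \<otimes>\<^bsub>G\<^esub> g) - 1) \<le> e"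
  shows "cmod (two_sided_average G E \<phi> x - 1) \<le> e"
proof -
  define n :: real where "n = card E"
  have n: "n > 0" using E by (simp add: n_def card_gt_0_iff)
  have "two_sided_average G E \<phi> x - 1 = (\<Sum>g\<in>E. \<Sum>h\<in>E. \<phi> (inv\<^bsub>G\<^esub> h \<otimes>\<^bsub>G\<^esub> x \<otimes>\<^bsub>G\<^esub> g) - 1) / (of_real n)\<^sup>2"
    using n E by (simp add: two_sided_average_def n_def sum_subtractf field_simps power2_eq_square)
  also have "cmod \<dots> = cmod (\<Sum>g\<in>E. \<Sum>h\<in>E. \<phi> (inv\<^bsub>G\<^esub> h \<otimes>\<^bsub>G\<^esub> x \<otimes>\<^bsub>G\<^esub> g) - 1) / n\<^sup>2"
    using n by (simp add: norm_divide norm_power)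
  also have "cmod (\<Sum>g\<in>E. \<Sum>h\<in>E. \<phi> (inv\<^bsub>G\<^esub> h \<otimes>\<^bsub>G\<^esub> x \<otimes>\<^bsub>G\<^esub> g) - 1) \<le> (\<Sum>g\<in>E. \<Sum>h\<in>E. e)"
    using e by (intro sum_norm_le) auto
  also have "\<dots> = e * n\<^sup>2" by (simp add: n_def power2_eq_square)
  finally show ?thesis using n by (simp add: divide_right_mono)
qed

text \<open>Let \<open>C\<close> be the optimal bound for kernels of functions approximating \<open>1\<close>. If \<open>\<phi>\<close> is close
  to \<open>1\<close> on a large set and its bound is almost \<open>C\<close>, then its averages under translations
  still approximate \<open>1\<close>, so that their bound cannot be much smaller than \<open>C\<close>. Hence, somewhere, the
  translates of the vectors on each side average to an almost longest vector, and by convexity they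
  are close to each other.\<close>

lemma almost_invariant_kernels:
  fixes G (structure)
  assumes "group G" and approx: "kernel_approximable G c0"
    and N: "subgroup N G" and comm: "comm_group (G\<lparr>carrier := N\<rparr>)"
  obtains c where "c > 0" "\<And>E S e. \<lbrakk>finite E; E \<subseteq> carrier G; finite S; S \<subseteq> carrier G; e > 0\<rbrakk> \<Longrightarrow>
    \<exists>\<phi> K x y. finite {x\<in>carrier G. \<phi> x \<noteq> 0} \<and> (\<forall>x\<in>S. cmod (\<phi> x - 1) \<le> e) \<and>
      schur_kernel G \<phi> 1 c K \<and> left_invariant G N K \<and> x \<in> carrier G \<and> y \<in> carrier G \<and>
      (\<forall>g\<in>E. kernel_dist K (Inl (x \<otimes>\<^bsub>G\<^esub> g)) (Inl x) \<le> e \<and> kernel_dist K (Inr (y \<otimes>\<^bsub>G\<^esub> g)) (Inr y) \<le> e)"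
proof -
  interpret group G by fact
  define A where "A = {c. kernel_approximable G c}"
  have A1: "c \<ge> 0" if "c \<in> A" for c
  proof -
    have c: "kernel_approximable G c" using that by (simp add: A_def)
    have "finite {\<one>\<^bsub>G\<^esub>} \<and> {\<one>\<^bsub>G\<^esub>} \<subseteq> carrier G \<and> (0::real) < 1" by simp
    from c[unfolded kernel_approximable_def, rule_format, OF this]
    obtain \<phi> K where K: "schur_kernel G \<phi> 1 c K" by (elim exE conjE)
    then have "Re (K (Inr \<one>\<^bsub>G\<^esub>) (Inr \<one>\<^bsub>G\<^esub>)) \<le> c" "pos_kernel K" by (simp_all add: schur_kernel_def)
    then show ?thesis using pos_kernel_diag[of K "Inr \<one>\<^bsub>G\<^esub>"] by linarith
  qed
  have bddA: "bdd_below A" by (rule bdd_belowI[of _ 0]) (rule A1)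
  have c0A: "c0 \<in> A" using approx by (simp add: A_def)
  define C where "C = Inf A"
  have C0: "C > 0"
  proof -
    have "1 / 2 \<le> c" if "c \<in> A" for c
    proof -
      have c: "kernel_approximable G c" using that by (simp add: A_def)
      have "finite {\<one>\<^bsub>G\<^esub>} \<and> {\<one>\<^bsub>G\<^esub>} \<subseteq> carrier G \<and> (0::real) < 1 / 8" by simp
      from c[unfolded kernel_approximable_def, rule_format, OF this]
      obtain \<phi> K where \<phi>: "cmod (\<phi> \<one>\<^bsub>G\<^esub> - 1) \<le> 1 / 8" and K: "schur_kernel G \<phi> 1 c K"
        by (elim exE conjE) simp
      have "7 / 8 \<le> cmod (\<phi> \<one>\<^bsub>G\<^esub>)" using norm_triangle_ineq2[of 1 "1 - \<phi> \<one>\<^bsub>G\<^esub>"] \<phi> by (simp add: norm_minus_commute)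
      then show ?thesis using schur_kernel_norm_le[OF assms(1) K one_closed] by simp
    qed
    then have "1 / 2 \<le> C" unfolding C_def using c0A by (intro cInf_greatest) auto
    then show ?thesis by simp
  qed
  have above: "kernel_approximable G c" if "c > C" for c
  proof -
    have "A \<noteq> {}" using c0A by blast
    then obtain c' where c': "c' \<in> A" "c' < c" using \<open>c > C\<close> cInf_less_iff[OF _ bddA, of c] unfolding C_def by blast
    show ?thesis
      unfolding kernel_approximable_def
    proof (intro allI impI)
      fix S and e :: real assume "finite S \<and> S \<subseteq> carrier G \<and> e > 0"
      from c'(1)[unfolded A_def mem_Collect_eq kernel_approximable_def, rule_format, OF this]
      obtain \<phi> K where *: "finite {x\<in>carrier G. \<phi> x \<noteq> 0}" "\<forall>x\<in>S. cmod (\<phi> x - 1) \<le> e" "schur_kernel G \<phi> 1 c' K"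
        by (elim exE conjE)
      show "\<exists>\<phi> K. finite {x\<in>carrier G. \<phi> x \<noteq> 0} \<and> (\<forall>x\<in>S. cmod (\<phi> x - 1) \<le> e) \<and> schur_kernel G \<phi> 1 c K"
        by (intro exI conjI, rule *(1), rule *(2), rule schur_kernel_mono[OF *(3)]) (use c'(2) in auto)
    qed
  qed
  have below: "\<not> kernel_approximable G c" if "c < C" for c
    using cInf_lower[OF _ bddA, of c] that by (auto simp: A_def C_def)
  have "\<exists>\<phi> K x y. finite {x\<in>carrier G. \<phi> x \<noteq> 0} \<and> (\<forall>x\<in>S. cmod (\<phi> x - 1) \<le> e) \<and>
      schur_kernel G \<phi> 1 (2 * C) K \<and> left_invariant G N K \<and> x \<in> carrier G \<and> y \<in> carrier G \<and>
      (\<forall>g\<in>E. kernel_dist K (Inl (x \<otimes>\<^bsub>G\<^esub> g)) (Inl x) \<le> e \<and> kernel_dist K (Inr (y \<otimes>\<^bsub>G\<^esub> g)) (Inr y) \<le> e)"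
    if E0: "finite E" "E \<subseteq> carrier G" and S: "finite S" "S \<subseteq> carrier G" and e: "e > 0" for E S e
  proof -
    define E' where "E' = insert \<one>\<^bsub>G\<^esub> E"
    have E: "finite E'" "E' \<noteq> {}" "E' \<subseteq> carrier G" "\<one>\<^bsub>G\<^esub> \<in> E'" using E0 by (auto simp: E'_def)
    define n where "n = (real (card E'))\<^sup>2"
    have n: "n > 0" using E by (simp add: n_def card_gt_0_iff)
    \<comment> \<open>The defect \<open>d\<close> is chosen such that convexity, which loses a factor of about the square of
      the number of translates, still yields distances at most \<open>e\<close>.\<close>
    define d where "d = min (1 / 2) (e / (2 * n * (1 + 2 * C)))"
    have "e / (2 * n * (1 + 2 * C)) > 0" using e n C0 by simp
    then have d: "0 < d" "d < 1" "d \<le> e / (2 * n * (1 + 2 * C))" by (auto simp: d_def)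
    have dn: "2 * n * d * (1 + 2 * C) \<le> e" 
    proof -
      have "2 * n * (1 + 2 * C) > 0" using n C0 by simp
      then have "d * (2 * n * (1 + 2 * C)) \<le> e" using d(3) by (simp only: pos_le_divide_eq)
      then show ?thesis by (simp only: mult_ac)
    qed
    define q where "q = C * (1 + d)"
    have q: "C < q" "q \<le> 2 * C" "0 < q" using C0 d by (auto simp: q_def)
    have q': "(1 - d) * q < C" using C0 d by (simp add: q_def field_simps)
    obtain S0 e0 where S0: "finite S0" "S0 \<subseteq> carrier G" "e0 > 0"
      and no: "\<And>\<phi> K. \<lbrakk>finite {x\<in>carrier G. \<phi> x \<noteq> 0}; \<forall>x\<in>S0. cmod (\<phi> x - 1) \<le> e0\<rbrakk> \<Longrightarrow> \<not> schur_kernel G \<phi> 1 ((1 - d) * q) K"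
      using below[OF q'] unfolding kernel_approximable_def by blast
    define S1 where "S1 = S \<union> (\<lambda>(h, x, g). inv h \<otimes> x \<otimes> g) ` (E' \<times> S0 \<times> E')"
    have "finite S1 \<and> S1 \<subseteq> carrier G \<and> min e e0 > 0"
      using S S0 E e by (auto simp: S1_def subset_iff)
    from above[OF q(1), unfolded kernel_approximable_def, rule_format, OF this]
    obtain \<phi> K0 where \<phi>: "finite {x\<in>carrier G. \<phi> x \<noteq> 0}" and near: "\<forall>x\<in>S1. cmod (\<phi> x - 1) \<le> min e e0"
      and K0: "schur_kernel G \<phi> 1 q K0" by (elim exE conjE)
    obtain K where K: "schur_kernel G \<phi> 1 q K" and inv: "left_invariant G N K"
      using schur_kernel_average_subgroup[OF K0 N comm] by blast
    have posK: "pos_kernel K" using K by (simp add: schur_kernel_def)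
    \<comment> \<open>The average still approximates \<open>1\<close> on \<open>S0\<close>, where no function has so small a bound.\<close>
    have no': "\<not> schur_kernel G (two_sided_average G E' \<phi>) 1 ((1 - d) * q) L" for L
    proof (rule no)
      show "finite {x\<in>carrier G. two_sided_average G E' \<phi> x \<noteq> 0}"
        using finite_support_two_sided_average[OF \<phi> E(1,3)] .
      show "\<forall>x\<in>S0. cmod (two_sided_average G E' \<phi> x - 1) \<le> e0"
      proof (intro ballI two_sided_average_near_1 E)
        fix x g h assume "x \<in> S0" "g \<in> E'" "h \<in> E'"
        then have "inv h \<otimes> x \<otimes> g \<in> S1" by (force simp: S1_def)
        then show "cmod (\<phi> (inv h \<otimes> x \<otimes> g) - 1) \<le> e0" using near by auto
      qed
    qed
    have dl: "Re (K (Inl (x \<otimes> g)) (Inl (x \<otimes> g))) \<le> 1" and dr: "Re (K (Inr (x \<otimes> g)) (Inr (x \<otimes> g))) \<le> q"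
      if "x \<in> carrier G" "g \<in> E'" for x g
      using K that E by (auto simp: schur_kernel_def)
    have "\<exists>x\<in>carrier G. n * (1 - d) < Re (\<Sum>g\<in>E'. \<Sum>h\<in>E'. K (Inl (x \<otimes> g)) (Inl (x \<otimes> h)))"
    proof (rule ccontr)
      assume "\<not> ?thesis"
      then obtain L where L: "schur_kernel G (two_sided_average G E' \<phi>) (1 - d) q L"
        using schur_kernel_two_sided_average[OF K E(1-3), of "1 - d" q]
          pos_kernel_average(1)[OF posK E(1), of "\<lambda>g. Inr (_ \<otimes> g)" q] dr by (force simp: n_def not_less)
      have "1 - d > 0" using d by simp
      from schur_kernel_rescale[OF L this] no' d show False by (auto simp: mult.commute)
    qed
    then obtain x where x: "x \<in> carrier G"
      and xd: "n * (1 - d) < Re (\<Sum>g\<in>E'. \<Sum>h\<in>E'. K (Inl (x \<otimes> g)) (Inl (x \<otimes> h)))" by blast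
    have "\<exists>y\<in>carrier G. n * ((1 - d) * q) < Re (\<Sum>g\<in>E'. \<Sum>h\<in>E'. K (Inr (y \<otimes> g)) (Inr (y \<otimes> h)))"
    proof (rule ccontr)
      assume "\<not> ?thesis"
      then obtain L where "schur_kernel G (two_sided_average G E' \<phi>) 1 ((1 - d) * q) L"
        using schur_kernel_two_sided_average[OF K E(1-3), of 1 "(1 - d) * q"]
          pos_kernel_average(1)[OF posK E(1), of "\<lambda>g. Inl (_ \<otimes> g)" 1] dl by (force simp: n_def not_less)
      with no' show False by blast
    qed
    then obtain y where y: "y \<in> carrier G"
      and yd: "n * ((1 - d) * q) < Re (\<Sum>g\<in>E'. \<Sum>h\<in>E'. K (Inr (y \<otimes> g)) (Inr (y \<otimes> h)))" by blast
    have "kernel_dist K (Inl (x \<otimes> g)) (Inl x) \<le> e \<and> kernel_dist K (Inr (y \<otimes> g)) (Inr y) \<le> e" if g: "g \<in> E" for g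
    proof
      have gE: "g \<in> E'" using g by (simp add: E'_def)
      have nd: "n * d \<ge> 0" using n d by simp
      have "kernel_dist K (Inl (x \<otimes> g)) (Inl (x \<otimes> \<one>)) \<le> 2 * (n * 1 - Re (\<Sum>g\<in>E'. \<Sum>h\<in>E'. K (Inl (x \<otimes> g)) (Inl (x \<otimes> h))))"
        using pos_kernel_average(2)[OF posK E(1), of "\<lambda>g. Inl (x \<otimes> g)" 1, OF _ gE E(4)] dl[OF x] by (simp add: n_def)
      also have "\<dots> \<le> 2 * n * d" using xd by (simp add: algebra_simps)
      also have "\<dots> \<le> e" using dn mult_nonneg_nonneg[OF nd less_imp_le[OF C0]] by (simp add: algebra_simps)
      finally show "kernel_dist K (Inl (x \<otimes> g)) (Inl x) \<le> e" using x by simp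
      have "kernel_dist K (Inr (y \<otimes> g)) (Inr (y \<otimes> \<one>)) \<le> 2 * (n * q - Re (\<Sum>g\<in>E'. \<Sum>h\<in>E'. K (Inr (y \<otimes> g)) (Inr (y \<otimes> h))))"
        using pos_kernel_average(2)[OF posK E(1), of "\<lambda>g. Inr (y \<otimes> g)" q, OF _ gE E(4)] dr[OF y] by (simp add: n_def)
      also have "\<dots> \<le> 2 * (n * d) * q" using yd by (simp add: algebra_simps)
      also have "\<dots> \<le> 2 * (n * d) * (2 * C)" using q nd by (intro mult_left_mono) auto
      also have "\<dots> \<le> e" using dn nd by (simp add: algebra_simps)
      finally show "kernel_dist K (Inr (y \<otimes> g)) (Inr y) \<le> e" using y by simp
    qed
    moreover have "\<forall>x\<in>S. cmod (\<phi> x - 1) \<le> e" using near by (auto simp: S1_def)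
    moreover have "schur_kernel G \<phi> 1 (2 * C) K" by (rule schur_kernel_mono[OF K order_refl q(2)])
    ultimately show ?thesis using \<phi> inv x y by (intro exI[of _ \<phi>] exI[of _ K] exI[of _ x] exI[of _ y]) blast
  qed
  then show thesis using that[of "2 * C"] C0 by simp
qed

section \<open>Square roots of transforms\<close>

context dual_mean
begin

lemma bounded_trig: "bounded ((\<lambda>\<theta>. \<Sum>a\<in>S. c a * \<theta> a) ` X)"
  by (intro bounded_fun_sum bounded_fun_mult) auto

lemma parseval:
  assumes S: "finite S" "S \<subseteq> carrier N"
  shows "M (\<lambda>\<theta>. (cmod (\<Sum>a\<in>S. c a * \<theta> a))\<^sup>2) = (\<Sum>a\<in>S. (cmod (c a))\<^sup>2)"
proof -
  have 1: "(cmod (\<Sum>a\<in>S. c a * \<theta> a))\<^sup>2 = Re (\<Sum>a\<in>S. \<Sum>b\<in>S. \<theta> a * cnj (\<theta> b) * (c a * cnj (c b)))" for \<theta>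
  proof -
    have "complex_of_real ((cmod (\<Sum>a\<in>S. c a * \<theta> a))\<^sup>2) = (\<Sum>a\<in>S. \<Sum>b\<in>S. \<theta> a * cnj (\<theta> b) * (c a * cnj (c b)))"
      unfolding complex_norm_square by (simp add: sum_product mult_ac)
    from arg_cong[OF this, of Re] show ?thesis by simp
  qed
  have 2: "Re (\<Sum>a\<in>S. c a * cnj (c a)) = (\<Sum>a\<in>S. (cmod (c a))\<^sup>2)"
    by (simp add: complex_mult_cnj cmod_power2)
  show ?thesis unfolding 1 mean_quadratic[OF S] 2 ..
qed

lemma bessel:
  assumes F: "bounded (F ` X)" and S: "finite S" "S \<subseteq> carrier N"
  shows "(\<Sum>a\<in>S. (cmod (cmean (\<lambda>\<theta>. F \<theta> * cnj (\<theta> a))))\<^sup>2) \<le> M (\<lambda>\<theta>. (cmod (F \<theta>))\<^sup>2)"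
proof -
  define c where "c a = cmean (\<lambda>\<theta>. F \<theta> * cnj (\<theta> a))" for a
  define P where "P \<theta> = (\<Sum>a\<in>S. c a * \<theta> a)" for \<theta>
  have bP: "bounded (P ` X)" unfolding P_def by (rule bounded_trig)
  have bF: "bounded ((\<lambda>\<theta>. F \<theta> * cnj (\<theta> a)) ` X)" for a
    by (rule bounded_fun_mult[OF F]) simp
  have b: "bounded ((\<lambda>\<theta>. (cmod (F \<theta>))\<^sup>2) ` X)" "bounded ((\<lambda>\<theta>. Re (F \<theta> * cnj (P \<theta>))) ` X)"
    "bounded ((\<lambda>\<theta>. (cmod (P \<theta>))\<^sup>2) ` X)"
    by (intro bounded_fun_power bounded_fun_norm bounded_fun_Re bounded_fun_mult bounded_fun_cnj F bP)+
  have "cmean (\<lambda>\<theta>. F \<theta> * cnj (P \<theta>)) = cmean (\<lambda>\<theta>. \<Sum>a\<in>S. cnj (c a) * (F \<theta> * cnj (\<theta> a)))"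
    by (simp add: P_def sum_distrib_left mult_ac)
  also have "\<dots> = (\<Sum>a\<in>S. cnj (c a) * c a)"
    using bF by (simp add: cmean_sum cmean_scale bounded_fun_mult c_def)
  finally have "Re (cmean (\<lambda>\<theta>. F \<theta> * cnj (P \<theta>))) = (\<Sum>a\<in>S. (cmod (c a))\<^sup>2)"
  proof -
    assume "cmean (\<lambda>\<theta>. F \<theta> * cnj (P \<theta>)) = (\<Sum>a\<in>S. cnj (c a) * c a)"
    moreover have "Re (cnj z * z) = (cmod z)\<^sup>2" for z
      unfolding cmod_power2 by (simp add: power2_eq_square)
    ultimately show ?thesis by (simp only: Re_sum)
  qed
  then have cross: "M (\<lambda>\<theta>. Re (F \<theta> * cnj (P \<theta>))) = (\<Sum>a\<in>S. (cmod (c a))\<^sup>2)" by simp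
  have PP: "M (\<lambda>\<theta>. (cmod (P \<theta>))\<^sup>2) = (\<Sum>a\<in>S. (cmod (c a))\<^sup>2)"
    unfolding P_def by (rule parseval[OF S])
  have "0 \<le> M (\<lambda>\<theta>. (cmod (F \<theta>))\<^sup>2 + ((-2) * Re (F \<theta> * cnj (P \<theta>)) + (cmod (P \<theta>))\<^sup>2))"
  proof (rule nonneg)
    show "bounded ((\<lambda>\<theta>. (cmod (F \<theta>))\<^sup>2 + ((-2) * Re (F \<theta> * cnj (P \<theta>)) + (cmod (P \<theta>))\<^sup>2)) ` X)"
      by (rule bounded_fun_add[OF b(1) bounded_fun_add[OF bounded_fun_mult[OF bounded_fun_const b(2)] b(3)]])
    show "0 \<le> (cmod (F \<theta>))\<^sup>2 + ((-2) * Re (F \<theta> * cnj (P \<theta>)) + (cmod (P \<theta>))\<^sup>2)" for \<theta>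
    proof -
      have "(cmod (F \<theta> - P \<theta>))\<^sup>2 = (cmod (F \<theta>))\<^sup>2 + ((-2) * Re (F \<theta> * cnj (P \<theta>)) + (cmod (P \<theta>))\<^sup>2)"
        unfolding cmod_power2 by (simp add: power2_eq_square algebra_simps)
      then show ?thesis by (metis zero_le_power2)
    qed
  qed
  also have "\<dots> = M (\<lambda>\<theta>. (cmod (F \<theta>))\<^sup>2) + ((-2) * M (\<lambda>\<theta>. Re (F \<theta> * cnj (P \<theta>))) + M (\<lambda>\<theta>. (cmod (P \<theta>))\<^sup>2))"
    by (simp only: add[OF b(1) bounded_fun_add[OF bounded_fun_mult[OF bounded_fun_const b(2)] b(3)]]
        add[OF bounded_fun_mult[OF bounded_fun_const b(2)] b(3)] scale[OF b(2)])
  finally show ?thesis unfolding cross PP c_def by simp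
qed

lemma cmean_trig_coeff:
  assumes S: "finite S" "S \<subseteq> carrier N" and a: "a \<in> carrier N"
  shows "cmean (\<lambda>\<theta>. (\<Sum>b\<in>S. c b * \<theta> b) * cnj (\<theta> a)) = (if a \<in> S then c a else 0)"
proof -
  have b: "bounded ((\<lambda>\<theta>. \<theta> b * cnj (\<theta> a)) ` X)" for b by (rule bounded_fun_mult) auto
  have "cmean (\<lambda>\<theta>. (\<Sum>b\<in>S. c b * \<theta> b) * cnj (\<theta> a)) = cmean (\<lambda>\<theta>. \<Sum>b\<in>S. c b * (\<theta> b * cnj (\<theta> a)))"
    by (simp add: sum_distrib_right mult.assoc)
  also have "\<dots> = (\<Sum>b\<in>S. c b * cmean (\<lambda>\<theta>. \<theta> b * cnj (\<theta> a)))"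
    using b by (simp add: cmean_sum cmean_scale bounded_fun_mult)
  also have "\<dots> = (\<Sum>b\<in>S. c b * (if b = a then 1 else 0))"
    using S a by (intro sum.cong refl) (simp add: cmean_orthogonal subset_iff)
  also have "\<dots> = (if a \<in> S then c a else 0)" using S by (simp add: if_distrib cong: if_cong)
  finally show ?thesis .
qed

text \<open>If \<open>sqrt \<bar>f\<bar>\<close> were nearly constant, then \<open>f\<close> would nearly be a multiple of the bounded function
  \<open>sgn f\<close>, whose Fourier coefficients are square summable with sum at most \<open>1\<close>. So \<open>f\<close> could not
  have many coefficients close to \<open>1\<close>.\<close>

lemma variance_sqrt_norm_ge:
  assumes f: "bounded (f ` X)" and B: "M (\<lambda>\<theta>. cmod (f \<theta>)) \<le> B" "B \<ge> 0"
    and S: "finite S" "S \<subseteq> carrier N" "8 * (1 + B) ^ 4 < card S"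
    and coeff: "\<And>a. a \<in> S \<Longrightarrow> 1 / 2 \<le> cmod (cmean (\<lambda>\<theta>. f \<theta> * cnj (\<theta> a)))"
    and k: "\<bar>k\<bar> \<le> 1 + B"
  shows "1 / (272 * (1 + B)\<^sup>2) \<le> M (\<lambda>\<theta>. (sqrt (cmod (f \<theta>)) - k)\<^sup>2)"
proof (rule ccontr)
  define L where "L = 1 + B"
  have L: "L \<ge> 1" using B by (simp add: L_def)
  define w where "w \<theta> = sqrt (cmod (f \<theta>)) - k" for \<theta>
  define V where "V = M (\<lambda>\<theta>. (w \<theta>)\<^sup>2)"
  assume "\<not> ?thesis"
  then have V: "V < 1 / (272 * L\<^sup>2)" by (simp add: V_def w_def L_def)
  obtain R where R: "\<forall>\<theta>\<in>X. cmod (f \<theta>) \<le> R" using f by (auto simp: bounded_iff)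
  have bsq: "bounded ((\<lambda>\<theta>. sqrt (cmod (f \<theta>))) ` X)"
    by (rule bounded_fun_leI[of _ _ "sqrt R"]) (use R in simp)
  have bw: "bounded (w ` X)" unfolding w_def by (rule bounded_fun_diff[OF bsq bounded_fun_const])
  have bw2: "bounded ((\<lambda>\<theta>. (w \<theta>)\<^sup>2) ` X)" by (rule bounded_fun_power[OF bw])
  have V0: "V \<ge> 0" unfolding V_def by (rule nonneg[OF bw2]) simp
  have cL: "(1 + 16 * L\<^sup>2) * V \<le> 1 / 16"
  proof -
    have L2: "1 \<le> L\<^sup>2" using L by (simp add: one_le_power)
    have "(1 + 16 * L\<^sup>2) * V \<le> (17 * L\<^sup>2) * V" using L2 V0 by (intro mult_right_mono) auto
    also have "\<dots> \<le> (17 * L\<^sup>2) * (1 / (272 * L\<^sup>2))" using V by (intro mult_left_mono) auto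
    also have "\<dots> = 1 / 16" using L by simp
    finally show ?thesis .
  qed
  define D where "D \<theta> = \<bar>cmod (f \<theta>) - k\<^sup>2\<bar>" for \<theta>
  have bD: "bounded (D ` X)"
    unfolding D_def by (intro bounded_fun_abs bounded_fun_diff bounded_fun_norm f bounded_fun_const)
  have MD: "M D \<le> 1 / 8"
  proof -
    have D: "D \<theta> \<le> (1 + 16 * L\<^sup>2) * (w \<theta>)\<^sup>2 + 1 / 16" for \<theta>
    proof -
      have "cmod (f \<theta>) = (w \<theta> + k)\<^sup>2" by (simp add: w_def)
      then have "D \<theta> = \<bar>(w \<theta>)\<^sup>2 + 2 * k * w \<theta>\<bar>" by (simp add: D_def power2_sum mult_ac)
      also have "\<dots> \<le> (w \<theta>)\<^sup>2 + 2 * \<bar>k\<bar> * \<bar>w \<theta>\<bar>"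
        by (rule order_trans[OF abs_triangle_ineq]) (simp add: abs_mult)
      also have "\<dots> \<le> (w \<theta>)\<^sup>2 + 2 * L * \<bar>w \<theta>\<bar>"
        using k by (intro add_left_mono mult_right_mono) (auto simp: L_def)
      \<comment> \<open>The weights make the constant term half of the bound \<open>1/8\<close> needed for \<open>M D\<close>.\<close>
      also have "2 * L * \<bar>w \<theta>\<bar> \<le> 16 * L\<^sup>2 * (w \<theta>)\<^sup>2 + 1 / 16"
      proof -
        have "0 \<le> (4 * L * \<bar>w \<theta>\<bar> - 1 / 4)\<^sup>2" by simp
        then show ?thesis by (simp add: power2_diff power_mult_distrib power_divide)
      qed
      finally show ?thesis by (simp add: algebra_simps)
    qed
    have bb: "bounded ((\<lambda>\<theta>. (1 + 16 * L\<^sup>2) * (w \<theta>)\<^sup>2) ` X)" by (rule bounded_fun_mult[OF bounded_fun_const bw2])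
    have "M D \<le> M (\<lambda>\<theta>. (1 + 16 * L\<^sup>2) * (w \<theta>)\<^sup>2 + 1 / 16)"
      by (rule mono[OF bD bounded_fun_add[OF bb bounded_fun_const]]) (rule D)
    also have "\<dots> = (1 + 16 * L\<^sup>2) * V + 1 / 16"
      by (simp only: add[OF bb bounded_fun_const] scale[OF bw2] const V_def)
    finally show ?thesis using cL by simp
  qed
  define s where "s \<theta> = sgn (f \<theta>)" for \<theta>
  have s1: "cmod (s \<theta>) \<le> 1" for \<theta> by (simp add: s_def norm_sgn)
  have bs: "bounded (s ` X)" by (rule bounded_fun_leI[of _ _ 1]) (rule s1)
  have bsa: "bounded ((\<lambda>\<theta>. s \<theta> * cnj (\<theta> a)) ` X)" "bounded ((\<lambda>\<theta>. f \<theta> * cnj (\<theta> a)) ` X)" for a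
    by (rule bounded_fun_mult[OF bs bounded_cnj_char], rule bounded_fun_mult[OF f bounded_cnj_char])
  have large: "9 / 64 \<le> L ^ 4 * (cmod (cmean (\<lambda>\<theta>. s \<theta> * cnj (\<theta> a))))\<^sup>2" if a: "a \<in> S" for a
  proof -
    define z where "z = cmean (\<lambda>\<theta>. s \<theta> * cnj (\<theta> a))"
    have "cmod (cmean (\<lambda>\<theta>. f \<theta> * cnj (\<theta> a) - complex_of_real (k\<^sup>2) * (s \<theta> * cnj (\<theta> a)))) \<le> M D"
    proof (rule norm_cmean_le[OF _ bD])
      show "bounded ((\<lambda>\<theta>. f \<theta> * cnj (\<theta> a) - complex_of_real (k\<^sup>2) * (s \<theta> * cnj (\<theta> a))) ` X)"
        by (rule bounded_fun_diff[OF bsa(2) bounded_fun_mult[OF bounded_fun_const bsa(1)]])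
      fix \<theta> assume \<theta>: "\<theta> \<in> X"
      have "f \<theta> = complex_of_real (cmod (f \<theta>)) * s \<theta>"
        by (cases "f \<theta> = 0") (simp_all add: s_def sgn_div_norm scaleR_conv_of_real)
      then have "f \<theta> * cnj (\<theta> a) - complex_of_real (k\<^sup>2) * (s \<theta> * cnj (\<theta> a)) =
          complex_of_real (cmod (f \<theta>) - k\<^sup>2) * (s \<theta> * cnj (\<theta> a))"
        by (metis (no_types, lifting) left_diff_distrib mult.assoc of_real_diff)
      then have "cmod (f \<theta> * cnj (\<theta> a) - complex_of_real (k\<^sup>2) * (s \<theta> * cnj (\<theta> a))) = D \<theta> * cmod (s \<theta>)"
        by (simp only: norm_mult norm_of_real D_def complex_mod_cnj dual_norm[OF \<theta>] mult_1_right)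
      also have "\<dots> \<le> D \<theta>" using s1[of \<theta>] by (intro mult_left_le) (auto simp: D_def)
      finally show "cmod (f \<theta> * cnj (\<theta> a) - complex_of_real (k\<^sup>2) * (s \<theta> * cnj (\<theta> a))) \<le> D \<theta>" .
    qed
    also have "cmean (\<lambda>\<theta>. f \<theta> * cnj (\<theta> a) - complex_of_real (k\<^sup>2) * (s \<theta> * cnj (\<theta> a))) =
        cmean (\<lambda>\<theta>. f \<theta> * cnj (\<theta> a)) - complex_of_real (k\<^sup>2) * z"
      by (simp only: cmean_diff[OF bsa(2) bounded_fun_mult[OF bounded_fun_const bsa(1)]] cmean_scale[OF bsa(1)] z_def)
    finally have "cmod (cmean (\<lambda>\<theta>. f \<theta> * cnj (\<theta> a)) - complex_of_real (k\<^sup>2) * z) \<le> 1 / 8" using MD by simp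
    then have "3 / 8 \<le> cmod (complex_of_real (k\<^sup>2) * z)"
      using coeff[OF a] norm_triangle_ineq2[of "cmean (\<lambda>\<theta>. f \<theta> * cnj (\<theta> a))" "complex_of_real (k\<^sup>2) * z"] by linarith
    also have "\<dots> = k\<^sup>2 * cmod z" by (simp only: norm_mult norm_of_real) simp
    also have "\<dots> \<le> L\<^sup>2 * cmod z"
      using k abs_le_square_iff[of k L] B by (intro mult_right_mono) (auto simp: L_def)
    finally have "(3 / 8)\<^sup>2 \<le> (L\<^sup>2 * cmod z)\<^sup>2" by (intro power_mono) auto
    then show ?thesis unfolding z_def by (simp add: power_mult_distrib power_divide flip: power_mult)
  qed
  have "card S * (9 / 64) \<le> (\<Sum>a\<in>S. L ^ 4 * (cmod (cmean (\<lambda>\<theta>. s \<theta> * cnj (\<theta> a))))\<^sup>2)"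
    using sum_mono[OF large, of S "\<lambda>a. a"] by simp
  also have "\<dots> = L ^ 4 * (\<Sum>a\<in>S. (cmod (cmean (\<lambda>\<theta>. s \<theta> * cnj (\<theta> a))))\<^sup>2)" by (simp add: sum_distrib_left)
  also have "\<dots> \<le> L ^ 4 * M (\<lambda>\<theta>. (cmod (s \<theta>))\<^sup>2)"
    using bessel[OF bs S(1,2)] L by (intro mult_left_mono) auto
  also have "\<dots> \<le> L ^ 4 * 1"
  proof (rule mult_left_mono)
    show "M (\<lambda>\<theta>. (cmod (s \<theta>))\<^sup>2) \<le> 1"
      using s1 by (intro le_const bounded_fun_power bounded_fun_norm bs) (auto simp: power_le_one)
  qed (use L in auto)
  finally have "card S * (9 / 64) \<le> L ^ 4" by simp
  then have "card S \<le> 8 * L ^ 4" using L by (simp add: field_simps)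
  then show False using S(3) by (simp add: L_def)
qed

subsection \<open>Trigonometric polynomials\<close>

text \<open>These are the transforms of finitely supported functions, on whose coefficients conjugation
  acts by permutation. The square root of \<open>\<bar>f\<bar>\<close> has to be replaced by such a function.\<close>

definition trig_poly :: "(('g \<Rightarrow> complex) \<Rightarrow> complex) \<Rightarrow> bool"
  where "trig_poly F \<longleftrightarrow> (\<exists>S c. finite S \<and> S \<subseteq> carrier N \<and> (\<forall>\<theta>\<in>X. F \<theta> = (\<Sum>a\<in>S. c a * \<theta> a)))"

lemma trig_polyI:
  assumes I: "finite I" and p: "\<And>i. i \<in> I \<Longrightarrow> p i \<in> carrier N"
    and F: "\<And>\<theta>. \<theta> \<in> X \<Longrightarrow> F \<theta> = (\<Sum>i\<in>I. d i * \<theta> (p i))"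
  shows "trig_poly F"
proof -
  have "F \<theta> = (\<Sum>a\<in>p ` I. (\<Sum>i\<in>{i\<in>I. p i = a}. d i) * \<theta> a)" if \<theta>: "\<theta> \<in> X" for \<theta>
  proof -
    have "F \<theta> = (\<Sum>a\<in>p ` I. \<Sum>i\<in>{i\<in>I. p i = a}. d i * \<theta> (p i))"
      unfolding F[OF \<theta>] by (rule sum.image_gen[OF I])
    also have "\<dots> = (\<Sum>a\<in>p ` I. (\<Sum>i\<in>{i\<in>I. p i = a}. d i) * \<theta> a)"
      by (intro sum.cong refl) (simp add: sum_distrib_right)
    finally show ?thesis .
  qed
  moreover have "p ` I \<subseteq> carrier N" using p by auto
  ultimately show ?thesis unfolding trig_poly_def using I
    by (intro exI[of _ "p ` I"] exI[of _ "\<lambda>a. \<Sum>i\<in>{i\<in>I. p i = a}. d i"]) auto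
qed

lemma trig_poly_const: "trig_poly (\<lambda>\<theta>. c)"
  by (rule trig_polyI[of "{()}" "\<lambda>_. \<one>" _ "\<lambda>_. c"]) (auto simp: dual_inv(2)[OF N.group_axioms _ N.one_closed])

lemma trig_poly_add:
  assumes "trig_poly F" "trig_poly F'" shows "trig_poly (\<lambda>\<theta>. F \<theta> + F' \<theta>)"
proof -
  obtain S c S' c' where *: "finite S" "S \<subseteq> carrier N" "\<forall>\<theta>\<in>X. F \<theta> = (\<Sum>a\<in>S. c a * \<theta> a)"
    "finite S'" "S' \<subseteq> carrier N" "\<forall>\<theta>\<in>X. F' \<theta> = (\<Sum>a\<in>S'. c' a * \<theta> a)"
    using assms unfolding trig_poly_def by (elim exE conjE) rule
  show ?thesis
    by (rule trig_polyI[of "S <+> S'" "case_sum (\<lambda>a. a) (\<lambda>a. a)" _ "case_sum c c'"])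
      (use * in \<open>auto simp: sum.Plus\<close>)
qed

lemma trig_poly_mult:
  assumes "trig_poly F" "trig_poly F'" shows "trig_poly (\<lambda>\<theta>. F \<theta> * F' \<theta>)"
proof -
  obtain S c S' c' where *: "finite S" "S \<subseteq> carrier N" "\<forall>\<theta>\<in>X. F \<theta> = (\<Sum>a\<in>S. c a * \<theta> a)"
    "finite S'" "S' \<subseteq> carrier N" "\<forall>\<theta>\<in>X. F' \<theta> = (\<Sum>a\<in>S'. c' a * \<theta> a)"
    using assms unfolding trig_poly_def by (elim exE conjE) rule
  show ?thesis
  proof (rule trig_polyI[of "S \<times> S'" "\<lambda>x. fst x \<otimes> snd x" _ "\<lambda>x. c (fst x) * c' (snd x)"])
    fix \<theta> assume \<theta>: "\<theta> \<in> X"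
    have "F \<theta> * F' \<theta> = (\<Sum>a\<in>S. \<Sum>b\<in>S'. (c a * c' b) * (\<theta> a * \<theta> b))"
    proof -
      have "F \<theta> * F' \<theta> = (\<Sum>a\<in>S. c a * \<theta> a) * (\<Sum>b\<in>S'. c' b * \<theta> b)" using * \<theta> by simp
      also have "\<dots> = (\<Sum>a\<in>S. \<Sum>b\<in>S'. (c a * \<theta> a) * (c' b * \<theta> b))" by (rule sum_product)
      finally show ?thesis by (simp only: mult_ac)
    qed
    also have "\<dots> = (\<Sum>a\<in>S. \<Sum>b\<in>S'. (c a * c' b) * \<theta> (a \<otimes> b))"
      using * by (intro sum.cong refl) (simp add: dual_mult[OF \<theta>] subset_iff)
    finally show "F \<theta> * F' \<theta> = (\<Sum>x\<in>S \<times> S'. c (fst x) * c' (snd x) * \<theta> (fst x \<otimes> snd x))"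
      by (simp add: sum.cartesian_product')
  next
    show "fst x \<otimes> snd x \<in> carrier N" if "x \<in> S \<times> S'" for x
      using * that by (intro N.m_closed) (auto simp: subset_iff)
  qed (use * in auto)
qed

lemma trig_poly_cnj:
  assumes "trig_poly F" shows "trig_poly (\<lambda>\<theta>. cnj (F \<theta>))"
proof -
  obtain S c where *: "finite S" "S \<subseteq> carrier N" "\<forall>\<theta>\<in>X. F \<theta> = (\<Sum>a\<in>S. c a * \<theta> a)"
    using assms unfolding trig_poly_def by (elim exE conjE) rule
  show ?thesis
  proof (rule trig_polyI[of S "\<lambda>a. inv a" _ "\<lambda>a. cnj (c a)"])
    fix \<theta> assume \<theta>: "\<theta> \<in> X"
    show "cnj (F \<theta>) = (\<Sum>a\<in>S. cnj (c a) * \<theta> (inv a))"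
      using * \<theta> by (simp add: dual_inv(1)[OF N.group_axioms \<theta>] subset_iff)
  qed (use * in auto)
qed

lemma trig_poly_real_polynomial:
  fixes q :: "real \<Rightarrow> real"
  assumes q: "real_polynomial_function q" and F: "trig_poly (\<lambda>\<theta>. complex_of_real (F \<theta>))"
  shows "trig_poly (\<lambda>\<theta>. complex_of_real (q (F \<theta>)))"
  using q
proof induction
  case (linear f)
  then have "f x = x * f 1" for x using linear_scale[of f x 1] by (simp add: bounded_linear.linear)
  then have "complex_of_real (f (F \<theta>)) = complex_of_real (F \<theta>) * complex_of_real (f 1)" for \<theta>
    by (metis of_real_mult)
  then show ?case using trig_poly_mult[OF F trig_poly_const[of "complex_of_real (f 1)"]] by simp
next
  case (const c)
  show ?case by (rule trig_poly_const)
qed (simp_all add: trig_poly_add trig_poly_mult)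

lemma trig_poly_norm_square: "trig_poly F \<Longrightarrow> trig_poly (\<lambda>\<theta>. complex_of_real ((cmod (F \<theta>))\<^sup>2))"
  unfolding complex_norm_square by (rule trig_poly_mult[OF _ trig_poly_cnj])

end

text \<open>The function \<open>\<bar>f\<bar>\<close> need not be a trigonometric polynomial, but its square is one. So the square
  root of \<open>\<bar>f\<bar>\<close> is approximated as the fourth root of the square.\<close>

lemma sqrt_polynomial_approximation:
  assumes "e > 0"
  obtains q :: "real \<Rightarrow> real" where "real_polynomial_function q"
    "\<And>z::complex. cmod z \<le> R \<Longrightarrow> \<bar>q ((cmod z)\<^sup>2) - sqrt (cmod z)\<bar> \<le> e"
proof -
  have "continuous_on {0..R\<^sup>2} (\<lambda>t. sqrt (sqrt t))" by (intro continuous_intros)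
  then obtain q where q: "real_polynomial_function q" "\<And>t. t \<in> {0..R\<^sup>2} \<Longrightarrow> \<bar>sqrt (sqrt t) - q t\<bar> < e"
    using Stone_Weierstrass_real_polynomial_function[of "{0..R\<^sup>2}" "\<lambda>t. sqrt (sqrt t)" e] assms by auto
  have "\<bar>q ((cmod z)\<^sup>2) - sqrt (cmod z)\<bar> \<le> e" if "cmod z \<le> R" for z
    using q(2)[of "(cmod z)\<^sup>2"] power_mono[OF that, of 2] by (simp add: abs_minus_commute)
  then show ?thesis using q(1) that by blast
qed

section \<open>A conjugation invariant mean\<close>

locale normal_dual_mean = normal N G + dual: dual_mean "G\<lparr>carrier := N\<rparr>" M
  for N and G (structure) and M
begin

text \<open>Elements of \<open>N\<close> may stand to the right of \<open>x\<close> because \<open>N\<close> is normal.\<close>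

lemma left_invariant_normal:
  assumes K: "left_invariant G N K" and a: "a \<in> N" and x: "x \<in> carrier G" and gh: "g \<in> carrier G" "h \<in> carrier G"
  shows "K (Inl (x \<otimes> a \<otimes> g)) (Inl (x \<otimes> a \<otimes> h)) = K (Inl (x \<otimes> g)) (Inl (x \<otimes> h))"
    and "K (Inr (x \<otimes> a \<otimes> g)) (Inr (x \<otimes> a \<otimes> h)) = K (Inr (x \<otimes> g)) (Inr (x \<otimes> h))"
proof -
  have b: "x \<otimes> a \<otimes> inv x \<in> N" by (rule inv_op_closed2[OF x a])
  have aG: "a \<in> carrier G" using a by (rule mem_carrier)
  have "inv x \<otimes> (x \<otimes> g) = g" if "g \<in> carrier G" for g using that x by (simp flip: m_assoc)
  then have "x \<otimes> a \<otimes> inv x \<otimes> (x \<otimes> g) = x \<otimes> a \<otimes> g" if "g \<in> carrier G" for g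
    using that x aG by (simp add: m_assoc)
  note eq = this[OF gh(1)] this[OF gh(2)]
  have c: "x \<otimes> g \<in> carrier G" "x \<otimes> h \<in> carrier G" using x gh by auto
  note inv = K[unfolded left_invariant_def, rule_format, OF b]
  show "K (Inl (x \<otimes> a \<otimes> g)) (Inl (x \<otimes> a \<otimes> h)) = K (Inl (x \<otimes> g)) (Inl (x \<otimes> h))"
    using inv[of "Inl (x \<otimes> g)" "Inl (x \<otimes> h)"] c by (simp add: eq InlI)
  show "K (Inr (x \<otimes> a \<otimes> g)) (Inr (x \<otimes> a \<otimes> h)) = K (Inr (x \<otimes> g)) (Inr (x \<otimes> h))"
    using inv[of "Inr (x \<otimes> g)" "Inr (x \<otimes> h)"] c by (simp add: eq InrI)
qed

lemma inv_subgroup: "b \<in> N \<Longrightarrow> inv\<^bsub>G\<lparr>carrier := N\<rparr>\<^esub> b = inv b"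
  using m_inv_consistent[OF subgroup_axioms] .

text \<open>Conjugation takes two steps: translation by \<open>g\<close> on the right, which is controlled by the vectors
  on one side, and translation by the inverse of \<open>g\<close> on the left, which is controlled by the vectors
  on the other side. As the functions on \<open>N\<close> do not depend on the points \<open>x\<close> and \<open>y\<close> at which the
  vectors are taken, these points may differ.\<close>

lemma transform_almost_invariant:
  assumes K: "schur_kernel G \<phi> 1 c K" and inv: "left_invariant G N K"
    and x: "x \<in> carrier G" and y: "y \<in> carrier G" and g: "g \<in> carrier G" and u: "u > 0"
    and dx: "kernel_dist K (Inl (x \<otimes> g)) (Inl x) \<le> u\<^sup>2" and dy: "kernel_dist K (Inr (y \<otimes> g)) (Inr y) \<le> u\<^sup>2"
    and A: "finite A" "A \<subseteq> N"
    and supp: "\<And>a. a \<in> N \<Longrightarrow> a \<notin> A \<Longrightarrow> \<phi> a = 0 \<and> \<phi> (a \<otimes> g) = 0 \<and> \<phi> (inv g \<otimes> a \<otimes> g) = 0"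
  shows "M (\<lambda>\<theta>. cmod ((\<Sum>a\<in>A. \<phi> (inv g \<otimes> a \<otimes> g) * \<theta> a) - (\<Sum>a\<in>A. \<phi> a * \<theta> a))) \<le> u * (2 + c)"
proof -
  have posK: "pos_kernel K" using K by (simp add: schur_kernel_def)
  have dl: "Re (K (Inl z) (Inl z)) \<le> 1" and dr: "Re (K (Inr z) (Inr z)) \<le> c" if "z \<in> carrier G" for z
    using K that by (auto simp: schur_kernel_def)
  have cross: "K (Inl z) (Inr z') = \<phi> (inv z' \<otimes> z)" if "z \<in> carrier G" "z' \<in> carrier G" for z z'
    using K that by (auto simp: schur_kernel_def)
  have quot: "inv (z \<otimes> b \<otimes> h) \<otimes> (z \<otimes> a \<otimes> g') = inv h \<otimes> (inv b \<otimes> a) \<otimes> g'"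
    if "z \<in> carrier G" "a \<in> carrier G" "b \<in> carrier G" "h \<in> carrier G" "g' \<in> carrier G" for z a b h g'
  proof -
    have "inv z \<otimes> (z \<otimes> (a \<otimes> g')) = a \<otimes> g'" using that by (simp flip: m_assoc)
    then show ?thesis using that by (simp add: inv_mult_group m_assoc)
  qed
  define J where "J = {True, False}"
  define D1 where "D1 a = \<phi> (a \<otimes> g) - \<phi> a" for a
  define D2 where "D2 a = \<phi> (inv g \<otimes> a \<otimes> g) - \<phi> (a \<otimes> g)" for a
  \<comment> \<open>Represented by the differences of \<open>\<xi> (x \<otimes> a \<otimes> g)\<close> and \<open>\<xi> (x \<otimes> a)\<close>, paired with \<open>\<eta> (x \<otimes> b)\<close>.\<close>
  have 1: "M (\<lambda>\<theta>. cmod (\<Sum>a\<in>A. D1 a * \<theta> a)) \<le> (u\<^sup>2 / u + u * c) / 2"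
  proof -
    define w :: "'a + 'a \<Rightarrow> bool \<Rightarrow> complex" where "w = case_sum (\<lambda>a j. if j then 1 else - 1 :: complex) (\<lambda>b j. if j then 1 else 0)"
    define p where "p = case_sum (\<lambda>a j. Inl (if j then x \<otimes> a \<otimes> g else x \<otimes> a \<otimes> \<one>)) (\<lambda>b j. Inr (x \<otimes> b \<otimes> \<one>))"
    define L where "L s t = (\<Sum>j\<in>J. \<Sum>k\<in>J. w s j * cnj (w t k) * K (p s j) (p t k))" for s t
    show ?thesis
    proof (rule dual.mean_norm_transform_le[of L])
      show "pos_kernel L" unfolding L_def by (rule pos_kernel_pullback[OF posK]) (simp add: J_def)
      show "L (Inl a) (Inr b) = D1 (inv\<^bsub>G\<lparr>carrier := N\<rparr>\<^esub> b \<otimes>\<^bsub>G\<lparr>carrier := N\<rparr>\<^esub> a)"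
        if "a \<in> carrier (G\<lparr>carrier := N\<rparr>)" "b \<in> carrier (G\<lparr>carrier := N\<rparr>)" for a b
      proof -
        have ab: "a \<in> N" "b \<in> N" "a \<in> carrier G" "b \<in> carrier G" using that mem_carrier by auto
        then have "L (Inl a) (Inr b) = \<phi> (inv (x \<otimes> b \<otimes> \<one>) \<otimes> (x \<otimes> a \<otimes> g)) - \<phi> (inv (x \<otimes> b \<otimes> \<one>) \<otimes> (x \<otimes> a \<otimes> \<one>))"
          using x g by (simp add: L_def J_def w_def p_def cross)
        then show ?thesis using ab x g by (simp only: quot one_closed) (simp add: D1_def inv_subgroup)
      qed
      show "Re (L (Inl a) (Inl a)) \<le> u\<^sup>2" if "a \<in> carrier (G\<lparr>carrier := N\<rparr>)" for a
      proof -
        have a: "a \<in> N" using that by simp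
        have "Re (L (Inl a) (Inl a)) = kernel_dist K (Inl (x \<otimes> g)) (Inl (x \<otimes> \<one>))"
          by (simp add: L_def J_def w_def p_def kernel_dist_def left_invariant_normal[OF inv a x] g del: r_one)
        then show ?thesis using dx x by simp
      qed
      show "Re (L (Inr a) (Inr a)) \<le> c" if "a \<in> carrier (G\<lparr>carrier := N\<rparr>)" for a
        using that dr[of "x \<otimes> a"] x mem_carrier[of a] by (simp add: L_def J_def w_def p_def)
    qed (use A u supp in \<open>auto simp: D1_def\<close>)
  qed
  \<comment> \<open>Represented by \<open>\<xi> (y \<otimes> a \<otimes> g)\<close>, paired with the differences of \<open>\<eta> (y \<otimes> b \<otimes> g)\<close> and \<open>\<eta> (y \<otimes> b)\<close>.\<close>
  have 2: "M (\<lambda>\<theta>. cmod (\<Sum>a\<in>A. D2 a * \<theta> a)) \<le> (1 / (1 / u) + 1 / u * u\<^sup>2) / 2"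
  proof -
    define w :: "'a + 'a \<Rightarrow> bool \<Rightarrow> complex" where "w = case_sum (\<lambda>b j. if j then 1 else 0) (\<lambda>a j. if j then 1 else - 1 :: complex)"
    define p where "p = case_sum (\<lambda>b j. Inl (y \<otimes> b \<otimes> g)) (\<lambda>a j. Inr (if j then y \<otimes> a \<otimes> g else y \<otimes> a \<otimes> \<one>))"
    define L where "L s t = (\<Sum>j\<in>J. \<Sum>k\<in>J. w s j * cnj (w t k) * K (p s j) (p t k))" for s t
    show ?thesis
    proof (rule dual.mean_norm_transform_le[of L])
      show "pos_kernel L" unfolding L_def by (rule pos_kernel_pullback[OF posK]) (simp add: J_def)
      show "L (Inl a) (Inr b) = D2 (inv\<^bsub>G\<lparr>carrier := N\<rparr>\<^esub> b \<otimes>\<^bsub>G\<lparr>carrier := N\<rparr>\<^esub> a)"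
        if "a \<in> carrier (G\<lparr>carrier := N\<rparr>)" "b \<in> carrier (G\<lparr>carrier := N\<rparr>)" for a b
      proof -
        have ab: "a \<in> N" "b \<in> N" "a \<in> carrier G" "b \<in> carrier G" using that mem_carrier by auto
        then have "L (Inl a) (Inr b) = \<phi> (inv (y \<otimes> b \<otimes> g) \<otimes> (y \<otimes> a \<otimes> g)) - \<phi> (inv (y \<otimes> b \<otimes> \<one>) \<otimes> (y \<otimes> a \<otimes> g))"
          using y g by (simp add: L_def J_def w_def p_def cross)
        then show ?thesis using ab y g by (simp only: quot one_closed) (simp add: D2_def inv_subgroup)
      qed
      show "Re (L (Inr a) (Inr a)) \<le> u\<^sup>2" if "a \<in> carrier (G\<lparr>carrier := N\<rparr>)" for a
      proof -
        have a: "a \<in> N" using that by simp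
        have "Re (L (Inr a) (Inr a)) = kernel_dist K (Inr (y \<otimes> g)) (Inr (y \<otimes> \<one>))"
          by (simp add: L_def J_def w_def p_def kernel_dist_def left_invariant_normal[OF inv a y] g del: r_one)
        then show ?thesis using dy y by simp
      qed
      show "Re (L (Inl a) (Inl a)) \<le> 1" if "a \<in> carrier (G\<lparr>carrier := N\<rparr>)" for a
        using that dl[of "y \<otimes> a \<otimes> g"] y g mem_carrier[of a] by (simp add: L_def J_def w_def p_def)
    qed (use A u supp in \<open>auto simp: D2_def\<close>)
  qed
  have b: "bounded ((\<lambda>\<theta>. cmod (\<Sum>a\<in>A. D a * \<theta> a)) ` dual.X)" for D
    by (rule bounded_fun_norm) (rule dual.bounded_trig)
  have split: "(\<Sum>a\<in>A. \<phi> (inv g \<otimes> a \<otimes> g) * \<theta> a) - (\<Sum>a\<in>A. \<phi> a * \<theta> a) = (\<Sum>a\<in>A. D1 a * \<theta> a) + (\<Sum>a\<in>A. D2 a * \<theta> a)" for \<theta>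
    by (simp add: D1_def D2_def left_diff_distrib flip: sum.distrib sum_subtractf)
  have "M (\<lambda>\<theta>. cmod ((\<Sum>a\<in>A. \<phi> (inv g \<otimes> a \<otimes> g) * \<theta> a) - (\<Sum>a\<in>A. \<phi> a * \<theta> a)))
      \<le> M (\<lambda>\<theta>. cmod (\<Sum>a\<in>A. D1 a * \<theta> a) + cmod (\<Sum>a\<in>A. D2 a * \<theta> a))"
    unfolding split
    by (rule dual.mono[OF _ bounded_fun_add[OF b b]])
      (auto intro!: norm_triangle_ineq bounded_fun_norm bounded_fun_add dual.bounded_trig)
  also have "\<dots> = M (\<lambda>\<theta>. cmod (\<Sum>a\<in>A. D1 a * \<theta> a)) + M (\<lambda>\<theta>. cmod (\<Sum>a\<in>A. D2 a * \<theta> a))"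
    by (rule dual.add[OF b b])
  also have "\<dots> \<le> (u\<^sup>2 / u + u * c) / 2 + (1 / (1 / u) + 1 / u * u\<^sup>2) / 2" by (rule add_mono[OF 1 2])
  also have "\<dots> = u * (3 + c) / 2" using u by (simp add: field_simps power2_eq_square)
  also have "\<dots> \<le> u * (2 + c)"
  proof -
    have "0 \<le> c" using pos_kernel_diag[OF posK, of "Inr x"] dr[OF x] by linarith
    then show ?thesis using u by (simp add: field_simps)
  qed
  finally show ?thesis .
qed

lemma transform_norm_le:
  assumes K: "schur_kernel G \<phi> 1 c K" and A: "finite A" "A \<subseteq> N" "\<And>a. a \<in> N \<Longrightarrow> a \<notin> A \<Longrightarrow> \<phi> a = 0"
  shows "M (\<lambda>\<theta>. cmod (\<Sum>a\<in>A. \<phi> a * \<theta> a)) \<le> (1 + c) / 2"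
  using dual.mean_norm_transform_le[of K A \<phi> 1 c 1] A K mem_carrier
  by (simp add: schur_kernel_def inv_subgroup)

definition conj_char :: "'a \<Rightarrow> ('a \<Rightarrow> complex) \<Rightarrow> 'a \<Rightarrow> complex"
  where "conj_char g \<theta> a = (if a \<in> N then \<theta> (g \<otimes> a \<otimes> inv g) else 1)"

lemma conj_mult: "\<lbrakk>g \<in> carrier G; a \<in> carrier G; b \<in> carrier G\<rbrakk> \<Longrightarrow>
    g \<otimes> (a \<otimes> b) \<otimes> inv g = (g \<otimes> a \<otimes> inv g) \<otimes> (g \<otimes> b \<otimes> inv g)"
proof -
  assume c: "g \<in> carrier G" "a \<in> carrier G" "b \<in> carrier G"
  have "inv g \<otimes> (g \<otimes> (b \<otimes> inv g)) = b \<otimes> inv g" using c by (simp flip: m_assoc)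
  then show ?thesis using c by (simp add: m_assoc)
qed

lemma conj_inv: "\<lbrakk>g \<in> carrier G; a \<in> carrier G\<rbrakk> \<Longrightarrow> g \<otimes> (inv g \<otimes> a \<otimes> g) \<otimes> inv g = a"
  "\<lbrakk>g \<in> carrier G; a \<in> carrier G\<rbrakk> \<Longrightarrow> inv g \<otimes> (g \<otimes> a \<otimes> inv g) \<otimes> g = a"
proof -
  assume c: "g \<in> carrier G" "a \<in> carrier G"
  have "g \<otimes> (inv g \<otimes> a) = a" "inv g \<otimes> (g \<otimes> a) = a" using c by (simp_all flip: m_assoc)
  then show "g \<otimes> (inv g \<otimes> a \<otimes> g) \<otimes> inv g = a" "inv g \<otimes> (g \<otimes> a \<otimes> inv g) \<otimes> g = a"
    using c by (simp_all add: m_assoc)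
qed

lemma conj_char_dual: "g \<in> carrier G \<Longrightarrow> \<theta> \<in> dual.X \<Longrightarrow> conj_char g \<theta> \<in> dual.X"
  using inv_op_closed2[of g] mem_carrier
  by (auto simp: dual_def conj_char_def conj_mult m_closed)

lemma sum_conj_char:
  assumes g: "g \<in> carrier G" and S: "S \<subseteq> N"
  shows "(\<Sum>a\<in>S. c a * conj_char g \<theta> a) = (\<Sum>b\<in>(\<lambda>a. g \<otimes> a \<otimes> inv g) ` S. c (inv g \<otimes> b \<otimes> g) * \<theta> b)"
proof -
  have SG: "a \<in> carrier G" if "a \<in> S" for a using that S mem_carrier by auto
  have inj: "inj_on (\<lambda>a. g \<otimes> a \<otimes> inv g) S"
    by (rule inj_on_inverseI[of _ "\<lambda>b. inv g \<otimes> b \<otimes> g"]) (use conj_inv(2)[OF g] SG in auto)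
  show ?thesis
    unfolding sum.reindex[OF inj] comp_def
    using conj_inv(2)[OF g] SG S by (intro sum.cong refl) (auto simp: conj_char_def)
qed

end

lemma abs_sqrt_diff_square_le:
  fixes s t :: real
  assumes "0 \<le> s" "0 \<le> t"
  shows "(sqrt s - sqrt t)\<^sup>2 \<le> \<bar>s - t\<bar>"
proof -
  have "(sqrt s - sqrt t)\<^sup>2 = \<bar>sqrt s - sqrt t\<bar> * \<bar>sqrt s - sqrt t\<bar>" by (simp add: power2_eq_square)
  also have "\<dots> \<le> \<bar>sqrt s - sqrt t\<bar> * \<bar>sqrt s + sqrt t\<bar>"
    using assms by (intro mult_left_mono) (auto simp: abs_le_iff)
  also have "\<dots> = \<bar>s - t\<bar>"
  proof -
    have "(sqrt s - sqrt t) * (sqrt s + sqrt t) = s - t" using assms by (simp add: algebra_simps)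
    then show ?thesis by (simp only: abs_mult[symmetric])
  qed
  finally show ?thesis .
qed

lemma norm_square_diff_le:
  fixes z w :: complex
  assumes t: "t > 0"
  shows "\<bar>(cmod z)\<^sup>2 - (cmod w)\<^sup>2\<bar> \<le> (cmod (z - w))\<^sup>2 / (2 * t) + t * ((cmod z)\<^sup>2 + (cmod w)\<^sup>2)"
proof -
  define d where "d = cmod (z - w)"
  define s where "s = cmod z + cmod w"
  have "\<bar>(cmod z)\<^sup>2 - (cmod w)\<^sup>2\<bar> = \<bar>cmod z - cmod w\<bar> * s"
    unfolding power2_eq_square square_diff_square_factored abs_mult s_def by simp
  also have "\<dots> \<le> d * s" unfolding d_def s_def by (intro mult_right_mono norm_triangle_ineq3) auto
  also have "\<dots> \<le> d\<^sup>2 / (2 * t) + t / 2 * s\<^sup>2"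
  proof -
    have "0 \<le> (d - t * s)\<^sup>2 / (2 * t)" using t by simp
    also have "\<dots> = d\<^sup>2 / (2 * t) + t / 2 * s\<^sup>2 - d * s"
      using t by (simp add: power2_eq_square field_simps)
    finally show ?thesis by simp
  qed
  also have "t / 2 * s\<^sup>2 \<le> t / 2 * (2 * ((cmod z)\<^sup>2 + (cmod w)\<^sup>2))"
  proof (intro mult_left_mono)
    have "0 \<le> (cmod z - cmod w)\<^sup>2" by simp
    then show "s\<^sup>2 \<le> 2 * ((cmod z)\<^sup>2 + (cmod w)\<^sup>2)" by (simp add: s_def power2_eq_square algebra_simps)
  qed (use t in simp)
  finally show ?thesis unfolding d_def by (simp add: algebra_simps)
qed

context normal_dual_mean
begin

text \<open>Let \<open>f\<close> be the transform on \<open>N\<close> of a function \<open>\<phi>\<close> with almost invariant kernel. Conjugating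
  \<open>\<phi>\<close> changes \<open>\<bar>f\<bar>\<close> little in \<open>L\<^sup>1\<close>, hence \<open>sqrt \<bar>f\<bar>\<close> little in \<open>L\<^sup>2\<close>, hence by Parseval its Fourier
  coefficients little in \<open>\<ell>\<^sup>2\<close>. Their squares are therefore the weights of an almost invariant mean.
  Conjugation fixes the coefficient at \<open>\<one>\<close>, which can be removed: the remaining mass is the variance
  of \<open>sqrt \<bar>f\<bar>\<close>, bounded below because \<open>\<phi>\<close> is close to \<open>1\<close> at many points of \<open>N\<close>.\<close>

lemma approximately_conjugation_invariant_mean:
  assumes approx: "kernel_approximable G c0" and inf: "infinite N"
    and E: "finite E" "E \<subseteq> carrier G" and e: "e > 0"
  shows "\<exists>m. mean (N - {\<one>}) m \<and> (\<forall>g\<in>E. \<forall>f. (\<forall>t\<in>N - {\<one>}. \<bar>f t\<bar> \<le> 1) \<longrightarrow>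
    \<bar>m (\<lambda>a. f (g \<otimes> a \<otimes> inv g)) - m f\<bar> \<le> e)"
proof -
  note b_simps = dual.bounded_trig
  obtain c where c: "c > 0" and ker: "\<And>E S e. \<lbrakk>finite E; E \<subseteq> carrier G; finite S; S \<subseteq> carrier G; e > 0\<rbrakk> \<Longrightarrow>
    \<exists>\<phi> K x y. finite {x\<in>carrier G. \<phi> x \<noteq> 0} \<and> (\<forall>x\<in>S. cmod (\<phi> x - 1) \<le> e) \<and>
      schur_kernel G \<phi> 1 c K \<and> left_invariant G N K \<and> x \<in> carrier G \<and> y \<in> carrier G \<and>
      (\<forall>g\<in>E. kernel_dist K (Inl (x \<otimes> g)) (Inl x) \<le> e \<and> kernel_dist K (Inr (y \<otimes> g)) (Inr y) \<le> e)"
    using almost_invariant_kernels[OF group_axioms approx subgroup_axioms dual.N.comm_group_axioms] by blast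
  define B where "B = (1 + c) / 2"
  have B: "B \<ge> 0" using c by (simp add: B_def)
  \<comment> \<open>The variance of \<open>sqrt \<bar>f\<bar>\<close> will be at least \<open>v\<close>, and conjugation by elements of \<open>E\<close> will change
    \<open>f\<close> in \<open>L\<^sup>1\<close> by at most \<open>u * (2 + c)\<close>; \<open>r\<close> is the error of the polynomial approximation.\<close>
  define v where "v = 1 / (272 * (1 + B)\<^sup>2)"
  have v: "v > 0" using B by (simp add: v_def add_nonneg_pos)
  define u where "u = e\<^sup>2 * v / (64 * (2 + c))"
  have u: "u > 0" "u * (2 + c) = e\<^sup>2 * v / 64"
  proof -
    have "2 + c \<noteq> 0" using c by simp
    from mult_divide_mult_cancel_right[OF this, of "e\<^sup>2 * v" 64] show "u * (2 + c) = e\<^sup>2 * v / 64"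
      by (simp only: u_def times_divide_eq_left)
  qed (use e v c in \<open>simp add: u_def\<close>)
  define r where "r = sqrt (min (1 / 4) (min (v / 4) (e\<^sup>2 * v / 256)))"
  have "0 < min (1 / 4) (min (v / 4) (e\<^sup>2 * v / 256))" using e v by simp
  then have r: "r > 0" "r\<^sup>2 = min (1 / 4) (min (v / 4) (e\<^sup>2 * v / 256))" by (simp_all add: r_def)
  have r2: "r \<le> 1 / 2" "r\<^sup>2 \<le> v / 4" "8 * r\<^sup>2 \<le> e\<^sup>2 * v / 32"
  proof -
    have "r\<^sup>2 \<le> (1 / 2)\<^sup>2" using r(2) by (simp add: power_divide)
    then show "r \<le> 1 / 2" by (rule power2_le_imp_le) simp
  qed (use r(2) in auto)

  obtain S0 where S0: "finite S0" "S0 \<subseteq> N" "card S0 = nat \<lceil>8 * (1 + B) ^ 4\<rceil> + 1"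
    using infinite_arbitrarily_large[OF inf, of "nat \<lceil>8 * (1 + B) ^ 4\<rceil> + 1"] by blast
  have S0c: "8 * (1 + B) ^ 4 < real (card S0)" unfolding S0(3) by linarith
  have "min (1 / 2) (u\<^sup>2) > 0" using u by simp
  from ker[OF E S0(1) subset_trans[OF S0(2) subset] this] obtain \<phi> K x y where
    fin: "finite {x\<in>carrier G. \<phi> x \<noteq> 0}" and near: "\<forall>x\<in>S0. cmod (\<phi> x - 1) \<le> min (1 / 2) (u\<^sup>2)"
    and K: "schur_kernel G \<phi> 1 c K" and inv: "left_invariant G N K" and xy: "x \<in> carrier G" "y \<in> carrier G"
    and dist: "\<forall>g\<in>E. kernel_dist K (Inl (x \<otimes> g)) (Inl x) \<le> min (1 / 2) (u\<^sup>2) \<and>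
      kernel_dist K (Inr (y \<otimes> g)) (Inr y) \<le> min (1 / 2) (u\<^sup>2)"
    by (elim exE conjE)

  define E' where "E' = insert \<one> E"
  have E': "finite E'" "E' \<subseteq> carrier G" using E by (auto simp: E'_def)
  define A where "A = N \<inter> {x\<in>carrier G. \<exists>g\<in>E'. \<exists>h\<in>E'. \<phi> (inv h \<otimes> x \<otimes> g) \<noteq> 0}"
  have A: "finite A" "A \<subseteq> N"
    using finite_translated_support[OF fin E'] by (auto simp: A_def)
  have suppA: "\<phi> (inv h \<otimes> a \<otimes> g) = 0" if "a \<in> N" "a \<notin> A" "g \<in> E'" "h \<in> E'" for a g h
    using that mem_carrier by (auto simp: A_def)
  have suppA1: "\<phi> a = 0" if "a \<in> N" "a \<notin> A" for a
    using suppA[OF that, of \<one> \<one>] that mem_carrier by (simp add: E'_def)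
  define f where "f \<theta> = (\<Sum>a\<in>A. \<phi> a * \<theta> a)" for \<theta>
  have bf: "bounded (f ` dual.X)" unfolding f_def by (rule b_simps)
  have bcf: "bounded ((\<lambda>\<theta>. cmod (f \<theta>)) ` dual.X)" by (rule bounded_fun_norm[OF bf])
  have MB: "M (\<lambda>\<theta>. cmod (f \<theta>)) \<le> B"
    unfolding f_def B_def by (rule transform_norm_le[OF K A]) (rule suppA1)
  have fg: "f (conj_char g \<theta>) = (\<Sum>a\<in>A. \<phi> (inv g \<otimes> a \<otimes> g) * \<theta> a)" if g: "g \<in> E" for g \<theta>
  proof -
    have gG: "g \<in> carrier G" "g \<in> E'" using g E by (auto simp: E'_def)
    define A1 where "A1 = {a\<in>N. \<phi> (inv g \<otimes> a \<otimes> g) \<noteq> 0}"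
    define gA where "gA = (\<lambda>a. g \<otimes> a \<otimes> inv g) ` A"
    have "f (conj_char g \<theta>) = (\<Sum>b\<in>gA. \<phi> (inv g \<otimes> b \<otimes> g) * \<theta> b)"
      unfolding f_def gA_def by (rule sum_conj_char[OF gG(1) A(2)])
    also have "\<dots> = (\<Sum>b\<in>A1. \<phi> (inv g \<otimes> b \<otimes> g) * \<theta> b)"
    proof (rule sum.mono_neutral_right)
      show "finite gA" using A by (simp add: gA_def)
      have gAN: "gA \<subseteq> N" using A inv_op_closed2[OF gG(1)] by (auto simp: gA_def)
      show "A1 \<subseteq> gA"
      proof
        fix b assume "b \<in> A1"
        then have b: "b \<in> N" "\<phi> (inv g \<otimes> b \<otimes> g) \<noteq> 0" by (auto simp: A1_def)
        have "inv g \<otimes> b \<otimes> g \<in> A" using suppA1 b inv_op_closed1[OF gG(1) b(1)] by blast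
        then show "b \<in> gA" unfolding gA_def using conj_inv(1)[OF gG(1)] mem_carrier[OF b(1)]
          by (intro image_eqI[of _ _ "inv g \<otimes> b \<otimes> g"]) auto
      qed
      show "\<forall>b\<in>gA - A1. \<phi> (inv g \<otimes> b \<otimes> g) * \<theta> b = 0" using gAN by (auto simp: A1_def)
    qed
    also have "\<dots> = (\<Sum>a\<in>A. \<phi> (inv g \<otimes> a \<otimes> g) * \<theta> a)"
    proof (rule sum.mono_neutral_left[OF A(1)])
      show "A1 \<subseteq> A" using suppA gG(2) by (auto simp: A1_def)
      show "\<forall>b\<in>A - A1. \<phi> (inv g \<otimes> b \<otimes> g) * \<theta> b = 0" using A by (auto simp: A1_def)
    qed
    finally show ?thesis .
  qed
  have Mfg: "M (\<lambda>\<theta>. cmod (f (conj_char g \<theta>) - f \<theta>)) \<le> e\<^sup>2 * v / 64" if g: "g \<in> E" for g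
  proof -
    have gG: "g \<in> carrier G" "g \<in> E'" "\<one> \<in> E'" using g E by (auto simp: E'_def)
    have "M (\<lambda>\<theta>. cmod ((\<Sum>a\<in>A. \<phi> (inv g \<otimes> a \<otimes> g) * \<theta> a) - (\<Sum>a\<in>A. \<phi> a * \<theta> a))) \<le> u * (2 + c)"
    proof (rule transform_almost_invariant[OF K inv xy gG(1) u(1) _ _ A])
      show "kernel_dist K (Inl (x \<otimes> g)) (Inl x) \<le> u\<^sup>2" "kernel_dist K (Inr (y \<otimes> g)) (Inr y) \<le> u\<^sup>2"
        using dist g by auto
      show "\<phi> a = 0 \<and> \<phi> (a \<otimes> g) = 0 \<and> \<phi> (inv g \<otimes> a \<otimes> g) = 0" if "a \<in> N" "a \<notin> A" for a
        using suppA1[OF that] suppA[OF that gG(2,3)] suppA[OF that gG(2,2)] mem_carrier[OF that(1)] gG(1) by simp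
    qed
    then show ?thesis using g by (simp only: fg u(2)) (simp add: f_def)
  qed

  obtain R where R: "\<And>\<theta>. \<theta> \<in> dual.X \<Longrightarrow> cmod (f \<theta>) \<le> R" using bf by (auto simp: bounded_iff)
  obtain q :: "real \<Rightarrow> real" where q: "real_polynomial_function q"
    and qR: "\<And>z::complex. cmod z \<le> R \<Longrightarrow> \<bar>q ((cmod z)\<^sup>2) - sqrt (cmod z)\<bar> \<le> r"
    using sqrt_polynomial_approximation[OF r(1)] by blast
  define z where "z \<theta> = q ((cmod (f \<theta>))\<^sup>2)" for \<theta>
  have zr: "\<bar>z \<theta> - sqrt (cmod (f \<theta>))\<bar> \<le> r" if "\<theta> \<in> dual.X" for \<theta>
    unfolding z_def by (rule qR[OF R[OF that]])
  have "dual.trig_poly f" unfolding f_def dual.trig_poly_def using A by auto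
  then have "dual.trig_poly (\<lambda>\<theta>. complex_of_real (z \<theta>))"
    unfolding z_def by (intro dual.trig_poly_real_polynomial[OF q] dual.trig_poly_norm_square)
  then obtain T d where T: "finite T" "T \<subseteq> N" "\<forall>\<theta>\<in>dual.X. complex_of_real (z \<theta>) = (\<Sum>a\<in>T. d a * \<theta> a)"
    unfolding dual.trig_poly_def by auto
  define S where "S = insert \<one> T"
  define co where "co a = (if a \<in> T then d a else 0)" for a
  have S: "finite S" "S \<subseteq> N" "\<one> \<in> S" using T by (auto simp: S_def)
  have co0: "co a = 0" if "a \<notin> S" for a using that by (auto simp: S_def co_def)
  have zS: "complex_of_real (z \<theta>) = (\<Sum>a\<in>S. co a * \<theta> a)" if "\<theta> \<in> dual.X" for \<theta>
  proof -
    have "(\<Sum>a\<in>S. co a * \<theta> a) = (\<Sum>a\<in>T. co a * \<theta> a)"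
      by (rule sum.mono_neutral_right) (use T in \<open>auto simp: S_def co_def\<close>)
    also have "\<dots> = (\<Sum>a\<in>T. d a * \<theta> a)" by (intro sum.cong) (auto simp: co_def)
    finally show ?thesis using T(3) that by simp
  qed
  have bz: "bounded (z ` dual.X)"
  proof -
    have "bounded ((\<lambda>\<theta>. \<Sum>a\<in>S. co a * \<theta> a) ` dual.X)" by (rule b_simps)
    then show ?thesis by (rule bounded_fun_le) (metis norm_of_real order_refl real_norm_def zS)
  qed
  have bsq: "bounded ((\<lambda>\<theta>. sqrt (cmod (f \<theta>))) ` dual.X)"
    by (rule bounded_fun_leI[of _ _ "sqrt R"]) (use R in simp)

  \<comment> \<open>The coefficient at \<open>\<one>\<close> is the mean value of \<open>z\<close>, so the other coefficients carry the variance.\<close>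
  define k where "k = M z"
  have co1: "co \<one> = of_real k"
  proof -
    have "co \<one> = dual.cmean (\<lambda>\<theta>. (\<Sum>a\<in>S. co a * \<theta> a) * cnj (\<theta> \<one>))"
      using dual.cmean_trig_coeff[of S \<one> co] S by simp
    also have "\<dots> = dual.cmean (\<lambda>\<theta>. complex_of_real (z \<theta>))"
    proof (rule dual.cmean_cong)
      show "bounded ((\<lambda>\<theta>. (\<Sum>a\<in>S. co a * \<theta> a) * cnj (\<theta> \<one>)) ` dual.X)"
        by (rule bounded_fun_mult[OF b_simps dual.bounded_cnj_char])
      show "(\<Sum>a\<in>S. co a * \<theta> a) * cnj (\<theta> \<one>) = complex_of_real (z \<theta>)" if \<theta>: "\<theta> \<in> dual.X" for \<theta>
        using zS[OF \<theta>] dual_inv(2)[OF dual.N.group_axioms \<theta>, of \<one>] S by auto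
    qed
    finally show ?thesis by (simp add: k_def dual.cmean_of_real)
  qed
  have kB: "\<bar>k\<bar> \<le> 1 + B"
  proof -
    have "\<bar>k\<bar> \<le> M (\<lambda>\<theta>. 1 + 1 / 2 * cmod (f \<theta>))"
      unfolding k_def
    proof (rule dual.abs_le[OF bz bounded_fun_add[OF bounded_fun_const bounded_fun_mult[OF bounded_fun_const bcf]]])
      fix \<theta> assume "\<theta> \<in> dual.X"
      have "0 \<le> (sqrt (cmod (f \<theta>)) - 1)\<^sup>2" by simp
      then have "2 * sqrt (cmod (f \<theta>)) \<le> cmod (f \<theta>) + 1" by (simp add: power2_diff)
      moreover have "0 \<le> sqrt (cmod (f \<theta>))" by simp
      ultimately show "\<bar>z \<theta>\<bar> \<le> 1 + 1 / 2 * cmod (f \<theta>)" using zr[OF \<open>\<theta> \<in> dual.X\<close>] r2(1) by linarith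
    qed
    also have "\<dots> = 1 + 1 / 2 * M (\<lambda>\<theta>. cmod (f \<theta>))"
      by (simp only: dual.add[OF bounded_fun_const bounded_fun_mult[OF bounded_fun_const bcf]] dual.const dual.scale[OF bcf])
    finally show ?thesis using MB B by linarith
  qed

  define V where "V = (\<Sum>a\<in>S - {\<one>}. (cmod (co a))\<^sup>2)"
  have bzk: "bounded ((\<lambda>\<theta>. (z \<theta> - k)\<^sup>2) ` dual.X)"
    by (rule bounded_fun_power[OF bounded_fun_diff[OF bz bounded_fun_const]])
  have Vz: "V = M (\<lambda>\<theta>. (z \<theta> - k)\<^sup>2)"
  proof -
    have "V = M (\<lambda>\<theta>. (cmod (\<Sum>a\<in>S - {\<one>}. co a * \<theta> a))\<^sup>2)"
      unfolding V_def using S by (intro dual.parseval[symmetric]) auto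
    also have "\<dots> = M (\<lambda>\<theta>. (z \<theta> - k)\<^sup>2)"
    proof (rule dual.cong)
      show "bounded ((\<lambda>\<theta>. (cmod (\<Sum>a\<in>S - {\<one>}. co a * \<theta> a))\<^sup>2) ` dual.X)"
        by (intro bounded_fun_power bounded_fun_norm b_simps)
      fix \<theta> assume \<theta>: "\<theta> \<in> dual.X"
      have "(\<Sum>a\<in>S. co a * \<theta> a) = co \<one> * \<theta> \<one> + (\<Sum>a\<in>S - {\<one>}. co a * \<theta> a)"
        by (rule sum.remove[OF S(1,3)])
      moreover have "\<theta> \<one> = 1" using dual_inv(2)[OF dual.N.group_axioms \<theta>, of \<one>] S by auto
      ultimately have "(\<Sum>a\<in>S - {\<one>}. co a * \<theta> a) = complex_of_real (z \<theta> - k)"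
        using zS[OF \<theta>] co1 by simp
      then show "(cmod (\<Sum>a\<in>S - {\<one>}. co a * \<theta> a))\<^sup>2 = (z \<theta> - k)\<^sup>2" by (simp only: norm_of_real power2_abs)
    qed
    finally show ?thesis .
  qed
  have V: "v / 4 \<le> V"
  proof -
    have "v \<le> M (\<lambda>\<theta>. (sqrt (cmod (f \<theta>)) - k)\<^sup>2)"
      unfolding v_def
    proof (rule dual.variance_sqrt_norm_ge[OF bf MB B S0(1) _ S0c _ kB])
      show "S0 \<subseteq> carrier (G\<lparr>carrier := N\<rparr>)" using S0 by simp
      fix a assume a: "a \<in> S0"
      have ha: "1 / 2 \<le> cmod (\<phi> a)"
        using bspec[OF near a] norm_triangle_ineq2[of 1 "1 - \<phi> a"] by (simp add: norm_minus_commute)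
      then have "a \<in> A" using suppA1[of a] a S0(2) by force
      then have "dual.cmean (\<lambda>\<theta>. f \<theta> * cnj (\<theta> a)) = \<phi> a"
        unfolding f_def using dual.cmean_trig_coeff[of A a \<phi>] A by auto
      then show "1 / 2 \<le> cmod (dual.cmean (\<lambda>\<theta>. f \<theta> * cnj (\<theta> a)))" using ha by simp
    qed
    also have "\<dots> \<le> M (\<lambda>\<theta>. 2 * (z \<theta> - k)\<^sup>2 + 2 * r\<^sup>2)"
    proof (rule dual.mono)
      show "bounded ((\<lambda>\<theta>. (sqrt (cmod (f \<theta>)) - k)\<^sup>2) ` dual.X)"
        by (rule bounded_fun_power[OF bounded_fun_diff[OF bsq bounded_fun_const]])
      show "bounded ((\<lambda>\<theta>. 2 * (z \<theta> - k)\<^sup>2 + 2 * r\<^sup>2) ` dual.X)"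
        by (rule bounded_fun_add[OF bounded_fun_mult[OF bounded_fun_const bzk] bounded_fun_const])
      fix \<theta> assume "\<theta> \<in> dual.X"
      define w where "w = sqrt (cmod (f \<theta>)) - z \<theta>"
      have "\<bar>w\<bar> \<le> r" using zr[OF \<open>\<theta> \<in> dual.X\<close>] by (simp add: w_def abs_minus_commute)
      then have "w\<^sup>2 \<le> r\<^sup>2" using abs_le_square_iff[of w r] r(1) by simp
      moreover have "0 \<le> (w - (z \<theta> - k))\<^sup>2" by simp
      moreover have "(sqrt (cmod (f \<theta>)) - k)\<^sup>2 = (w + (z \<theta> - k))\<^sup>2" by (simp add: w_def)
      ultimately show "(sqrt (cmod (f \<theta>)) - k)\<^sup>2 \<le> 2 * (z \<theta> - k)\<^sup>2 + 2 * r\<^sup>2"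
        unfolding power2_sum power2_diff[of w] by linarith
    qed
    also have "\<dots> = 2 * V + 2 * r\<^sup>2"
      by (simp only: dual.add[OF bounded_fun_mult[OF bounded_fun_const bzk] bounded_fun_const] dual.scale[OF bzk] dual.const Vz)
    finally show ?thesis using r2(2) by linarith
  qed
  have V0: "V > 0" using V v by linarith

  define m where "m h = (\<Sum>a\<in>S - {\<one>}. (cmod (co a))\<^sup>2 * h a) / V" for h :: "'a \<Rightarrow> real"
  have "mean (N - {\<one>}) m"
  proof
    show "0 \<le> m h" if "bounded (h ` (N - {\<one>}))" "\<And>t. t \<in> N - {\<one>} \<Longrightarrow> 0 \<le> h t" for h
      unfolding m_def using that(2) S V0 by (intro divide_nonneg_nonneg sum_nonneg mult_nonneg_nonneg) auto
    show "m (\<lambda>t. 1) = 1" using V0 by (simp add: m_def flip: V_def)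
    show "m (\<lambda>t. h t + h' t) = m h + m h'" for h h'
      by (simp add: m_def distrib_left sum.distrib add_divide_distrib)
    show "m (\<lambda>t. r * h t) = r * m h" for r h
      by (simp add: m_def sum_distrib_left mult_ac)
  qed
  moreover have "\<bar>m (\<lambda>a. h (g \<otimes> a \<otimes> inv g)) - m h\<bar> \<le> e"
    if g: "g \<in> E" and h: "\<forall>t\<in>N - {\<one>}. \<bar>h t\<bar> \<le> 1" for g and h :: "'a \<Rightarrow> real"
  proof -
    have gG: "g \<in> carrier G" using g E by auto
    define gS where "gS = (\<lambda>a. g \<otimes> a \<otimes> inv g) ` S"
    define S' where "S' = S \<union> gS"
    have gSN: "gS \<subseteq> N" using S inv_op_closed2[OF gG] by (auto simp: gS_def)
    have S': "finite S'" "S' \<subseteq> N" using S gSN by (auto simp: S'_def gS_def)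
    \<comment> \<open>The coefficients of the conjugated function.\<close>
    define cg where "cg a = co (inv g \<otimes> a \<otimes> g)" for a
    have cg0: "cg b = 0" if "b \<in> N" "b \<notin> gS" for b
    proof -
      have "inv g \<otimes> b \<otimes> g \<notin> S"
      proof
        assume "inv g \<otimes> b \<otimes> g \<in> S"
        then have "b \<in> gS" unfolding gS_def using conj_inv(1)[OF gG mem_carrier[OF that(1)]]
          by (intro image_eqI[of _ _ "inv g \<otimes> b \<otimes> g"]) auto
        then show False using that by simp
      qed
      then show ?thesis by (simp add: cg_def co0)
    qed
    have inj: "inj_on (\<lambda>a. g \<otimes> a \<otimes> inv g) S"
      by (rule inj_on_inverseI[of _ "\<lambda>b. inv g \<otimes> b \<otimes> g"]) (use conj_inv(2)[OF gG] mem_carrier S in auto)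
    have re: "(\<Sum>b\<in>S' - {\<one>}. (cmod (cg b))\<^sup>2 * k b) = (\<Sum>a\<in>S - {\<one>}. (cmod (co a))\<^sup>2 * k (g \<otimes> a \<otimes> inv g))"
      for k :: "'a \<Rightarrow> real"
    proof -
      have g1: "g \<otimes> a \<otimes> inv g = \<one> \<longleftrightarrow> a = \<one>" if "a \<in> S" for a
        using inj_onD[OF inj, of a \<one>] that S(3) gG by auto
      have im: "(\<lambda>a. g \<otimes> a \<otimes> inv g) ` (S - {\<one>}) = gS - {\<one>}"
        using g1 by (auto simp: gS_def)
      have "(\<Sum>b\<in>S' - {\<one>}. (cmod (cg b))\<^sup>2 * k b) = (\<Sum>b\<in>gS - {\<one>}. (cmod (cg b))\<^sup>2 * k b)"
        by (rule sum.mono_neutral_right) (use S' cg0 in \<open>auto simp: S'_def\<close>)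
      also have "\<dots> = (\<Sum>a\<in>S - {\<one>}. (cmod (cg (g \<otimes> a \<otimes> inv g)))\<^sup>2 * k (g \<otimes> a \<otimes> inv g))"
        unfolding im[symmetric] by (subst sum.reindex) (auto intro: inj_on_subset[OF inj])
      also have "\<dots> = (\<Sum>a\<in>S - {\<one>}. (cmod (co a))\<^sup>2 * k (g \<otimes> a \<otimes> inv g))"
        using conj_inv(2)[OF gG] S mem_carrier by (intro sum.cong refl) (auto simp: cg_def)
      finally show ?thesis .
    qed
    have ext: "(\<Sum>b\<in>S' - {\<one>}. (cmod (co b))\<^sup>2 * k b) = (\<Sum>a\<in>S - {\<one>}. (cmod (co a))\<^sup>2 * k a)"
      for k :: "'a \<Rightarrow> real"
      by (rule sum.mono_neutral_right) (use S' co0 in \<open>auto simp: S'_def\<close>)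
    have sums: "(\<Sum>b\<in>S' - {\<one>}. (cmod (cg b))\<^sup>2) = V" "(\<Sum>b\<in>S' - {\<one>}. (cmod (co b))\<^sup>2) = V"
      using re[of "\<lambda>_. 1"] ext[of "\<lambda>_. 1"] by (simp_all add: V_def)

    define D where "D = (\<Sum>a\<in>S'. (cmod (cg a - co a))\<^sup>2)"
    have D: "D \<le> e\<^sup>2 * v / 16"
    proof -
      have eq: "(\<Sum>a\<in>S'. (cg a - co a) * \<theta> a) = complex_of_real (z (conj_char g \<theta>) - z \<theta>)" if \<theta>: "\<theta> \<in> dual.X" for \<theta>
      proof -
        have "(\<Sum>a\<in>S'. cg a * \<theta> a) = (\<Sum>a\<in>gS. cg a * \<theta> a)"
          by (rule sum.mono_neutral_right) (use S' cg0 in \<open>auto simp: S'_def\<close>)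
        also have "\<dots> = (\<Sum>a\<in>S. co a * conj_char g \<theta> a)"
          unfolding gS_def cg_def by (rule sum_conj_char[OF gG S(2), symmetric])
        also have "\<dots> = complex_of_real (z (conj_char g \<theta>))" using zS[OF conj_char_dual[OF gG \<theta>]] by simp
        finally have 1: "(\<Sum>a\<in>S'. cg a * \<theta> a) = complex_of_real (z (conj_char g \<theta>))" .
        have "(\<Sum>a\<in>S'. co a * \<theta> a) = (\<Sum>a\<in>S. co a * \<theta> a)"
          by (rule sum.mono_neutral_right) (use S' co0 in \<open>auto simp: S'_def\<close>)
        then show ?thesis using 1 zS[OF \<theta>] by (simp add: left_diff_distrib sum_subtractf)
      qed
      have bcg: "bounded ((\<lambda>\<theta>. f (conj_char g \<theta>)) ` dual.X)"
        by (rule bounded_fun_reindex[OF bf]) (rule conj_char_dual[OF gG])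
      have bd: "bounded ((\<lambda>\<theta>. cmod (f (conj_char g \<theta>) - f \<theta>)) ` dual.X)"
        by (rule bounded_fun_norm[OF bounded_fun_diff[OF bcg bf]])
      have "D = M (\<lambda>\<theta>. (cmod (\<Sum>a\<in>S'. (cg a - co a) * \<theta> a))\<^sup>2)"
        unfolding D_def using S' by (intro dual.parseval[symmetric]) auto
      also have "\<dots> \<le> M (\<lambda>\<theta>. 2 * cmod (f (conj_char g \<theta>) - f \<theta>) + 8 * r\<^sup>2)"
      proof (rule dual.mono)
        show "bounded ((\<lambda>\<theta>. (cmod (\<Sum>a\<in>S'. (cg a - co a) * \<theta> a))\<^sup>2) ` dual.X)"
          by (intro bounded_fun_power bounded_fun_norm b_simps)
        show "bounded ((\<lambda>\<theta>. 2 * cmod (f (conj_char g \<theta>) - f \<theta>) + 8 * r\<^sup>2) ` dual.X)"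
          by (rule bounded_fun_add[OF bounded_fun_mult[OF bounded_fun_const bd] bounded_fun_const])
        fix \<theta> assume \<theta>: "\<theta> \<in> dual.X"
        define s where "s = sqrt (cmod (f (conj_char g \<theta>))) - sqrt (cmod (f \<theta>))"
        define w where "w = z (conj_char g \<theta>) - z \<theta> - s"
        have "\<bar>w\<bar> \<le> 2 * r" using zr[OF \<theta>] zr[OF conj_char_dual[OF gG \<theta>]] unfolding w_def s_def by linarith
        then have "w\<^sup>2 \<le> (2 * r)\<^sup>2" using abs_le_square_iff[of w "2 * r"] r(1) by simp
        then have w2: "w\<^sup>2 \<le> 4 * r\<^sup>2" by (simp add: power_mult_distrib)
        have "s\<^sup>2 \<le> \<bar>cmod (f (conj_char g \<theta>)) - cmod (f \<theta>)\<bar>"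
          unfolding s_def by (rule abs_sqrt_diff_square_le) auto
        also have "\<dots> \<le> cmod (f (conj_char g \<theta>) - f \<theta>)" by (rule norm_triangle_ineq3)
        finally have s2: "s\<^sup>2 \<le> cmod (f (conj_char g \<theta>) - f \<theta>)" .
        have "(cmod (\<Sum>a\<in>S'. (cg a - co a) * \<theta> a))\<^sup>2 = (w + s)\<^sup>2"
          unfolding eq[OF \<theta>] by (simp only: norm_of_real power2_abs) (simp add: w_def)
        moreover have "0 \<le> (w - s)\<^sup>2" by simp
        ultimately show "(cmod (\<Sum>a\<in>S'. (cg a - co a) * \<theta> a))\<^sup>2 \<le> 2 * cmod (f (conj_char g \<theta>) - f \<theta>) + 8 * r\<^sup>2"
          using w2 s2 unfolding power2_sum power2_diff[of w] by linarith
      qed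
      also have "\<dots> = 2 * M (\<lambda>\<theta>. cmod (f (conj_char g \<theta>) - f \<theta>)) + 8 * r\<^sup>2"
        by (simp only: dual.add[OF bounded_fun_mult[OF bounded_fun_const bd] bounded_fun_const] dual.scale[OF bd] dual.const)
      finally show ?thesis using Mfg[OF g] r2(3) by linarith
    qed

    \<comment> \<open>The parameter \<open>e / 4\<close> makes both terms of the weighted inequality at most \<open>e / 2 * V\<close>.\<close>
    have "m (\<lambda>a. h (g \<otimes> a \<otimes> inv g)) - m h = (\<Sum>b\<in>S' - {\<one>}. ((cmod (cg b))\<^sup>2 - (cmod (co b))\<^sup>2) * h b) / V"
      unfolding m_def by (simp only: re[symmetric] ext[symmetric] left_diff_distrib sum_subtractf diff_divide_distrib)
    also have "\<bar>\<dots>\<bar> \<le> (\<Sum>b\<in>S' - {\<one>}. \<bar>(cmod (cg b))\<^sup>2 - (cmod (co b))\<^sup>2\<bar>) / V"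
    proof -
      have "\<bar>\<Sum>b\<in>S' - {\<one>}. ((cmod (cg b))\<^sup>2 - (cmod (co b))\<^sup>2) * h b\<bar> \<le> (\<Sum>b\<in>S' - {\<one>}. \<bar>(cmod (cg b))\<^sup>2 - (cmod (co b))\<^sup>2\<bar>)"
        using h S' by (intro order_trans[OF sum_abs] sum_mono) (auto simp: abs_mult intro!: mult_left_le)
      then show ?thesis using V0 by (simp add: divide_right_mono)
    qed
    also have "(\<Sum>b\<in>S' - {\<one>}. \<bar>(cmod (cg b))\<^sup>2 - (cmod (co b))\<^sup>2\<bar>) \<le>
        (\<Sum>b\<in>S' - {\<one>}. (cmod (cg b - co b))\<^sup>2 / (2 * (e / 4)) + e / 4 * ((cmod (cg b))\<^sup>2 + (cmod (co b))\<^sup>2))"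
      using e by (intro sum_mono norm_square_diff_le) simp
    also have "\<dots> = (\<Sum>b\<in>S' - {\<one>}. (cmod (cg b - co b))\<^sup>2) / (2 * (e / 4)) + e / 4 * (V + V)"
      by (simp only: sum.distrib sum_divide_distrib[symmetric] sum_distrib_left[symmetric] sums)
    also have "\<dots> \<le> (e\<^sup>2 * v / 16) / (2 * (e / 4)) + e / 4 * (V + V)"
    proof -
      have "(\<Sum>b\<in>S' - {\<one>}. (cmod (cg b - co b))\<^sup>2) \<le> D"
        unfolding D_def by (rule sum_mono2) (use S' in auto)
      then have "(\<Sum>b\<in>S' - {\<one>}. (cmod (cg b - co b))\<^sup>2) \<le> e\<^sup>2 * v / 16" using D by linarith
      then show ?thesis using e by (intro add_right_mono divide_right_mono) auto
    qed
    also have "\<dots> = e * (v / 8) + e / 2 * V" using e by (simp add: power2_eq_square)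
    also have "\<dots> \<le> e * (V / 2) + e / 2 * V" using V e by (intro add_right_mono mult_left_mono) auto
    also have "\<dots> = e * V" by simp
    finally show ?thesis using V0 by (simp add: divide_right_mono)
  qed
  ultimately show ?thesis by (intro exI[of _ m]) blast
qed

lemma conjugation_invariant_mean_exists:
  assumes "kernel_approximable G c0" and "infinite N"
  shows "\<exists>m. mean (N - {\<one>}) m \<and> (\<forall>g\<in>carrier G. \<forall>f. bounded (f ` (N - {\<one>})) \<longrightarrow>
    m (\<lambda>a. f (g \<otimes> a \<otimes> inv g)) = m f)"
proof (rule mean_limit)
  show "g \<otimes> a \<otimes> inv g \<in> N - {\<one>}" if g: "g \<in> carrier G" and a: "a \<in> N - {\<one>}" for g a
  proof -
    have "g \<otimes> a \<otimes> inv g \<noteq> \<one>"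
    proof
      assume "g \<otimes> a \<otimes> inv g = \<one>"
      then have "inv g \<otimes> \<one> \<otimes> g = a" using conj_inv(2)[OF g, of a] a mem_carrier by auto
      then show False using a g by auto
    qed
    then show ?thesis using inv_op_closed2[OF g] a by auto
  qed
  show "\<exists>m. mean (N - {\<one>}) m \<and> (\<forall>g\<in>E. \<forall>f. (\<forall>t\<in>N - {\<one>}. \<bar>f t\<bar> \<le> 1) \<longrightarrow>
      \<bar>m (\<lambda>a. f (g \<otimes> a \<otimes> inv g)) - m f\<bar> \<le> e)" if "finite E" "E \<subseteq> carrier G" "e > 0" for E e
    by (rule approximately_conjugation_invariant_mean[OF assms that])
qed

end

text \<open>Removing \<open>\<one>\<close> excludes the trivial invariant mean, evaluation at \<open>\<one>\<close>.\<close>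

theorem kernel_approximable_conjugation_invariant_mean:
  fixes G (structure)
  assumes "kernel_approximable G c" "N \<lhd> G" "comm_group (G\<lparr>carrier := N\<rparr>)" "infinite N"
    and "\<And>a. a \<in> N \<Longrightarrow> a \<noteq> \<one> \<Longrightarrow> \<exists>\<theta>\<in>carrier (dual (G\<lparr>carrier := N\<rparr>)). \<theta> a \<noteq> 1"
  shows "\<exists>m. mean (N - {\<one>}) m \<and> (\<forall>g\<in>carrier G. \<forall>f. bounded (f ` (N - {\<one>})) \<longrightarrow>
    m (\<lambda>a. f (g \<otimes> a \<otimes> inv g)) = m f)"
proof -
  obtain M where "dual_mean (G\<lparr>carrier := N\<rparr>) M"
    using dual_mean_exists[of "G\<lparr>carrier := N\<rparr>"] assms(3,5) by auto
  then interpret normal_dual_mean N G M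
    by (intro normal_dual_mean.intro assms(2))
  show ?thesis by (rule conjugation_invariant_mean_exists[OF assms(1,4)])
qed

lemma (in group) conj_eqI: "\<lbrakk>x \<in> carrier G; b \<in> carrier G; x \<otimes> a = b \<otimes> x\<rbrakk> \<Longrightarrow> x \<otimes> a \<otimes> inv x = b"
  by (simp add: m_assoc)

section \<open>The semidirect product of the integer plane with SL(2, Z)\<close>

lemma mult_SL2Z_Z2: "(n, A) \<otimes>\<^bsub>SL2Z_Z2\<^esub> (n', B) = (n + A *v n', A ** B)"
  by (simp add: SL2Z_Z2_def semidirect_product_def Z2_def SL2Z_def)

lemma one_SL2Z_Z2: "\<one>\<^bsub>SL2Z_Z2\<^esub> = (0, mat 1)"
  by (simp add: SL2Z_Z2_def semidirect_product_def Z2_def SL2Z_def)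

lemma carrier_SL2Z_Z2: "carrier SL2Z_Z2 = UNIV \<times> {A. det A = 1}"
  by (simp add: SL2Z_Z2_def semidirect_product_def Z2_def SL2Z_def)

text \<open>The quadrants, without the origin, are permuted by a rotation of order four, so each has
  mass \<open>1/4\<close>. The two elementary matrices move the first quadrant into disjoint parts of itself.\<close>

lemma no_SL2Z_invariant_mean:
  fixes X :: "'x set" and \<pi> :: "'x \<Rightarrow> int^2"
  assumes "mean X m" and nz: "\<And>x. x \<in> X \<Longrightarrow> \<pi> x \<noteq> 0"
    and inv: "\<And>A (F :: int^2 \<Rightarrow> real). det A = 1 \<Longrightarrow> bounded ((\<lambda>x. F (\<pi> x)) ` X) \<Longrightarrow>
      m (\<lambda>x. F (A *v \<pi> x)) = m (\<lambda>x. F (\<pi> x))"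
  shows False
proof -
  interpret mean X m by fact
  define I :: "(int \<Rightarrow> int \<Rightarrow> bool) \<Rightarrow> int^2 \<Rightarrow> real" where "I P v = of_bool (P (v $ 1) (v $ 2))" for P v
  have b: "bounded ((\<lambda>x. I P (h x)) ` X)" for P h
    by (rule bounded_fun_leI[of _ _ 1]) (simp add: I_def)
  have move: "m (\<lambda>x. I P (\<pi> x)) = m (\<lambda>x. I (\<lambda>s t. P (a * s + b * t) (c * s + d * t)) (\<pi> x))"
    if "a * d - b * c = 1" for a b c d P
  proof -
    define A :: "int^2^2" where "A = vector [vector [a, b], vector [c, d]]"
    have "det A = 1" using that by (simp add: A_def det_2)
    from inv[OF this b[of P "\<pi>"]] show ?thesis
      by (simp add: I_def A_def matrix_vector_mult_def sum_2)
  qed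
  define q1 where "q1 = m (\<lambda>x. I (\<lambda>s t. s > 0 \<and> t \<ge> 0) (\<pi> x))"
  define q2 where "q2 = m (\<lambda>x. I (\<lambda>s t. s \<le> 0 \<and> t > 0) (\<pi> x))"
  define q3 where "q3 = m (\<lambda>x. I (\<lambda>s t. s < 0 \<and> t \<le> 0) (\<pi> x))"
  define q4 where "q4 = m (\<lambda>x. I (\<lambda>s t. s \<ge> 0 \<and> t < 0) (\<pi> x))"
  have "q2 = q1" unfolding q1_def q2_def by (subst move[of 0 0 "-1" 1]) (simp_all add: conj_commute)
  moreover have "q3 = q2" unfolding q3_def q2_def by (subst move[of 0 0 "-1" 1]) (simp_all add: conj_commute)
  moreover have "q4 = q3" unfolding q4_def q3_def by (subst move[of 0 0 "-1" 1]) (simp_all add: conj_commute)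
  moreover have "q1 + (q2 + (q3 + q4)) = 1"
  proof -
    have "q1 + (q2 + (q3 + q4)) = m (\<lambda>x. I (\<lambda>s t. s > 0 \<and> t \<ge> 0) (\<pi> x) + (I (\<lambda>s t. s \<le> 0 \<and> t > 0) (\<pi> x) +
        (I (\<lambda>s t. s < 0 \<and> t \<le> 0) (\<pi> x) + I (\<lambda>s t. s \<ge> 0 \<and> t < 0) (\<pi> x))))"
      unfolding q1_def q2_def q3_def q4_def
      by (simp only: add[OF b b] add[OF b bounded_fun_add[OF b b]] add[OF b bounded_fun_add[OF b bounded_fun_add[OF b b]]])
    also have "\<dots> = m (\<lambda>x. 1)"
    proof (rule cong)
      show "bounded ((\<lambda>x. I (\<lambda>s t. s > 0 \<and> t \<ge> 0) (\<pi> x) + (I (\<lambda>s t. s \<le> 0 \<and> t > 0) (\<pi> x) +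
        (I (\<lambda>s t. s < 0 \<and> t \<le> 0) (\<pi> x) + I (\<lambda>s t. s \<ge> 0 \<and> t < 0) (\<pi> x)))) ` X)"
        by (rule bounded_fun_add[OF b bounded_fun_add[OF b bounded_fun_add[OF b b]]])
      fix x assume "x \<in> X"
      then have "\<pi> x $ 1 \<noteq> 0 \<or> \<pi> x $ 2 \<noteq> 0" using nz[of x] by (simp add: vec_eq_iff forall_2)
      then show "I (\<lambda>s t. s > 0 \<and> t \<ge> 0) (\<pi> x) + (I (\<lambda>s t. s \<le> 0 \<and> t > 0) (\<pi> x) +
        (I (\<lambda>s t. s < 0 \<and> t \<le> 0) (\<pi> x) + I (\<lambda>s t. s \<ge> 0 \<and> t < 0) (\<pi> x))) = 1"
        by (auto simp: I_def of_bool_def)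
    qed
    finally show ?thesis by (simp add: one)
  qed
  moreover have "q1 + q1 \<le> q1"
  proof -
    have u: "q1 \<le> m (\<lambda>x. I (\<lambda>s t. s > t \<and> t \<ge> 0) (\<pi> x))"
      unfolding q1_def by (subst (2) move[of 1 1 1 0]) (auto simp: I_def intro!: mono b[unfolded I_def])
    have w: "q1 \<le> m (\<lambda>x. I (\<lambda>s t. t \<ge> s \<and> s > 0) (\<pi> x))"
      unfolding q1_def by (subst (2) move[of 1 1 0 1]) (auto simp: I_def intro!: mono b[unfolded I_def])
    have "q1 + q1 \<le> m (\<lambda>x. I (\<lambda>s t. s > t \<and> t \<ge> 0) (\<pi> x) + I (\<lambda>s t. t \<ge> s \<and> s > 0) (\<pi> x))"
      unfolding add[OF b b] by (rule add_mono[OF u w])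
    also have "\<dots> \<le> q1" unfolding q1_def by (rule mono[OF bounded_fun_add[OF b b] b]) (auto simp: I_def)
    finally show ?thesis .
  qed
  ultimately show False by linarith
qed

lemma SL2Z_Z2_not_weakly_amenable: "\<not> weakly_amenable SL2Z_Z2"
proof
  let ?G = SL2Z_Z2
  assume "weakly_amenable SL2Z_Z2"
  then obtain c where c: "kernel_approximable SL2Z_Z2 c"
    using weakly_amenable_kernel_approximable[OF group_SL2Z_Z2] by blast
  interpret G: group SL2Z_Z2 by (rule group_SL2Z_Z2)
  have "snd \<in> hom SL2Z_Z2 SL2Z"
    by (rule homI) (auto simp: SL2Z_Z2_def semidirect_product_def)
  then interpret h: group_hom SL2Z_Z2 SL2Z snd
    by (simp add: group_hom_def group_hom_axioms_def group_SL2Z group_SL2Z_Z2)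
  define N where "N = kernel SL2Z_Z2 SL2Z snd"
  have N: "N = UNIV \<times> {mat 1}"
    by (auto simp: N_def kernel_def carrier_SL2Z_Z2) (auto simp: SL2Z_def det_I)
  have normal: "N \<lhd> SL2Z_Z2" unfolding N_def by (rule h.normal_kernel)
  have conj: "(0, A) \<otimes>\<^bsub>?G\<^esub> a \<otimes>\<^bsub>?G\<^esub> inv\<^bsub>?G\<^esub> (0, A) = (A *v fst a, mat 1)" if "a \<in> N" "det A = 1" for a A
    by (rule G.conj_eqI) (use that in \<open>auto simp: carrier_SL2Z_Z2 mult_SL2Z_Z2 N det_I matrix_mul_lid matrix_mul_rid\<close>)
  have "\<exists>m. mean (N - {\<one>\<^bsub>?G\<^esub>}) m \<and> (\<forall>g\<in>carrier SL2Z_Z2. \<forall>f. bounded (f ` (N - {\<one>\<^bsub>?G\<^esub>})) \<longrightarrow>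
      m (\<lambda>a. f (g \<otimes>\<^bsub>?G\<^esub> a \<otimes>\<^bsub>?G\<^esub> inv\<^bsub>?G\<^esub> g)) = m f)"
  proof (rule kernel_approximable_conjugation_invariant_mean[OF c normal])
    show "comm_group (SL2Z_Z2\<lparr>carrier := N\<rparr>)"
    proof (rule group.group_comm_groupI)
      show "group (SL2Z_Z2\<lparr>carrier := N\<rparr>)"
        using normal by (intro subgroup.subgroup_is_group group_SL2Z_Z2) (auto simp: normal_def)
      show "x \<otimes>\<^bsub>SL2Z_Z2\<lparr>carrier := N\<rparr>\<^esub> y = y \<otimes>\<^bsub>SL2Z_Z2\<lparr>carrier := N\<rparr>\<^esub> x"
        if "x \<in> carrier (SL2Z_Z2\<lparr>carrier := N\<rparr>)" "y \<in> carrier (SL2Z_Z2\<lparr>carrier := N\<rparr>)" for x y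
        using that by (auto simp: N mult_SL2Z_Z2 add.commute)
    qed
    have "infinite (UNIV :: (int^2) set)"
    proof
      assume "finite (UNIV :: (int^2) set)"
      then have "finite (range (\<lambda>n::int. (\<chi> i. n) :: int^2))" by (rule finite_subset[rotated]) simp
      moreover have "inj (\<lambda>n::int. (\<chi> i. n) :: int^2)" by (auto simp: inj_on_def vec_eq_iff)
      ultimately show False using finite_imageD infinite_UNIV_int by blast
    qed
    then show "infinite N" by (auto simp: N finite_cartesian_product_iff)
    fix a assume a: "a \<in> N" "a \<noteq> \<one>\<^bsub>?G\<^esub>"
    then obtain v where v: "a = (v, mat 1)" "v \<noteq> 0" by (auto simp: N one_SL2Z_Z2)
    then obtain i where i: "v $ i \<noteq> 0" by (auto simp: vec_eq_iff)
    \<comment> \<open>Scaled such that its value at \<open>a\<close> is \<open>-1\<close>.\<close>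
    define \<theta> where "\<theta> x = (if x \<in> N then cis (pi * (fst x $ i) / (v $ i)) else 1)" for x
    have "\<theta> \<in> carrier (dual (SL2Z_Z2\<lparr>carrier := N\<rparr>))"
      by (auto simp: dual_def \<theta>_def N mult_SL2Z_Z2 cis_mult add_divide_distrib distrib_left)
    moreover have "\<theta> a \<noteq> 1" using v i by (simp add: \<theta>_def N)
    ultimately show "\<exists>\<theta>\<in>carrier (dual (SL2Z_Z2\<lparr>carrier := N\<rparr>)). \<theta> a \<noteq> 1" by blast
  qed
  then obtain m where m: "mean (N - {\<one>\<^bsub>?G\<^esub>}) m"
    and inv: "\<And>g f. g \<in> carrier SL2Z_Z2 \<Longrightarrow> bounded (f ` (N - {\<one>\<^bsub>?G\<^esub>})) \<Longrightarrow>
      m (\<lambda>a. f (g \<otimes>\<^bsub>?G\<^esub> a \<otimes>\<^bsub>?G\<^esub> inv\<^bsub>?G\<^esub> g)) = m f" by blast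
  interpret mean "N - {\<one>\<^bsub>?G\<^esub>}" m by fact
  show False
  proof (rule no_SL2Z_invariant_mean[OF m, of fst])
    show "fst x \<noteq> 0" if "x \<in> N - {\<one>\<^bsub>?G\<^esub>}" for x using that by (auto simp: N one_SL2Z_Z2)
    fix A :: "int^2^2" and F :: "int^2 \<Rightarrow> real"
    assume A: "det A = 1" and b: "bounded ((\<lambda>x. F (fst x)) ` (N - {\<one>\<^bsub>?G\<^esub>}))"
    have gA: "(0, A) \<in> carrier SL2Z_Z2" using A by (simp add: carrier_SL2Z_Z2)
    have "m (\<lambda>x. F (A *v fst x)) = m (\<lambda>a. F (fst ((0, A) \<otimes>\<^bsub>?G\<^esub> a \<otimes>\<^bsub>?G\<^esub> inv\<^bsub>?G\<^esub> (0, A))))"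
    proof (rule cong[symmetric])
      have inN: "(0, A) \<otimes>\<^bsub>?G\<^esub> a \<otimes>\<^bsub>?G\<^esub> inv\<^bsub>?G\<^esub> (0, A) \<in> N - {\<one>\<^bsub>?G\<^esub>}" if "a \<in> N - {\<one>\<^bsub>?G\<^esub>}" for a
      proof -
        have "A *v fst a \<noteq> 0"
        proof
          assume "A *v fst a = 0"
          then have "(0, A) \<otimes>\<^bsub>?G\<^esub> a = (0, A) \<otimes>\<^bsub>?G\<^esub> \<one>\<^bsub>?G\<^esub>"
            using that by (auto simp: N mult_SL2Z_Z2 one_SL2Z_Z2)
          moreover have "b = inv\<^bsub>?G\<^esub> (0, A) \<otimes>\<^bsub>?G\<^esub> ((0, A) \<otimes>\<^bsub>?G\<^esub> b)" if "b \<in> carrier SL2Z_Z2" for b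
            using gA that by (simp flip: G.m_assoc)
          moreover have "a \<in> carrier SL2Z_Z2" using that by (auto simp: N carrier_SL2Z_Z2 det_I)
          ultimately have "a = \<one>\<^bsub>?G\<^esub>" using G.one_closed by metis
          then show False using that by simp
        qed
        then show ?thesis using that A by (simp add: conj N one_SL2Z_Z2)
      qed
      show "bounded ((\<lambda>a. F (fst ((0, A) \<otimes>\<^bsub>?G\<^esub> a \<otimes>\<^bsub>?G\<^esub> inv\<^bsub>?G\<^esub> (0, A)))) ` (N - {\<one>\<^bsub>?G\<^esub>}))"
        by (rule bounded_fun_reindex[OF b]) (rule inN)
      show "F (fst ((0, A) \<otimes>\<^bsub>?G\<^esub> a \<otimes>\<^bsub>?G\<^esub> inv\<^bsub>?G\<^esub> (0, A))) = F (A *v fst a)"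
        if "a \<in> N - {\<one>\<^bsub>?G\<^esub>}" for a using conj[of a A] that A by simp
    qed
    also have "\<dots> = m (\<lambda>a. F (fst a))" by (rule inv[OF gA b])
    finally show "m (\<lambda>x. F (A *v fst x)) = m (\<lambda>x. F (fst x))" .
  qed
qed

section \<open>Wreath products\<close>

text \<open>If \<open>x\<close> has finite order, the value at \<open>x\<close> is a root of unity of this order. For infinite order it
  may be any number of modulus \<open>1\<close>, and is chosen such that the value at \<open>x [^] k\<close> is \<open>-1\<close>.\<close>

lemma (in group) cyclic_separating_character:
  assumes x: "x \<in> carrier G" and k: "x [^] (k::int) \<noteq> \<one>"
  shows "\<exists>\<theta> :: 'a \<Rightarrow> complex. (\<forall>l::int. cmod (\<theta> (x [^] l)) = 1) \<and>
    (\<forall>(l::int) (l'::int). \<theta> (x [^] l \<otimes> x [^] l') = \<theta> (x [^] l) * \<theta> (x [^] l')) \<and> \<theta> (x [^] k) \<noteq> 1"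
proof -
  define d where "d = int (ord x)"
  have eq: "x [^] l = x [^] l' \<longleftrightarrow> d dvd (l' - l)" for l l' :: int
    unfolding d_def by (rule int_pow_eq[OF x])
  have kd: "\<not> d dvd k" using k int_pow_eq_id[OF x, of k] by (simp add: d_def)
  define \<alpha> where "\<alpha> = (if d = 0 then pi / real_of_int k else 2 * pi / real_of_int d)"
  have cis_2pi_int: "cis (2 * pi * real_of_int j) = 1" for j
    by (simp add: cis.ctr complex_eq_iff)
  have per: "cis (\<alpha> * real_of_int (d * j)) = 1" for j
    using cis_2pi_int[of j] by (cases "d = 0") (simp_all add: \<alpha>_def mult.assoc)
  have cis_k: "cis (\<alpha> * real_of_int k) \<noteq> 1"
  proof (cases "d = 0")
    case True
    then show ?thesis using kd by (simp add: \<alpha>_def)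
  next
    case False
    show ?thesis
    proof
      assume "cis (\<alpha> * real_of_int k) = 1"
      then have "cos (\<alpha> * real_of_int k) = 1" by (simp add: complex_eq_iff)
      then obtain n :: int where "\<alpha> * real_of_int k = real_of_int n * 2 * pi" unfolding cos_one_2pi_int by blast
      then have "real_of_int k = real_of_int (n * d)" using False by (simp add: \<alpha>_def field_simps)
      then have "k = n * d" by (simp only: of_int_eq_iff)
      then show False using kd by simp
    qed
  qed
  define \<theta> where "\<theta> y = cis (\<alpha> * real_of_int (SOME l::int. y = x [^] l))" for y
  have \<theta>: "\<theta> (x [^] l) = cis (\<alpha> * real_of_int l)" for l :: int
  proof -
    define l' where "l' = (SOME l'::int. x [^] l = x [^] l')"
    have "x [^] l = x [^] l'" unfolding l'_def using someI[of "\<lambda>l'::int. x [^] l = x [^] l'" l] by simp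
    then obtain j where "l' - l = d * j" unfolding eq by (auto simp: dvd_def)
    then have "l' = l + d * j" by simp
    then have "cis (\<alpha> * real_of_int l') = cis (\<alpha> * real_of_int l) * cis (\<alpha> * real_of_int (d * j))"
      by (simp add: cis_mult distrib_left)
    then show ?thesis unfolding \<theta>_def l'_def[symmetric] per by simp
  qed
  have "\<theta> (x [^] l \<otimes> x [^] l') = \<theta> (x [^] l) * \<theta> (x [^] l')" for l l' :: int
    unfolding int_pow_mult[OF x, symmetric] \<theta> by (simp add: cis_mult distrib_left)
  moreover have "cmod (\<theta> (x [^] l)) = 1" for l :: int unfolding \<theta> by simp
  ultimately show ?thesis using cis_k \<theta> by (intro exI[of _ \<theta>]) auto
qed

lemma finite_group_amenable:
  assumes "group G" "finite (carrier G)" shows "amenable G"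
  unfolding amenable_iff_mean
proof -
  interpret group G by fact
  define m where "m f = (\<Sum>t\<in>carrier G. f t) / card (carrier G)" for f :: "'a \<Rightarrow> real"
  have c: "card (carrier G) > 0" using assms(2) by (simp add: card_gt_0_iff) (use one_closed in blast)
  have "mean (carrier G) m"
  proof
    show "m (\<lambda>t. f t + h t) = m f + m h" for f h by (simp add: m_def sum.distrib add_divide_distrib)
    show "m (\<lambda>t. r * f t) = r * m f" for r f by (simp add: m_def sum_distrib_left)
    show "0 \<le> m f" if "\<And>t. t \<in> carrier G \<Longrightarrow> 0 \<le> f t" for f
      unfolding m_def using that by (intro divide_nonneg_nonneg sum_nonneg) auto
    show "m (\<lambda>t. 1) = 1" using c by (simp add: m_def)
  qed
  moreover have "m (\<lambda>t. f (inv\<^bsub>G\<^esub> x \<otimes>\<^bsub>G\<^esub> t)) = m f" if "x \<in> carrier G" for x f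
    unfolding m_def using sum.reindex_bij_betw[OF bij_betw_left_mult[of "inv\<^bsub>G\<^esub> x"], of f] that by simp
  ultimately show "\<exists>m. mean (carrier G) m \<and>
      (\<forall>x\<in>carrier G. \<forall>f. bounded (f ` carrier G) \<longrightarrow> m (\<lambda>t. f (inv\<^bsub>G\<^esub> x \<otimes>\<^bsub>G\<^esub> t)) = m f)"
    by blast
qed

lemma mult_wreath_product:
  "(f, g) \<otimes>\<^bsub>wreath_product \<Lambda> \<Gamma>\<^esub> (f', g') =
    (\<lambda>t\<in>carrier \<Gamma>. f t \<otimes>\<^bsub>\<Lambda>\<^esub> f' (inv\<^bsub>\<Gamma>\<^esub> g \<otimes>\<^bsub>\<Gamma>\<^esub> t), g \<otimes>\<^bsub>\<Gamma>\<^esub> g')"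
  by (auto simp: wreath_product_def semidirect_product_def intro!: restrict_ext)

lemma one_wreath_product: "\<one>\<^bsub>wreath_product \<Lambda> \<Gamma>\<^esub> = (\<lambda>t\<in>carrier \<Gamma>. \<one>\<^bsub>\<Lambda>\<^esub>, \<one>\<^bsub>\<Gamma>\<^esub>)"
  by (simp add: wreath_product_def semidirect_product_def)

lemma carrier_wreath_product:
  assumes "group \<Lambda>"
  shows "carrier (wreath_product \<Lambda> \<Gamma>) =
    {f \<in> carrier \<Gamma> \<rightarrow>\<^sub>E carrier \<Lambda>. finite {t\<in>carrier \<Gamma>. f t \<noteq> \<one>\<^bsub>\<Lambda>\<^esub>}} \<times> carrier \<Gamma>"
  by (simp add: wreath_product_def semidirect_product_def carrier_sum_group assms)

text \<open>A non-trivial element \<open>x\<close> of \<open>\<Lambda>\<close> generates a cyclic group \<open>C\<close>, and the sum \<open>N\<close> of copies of \<open>C\<close>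
  is an abelian normal subgroup of the subgroup \<open>V\<close> of elements with coordinates in \<open>C\<close>. The finite
  supports of the non-trivial elements of \<open>N\<close> are translated when the elements are conjugated by \<open>\<Gamma>\<close>.
  Averaging functions on \<open>\<Gamma>\<close> over these supports turns an invariant mean on the non-trivial elements
  of \<open>N\<close> into one on \<open>\<Gamma>\<close>.\<close>

lemma wreath_product_not_weakly_amenable:
  fixes \<Lambda> :: "('a, 'c) monoid_scheme" and \<Gamma> :: "('b, 'd) monoid_scheme" (structure)
  assumes "group \<Lambda>" "group \<Gamma>" and nontrivial: "carrier \<Lambda> \<noteq> {\<one>\<^bsub>\<Lambda>\<^esub>}" and "\<not> amenable \<Gamma>"
  shows "\<not> weakly_amenable (wreath_product \<Lambda> \<Gamma>)"
proof
  interpret L: group \<Lambda> by fact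
  interpret G: group \<Gamma> by fact
  define W where "W = wreath_product \<Lambda> \<Gamma>"
  have "group W" unfolding W_def by (rule group_wreath_product) fact+
  then interpret W: group W .
  assume "weakly_amenable (wreath_product \<Lambda> \<Gamma>)"
  then obtain c where c: "kernel_approximable W c"
    using weakly_amenable_kernel_approximable[OF \<open>group W\<close>] by (auto simp: W_def)
  obtain x where x: "x \<in> carrier \<Lambda>" "x \<noteq> \<one>\<^bsub>\<Lambda>\<^esub>" using nontrivial L.one_closed by blast

  define C where "C = range (\<lambda>k::int. x [^]\<^bsub>\<Lambda>\<^esub> k)"
  have C: "C \<subseteq> carrier \<Lambda>" using x by (auto simp: C_def)
  have C1: "\<one>\<^bsub>\<Lambda>\<^esub> \<in> C" unfolding C_def by (rule image_eqI[of _ _ 0]) auto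
  have Cx: "x \<in> C" unfolding C_def by (rule image_eqI[of _ _ 1]) (use x in auto)
  have Cm: "y \<otimes>\<^bsub>\<Lambda>\<^esub> z \<in> C" and Cc: "y \<otimes>\<^bsub>\<Lambda>\<^esub> z = z \<otimes>\<^bsub>\<Lambda>\<^esub> y" if yz: "y \<in> C" "z \<in> C" for y z
  proof -
    obtain k l :: int where kl: "y = x [^]\<^bsub>\<Lambda>\<^esub> k" "z = x [^]\<^bsub>\<Lambda>\<^esub> l" using yz unfolding C_def by blast
    have "y \<otimes>\<^bsub>\<Lambda>\<^esub> z = x [^]\<^bsub>\<Lambda>\<^esub> (k + l)" "z \<otimes>\<^bsub>\<Lambda>\<^esub> y = x [^]\<^bsub>\<Lambda>\<^esub> (l + k)"
      unfolding kl by (rule L.int_pow_mult[OF x(1), symmetric])+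
    then show "y \<otimes>\<^bsub>\<Lambda>\<^esub> z \<in> C" "y \<otimes>\<^bsub>\<Lambda>\<^esub> z = z \<otimes>\<^bsub>\<Lambda>\<^esub> y" by (auto simp: C_def add.commute)
  qed
  have Ci: "inv\<^bsub>\<Lambda>\<^esub> y \<in> C" if "y \<in> C" for y
    using that x(1) by (auto simp: C_def simp flip: L.int_pow_neg)

  define P where "P f \<longleftrightarrow> f \<in> carrier \<Gamma> \<rightarrow>\<^sub>E C \<and> finite {t\<in>carrier \<Gamma>. f t \<noteq> \<one>\<^bsub>\<Lambda>\<^esub>}" for f
  have PC: "f t \<in> C" if "P f" "t \<in> carrier \<Gamma>" for f t using that by (auto simp: P_def)
  have Pe: "f \<in> extensional (carrier \<Gamma>)" if "P f" for f using that by (auto simp: P_def PiE_def)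
  have shift: "finite {t\<in>carrier \<Gamma>. f (g \<otimes> t) \<noteq> \<one>\<^bsub>\<Lambda>\<^esub>}"
    if "finite {t\<in>carrier \<Gamma>. f t \<noteq> \<one>\<^bsub>\<Lambda>\<^esub>}" "g \<in> carrier \<Gamma>" for f :: "'b \<Rightarrow> 'a" and g
  proof (rule finite_subset)
    show "{t\<in>carrier \<Gamma>. f (g \<otimes> t) \<noteq> \<one>\<^bsub>\<Lambda>\<^esub>} \<subseteq> (\<lambda>s. inv g \<otimes> s) ` {t\<in>carrier \<Gamma>. f t \<noteq> \<one>\<^bsub>\<Lambda>\<^esub>}"
    proof
      fix t assume "t \<in> {t\<in>carrier \<Gamma>. f (g \<otimes> t) \<noteq> \<one>\<^bsub>\<Lambda>\<^esub>}"
      then show "t \<in> (\<lambda>s. inv g \<otimes> s) ` {t\<in>carrier \<Gamma>. f t \<noteq> \<one>\<^bsub>\<Lambda>\<^esub>}"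
        using that(2) by (intro image_eqI[of _ _ "g \<otimes> t"]) (auto simp flip: G.m_assoc)
    qed
  qed (use that in simp)
  have P_shift: "P (\<lambda>t\<in>carrier \<Gamma>. f (g \<otimes> t))" if "P f" "g \<in> carrier \<Gamma>" for f g
    using that shift[of f g] PC[OF that(1)] by (auto simp: P_def cong: conj_cong)
  have P_mult: "P (\<lambda>t\<in>carrier \<Gamma>. f t \<otimes>\<^bsub>\<Lambda>\<^esub> f' t)" if "P f" "P f'" for f f'
  proof -
    have "finite {t\<in>carrier \<Gamma>. f t \<otimes>\<^bsub>\<Lambda>\<^esub> f' t \<noteq> \<one>\<^bsub>\<Lambda>\<^esub>}"
      by (rule finite_subset[of _ "{t\<in>carrier \<Gamma>. f t \<noteq> \<one>\<^bsub>\<Lambda>\<^esub>} \<union> {t\<in>carrier \<Gamma>. f' t \<noteq> \<one>\<^bsub>\<Lambda>\<^esub>}"])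
        (use that in \<open>auto simp: P_def\<close>)
    then show ?thesis using Cm PC[OF that(1)] PC[OF that(2)] by (auto simp: P_def cong: conj_cong)
  qed
  have P_inv: "P (\<lambda>t\<in>carrier \<Gamma>. inv\<^bsub>\<Lambda>\<^esub> f t)" if "P f" for f
  proof -
    have "finite {t\<in>carrier \<Gamma>. inv\<^bsub>\<Lambda>\<^esub> f t \<noteq> \<one>\<^bsub>\<Lambda>\<^esub>}"
      by (rule finite_subset[of _ "{t\<in>carrier \<Gamma>. f t \<noteq> \<one>\<^bsub>\<Lambda>\<^esub>}"]) (use that in \<open>auto simp: P_def\<close>)
    then show ?thesis using Ci PC[OF that] by (auto simp: P_def cong: conj_cong)
  qed
  have P_one: "P (\<lambda>t\<in>carrier \<Gamma>. \<one>\<^bsub>\<Lambda>\<^esub>)" using C1 by (auto simp: P_def cong: conj_cong)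

  define H where "H = {f. P f} \<times> carrier \<Gamma>"
  have HW: "H \<subseteq> carrier W"
    using C by (auto simp: H_def W_def carrier_wreath_product[OF \<open>group \<Lambda>\<close>] P_def PiE_iff)
  have H: "subgroup H W"
  proof (rule W.subgroupI)
    show "H \<noteq> {}" using P_one by (auto simp: H_def)
    show "a \<otimes>\<^bsub>W\<^esub> b \<in> H" if ab0: "a \<in> H" "b \<in> H" for a b
    proof -
      obtain f g f' g' where ab: "a = (f, g)" "b = (f', g')" "P f" "P f'" "g \<in> carrier \<Gamma>" "g' \<in> carrier \<Gamma>"
        using ab0 by (auto simp: H_def)
      have "a \<otimes>\<^bsub>W\<^esub> b = (\<lambda>t\<in>carrier \<Gamma>. f t \<otimes>\<^bsub>\<Lambda>\<^esub> (\<lambda>t\<in>carrier \<Gamma>. f' (inv g \<otimes> t)) t, g \<otimes> g')"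
        unfolding ab W_def mult_wreath_product by (auto intro!: restrict_ext)
      then show ?thesis using P_mult[OF ab(3) P_shift[OF ab(4) G.inv_closed[OF ab(5)]]] ab by (simp add: H_def)
    qed
    show "inv\<^bsub>W\<^esub> a \<in> H" if a0: "a \<in> H" for a
    proof -
      obtain f g where a: "a = (f, g)" "P f" "g \<in> carrier \<Gamma>" using a0 by (auto simp: H_def)
      define f' where "f' = (\<lambda>t\<in>carrier \<Gamma>. inv\<^bsub>\<Lambda>\<^esub> (\<lambda>t\<in>carrier \<Gamma>. f (g \<otimes> t)) t)"
      have f': "P f'" unfolding f'_def by (rule P_inv[OF P_shift[OF a(2,3)]])
      have "(f', inv g) \<otimes>\<^bsub>W\<^esub> a = \<one>\<^bsub>W\<^esub>"
        unfolding a W_def mult_wreath_product one_wreath_product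
        using PC[OF a(2)] C a(3) by (auto simp: f'_def subset_iff intro!: restrict_ext L.l_inv)
      then have "inv\<^bsub>W\<^esub> a = (f', inv g)"
        by (rule W.inv_equality) (use a0 HW f' a in \<open>auto simp: H_def\<close>)
      then show ?thesis using f' a by (simp add: H_def)
    qed
  qed (rule HW)
  define V where "V = W\<lparr>carrier := H\<rparr>"
  have "group V" unfolding V_def by (rule subgroup.subgroup_is_group[OF H]) fact
  then interpret V: group V .
  have cV: "kernel_approximable V c" unfolding V_def by (rule kernel_approximable_subgroup[OF \<open>group W\<close> H c])
  have carV: "carrier V = H" by (simp add: V_def)
  have multV: "(f, g) \<otimes>\<^bsub>V\<^esub> (f', g') = (\<lambda>t\<in>carrier \<Gamma>. f t \<otimes>\<^bsub>\<Lambda>\<^esub> f' (inv g \<otimes> t), g \<otimes> g')" for f g f' g'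
    by (simp add: V_def W_def mult_wreath_product)
  have oneV: "\<one>\<^bsub>V\<^esub> = (\<lambda>t\<in>carrier \<Gamma>. \<one>\<^bsub>\<Lambda>\<^esub>, \<one>)" by (simp add: V_def W_def one_wreath_product)

  have "snd \<in> hom V \<Gamma>" by (rule homI) (auto simp: carV H_def multV)
  then interpret h: group_hom V \<Gamma> snd
    by (simp add: group_hom_def group_hom_axioms_def \<open>group V\<close> \<open>group \<Gamma>\<close>)
  define N where "N = kernel V \<Gamma> snd"
  have N: "N = {f. P f} \<times> {\<one>}" by (auto simp: N_def kernel_def carV H_def)
  have normal: "N \<lhd> V" unfolding N_def by (rule h.normal_kernel)
  have multN: "(f, \<one>) \<otimes>\<^bsub>V\<^esub> (f', \<one>) = (\<lambda>t\<in>carrier \<Gamma>. f t \<otimes>\<^bsub>\<Lambda>\<^esub> f' t, \<one>)" for f f'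
    by (auto simp: multV intro!: restrict_ext)
  \<comment> \<open>The copy of \<open>\<Gamma>\<close> in the wreath product.\<close>
  define w where "w \<gamma> = (\<lambda>t\<in>carrier \<Gamma>. \<one>\<^bsub>\<Lambda>\<^esub>, \<gamma>)" for \<gamma> :: 'b
  have wV: "w \<gamma> \<in> carrier V" if "\<gamma> \<in> carrier \<Gamma>" for \<gamma> using that P_one by (simp add: carV H_def w_def)
  have conj: "w \<gamma> \<otimes>\<^bsub>V\<^esub> a \<otimes>\<^bsub>V\<^esub> inv\<^bsub>V\<^esub> (w \<gamma>) = (\<lambda>t\<in>carrier \<Gamma>. fst a (inv \<gamma> \<otimes> t), \<one>)"
    if \<gamma>: "\<gamma> \<in> carrier \<Gamma>" and a: "a \<in> N" for \<gamma> a
  proof (rule V.conj_eqI[OF wV[OF \<gamma>]])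
    obtain f where f: "a = (f, \<one>)" "P f" using a by (auto simp: N)
    show "(\<lambda>t\<in>carrier \<Gamma>. fst a (inv \<gamma> \<otimes> t), \<one>) \<in> carrier V"
      using P_shift[OF f(2) G.inv_closed[OF \<gamma>]] by (simp add: carV H_def f)
    have "f t \<in> carrier \<Lambda>" if "t \<in> carrier \<Gamma>" for t using PC[OF f(2) that] C by auto
    then show "w \<gamma> \<otimes>\<^bsub>V\<^esub> a = (\<lambda>t\<in>carrier \<Gamma>. fst a (inv \<gamma> \<otimes> t), \<one>) \<otimes>\<^bsub>V\<^esub> w \<gamma>"
      using \<gamma> by (auto simp: w_def f multV intro!: restrict_ext)
  qed
  have "\<exists>m. mean (N - {\<one>\<^bsub>V\<^esub>}) m \<and> (\<forall>g\<in>carrier V. \<forall>f. bounded (f ` (N - {\<one>\<^bsub>V\<^esub>})) \<longrightarrow>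
      m (\<lambda>a. f (g \<otimes>\<^bsub>V\<^esub> a \<otimes>\<^bsub>V\<^esub> inv\<^bsub>V\<^esub> g)) = m f)"
  proof (rule kernel_approximable_conjugation_invariant_mean[OF cV normal])
    show "comm_group (V\<lparr>carrier := N\<rparr>)"
    proof (rule group.group_comm_groupI)
      show "group (V\<lparr>carrier := N\<rparr>)"
        using normal by (intro subgroup.subgroup_is_group \<open>group V\<close>) (auto simp: normal_def)
      show "a \<otimes>\<^bsub>V\<lparr>carrier := N\<rparr>\<^esub> b = b \<otimes>\<^bsub>V\<lparr>carrier := N\<rparr>\<^esub> a"
        if "a \<in> carrier (V\<lparr>carrier := N\<rparr>)" "b \<in> carrier (V\<lparr>carrier := N\<rparr>)" for a b
        using that Cc PC by (auto simp: N multN intro!: restrict_ext)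
    qed
    have "infinite (carrier \<Gamma>)" using finite_group_amenable[OF \<open>group \<Gamma>\<close>] \<open>\<not> amenable \<Gamma>\<close> by blast
    define \<delta> where "\<delta> s = (\<lambda>t\<in>carrier \<Gamma>. if t = s then x else \<one>\<^bsub>\<Lambda>\<^esub>, \<one>)" for s
    have "inj_on \<delta> (carrier \<Gamma>)"
    proof (rule inj_onI)
      fix s s' assume s: "s \<in> carrier \<Gamma>" and "\<delta> s = \<delta> s'"
      then have "fst (\<delta> s) s = fst (\<delta> s') s" by simp
      then show "s = s'" using s x(2) by (auto simp: \<delta>_def split: if_splits)
    qed
    moreover have "\<delta> ` carrier \<Gamma> \<subseteq> N"
    proof (rule image_subsetI)
      fix s assume "s \<in> carrier \<Gamma>"
      have "finite {t\<in>carrier \<Gamma>. (if t = s then x else \<one>\<^bsub>\<Lambda>\<^esub>) \<noteq> \<one>\<^bsub>\<Lambda>\<^esub>}" by (rule finite_subset[of _ "{s}"]) auto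
      then show "\<delta> s \<in> N" using C1 Cx by (auto simp: N \<delta>_def P_def cong: conj_cong)
    qed
    ultimately show "infinite N" using \<open>infinite (carrier \<Gamma>)\<close> by (meson finite_imageD finite_subset)
    fix a assume a: "a \<in> N" "a \<noteq> \<one>\<^bsub>V\<^esub>"
    then obtain f where f: "a = (f, \<one>)" "P f" by (auto simp: N)
    have "\<exists>t\<in>carrier \<Gamma>. f t \<noteq> \<one>\<^bsub>\<Lambda>\<^esub>"
    proof (rule ccontr)
      assume "\<not> ?thesis"
      then have "f = (\<lambda>t\<in>carrier \<Gamma>. \<one>\<^bsub>\<Lambda>\<^esub>)" using Pe[OF f(2)] by (intro extensionalityI[of f "carrier \<Gamma>"]) auto
      then show False using a f by (simp add: oneV)
    qed
    then obtain s where s: "s \<in> carrier \<Gamma>" "f s \<noteq> \<one>\<^bsub>\<Lambda>\<^esub>" by blast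
    then obtain k :: int where k: "f s = x [^]\<^bsub>\<Lambda>\<^esub> k" using PC[OF f(2) s(1)] by (auto simp: C_def)
    obtain \<theta> :: "'a \<Rightarrow> complex" where \<theta>: "\<And>l::int. cmod (\<theta> (x [^]\<^bsub>\<Lambda>\<^esub> l)) = 1"
      "\<And>(l::int) (l'::int). \<theta> (x [^]\<^bsub>\<Lambda>\<^esub> l \<otimes>\<^bsub>\<Lambda>\<^esub> x [^]\<^bsub>\<Lambda>\<^esub> l') = \<theta> (x [^]\<^bsub>\<Lambda>\<^esub> l) * \<theta> (x [^]\<^bsub>\<Lambda>\<^esub> l')" "\<theta> (x [^]\<^bsub>\<Lambda>\<^esub> k) \<noteq> 1"
      using L.cyclic_separating_character[OF x(1), of k] s k by auto
    have \<theta>C: "cmod (\<theta> y) = 1" "\<theta> (y \<otimes>\<^bsub>\<Lambda>\<^esub> z) = \<theta> y * \<theta> z" if "y \<in> C" "z \<in> C" for y z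
      using that \<theta>(1,2) by (auto simp: C_def)
    define \<psi> where "\<psi> b = (if b \<in> N then \<theta> (fst b s) else 1)" for b
    have "\<psi> \<in> carrier (dual (V\<lparr>carrier := N\<rparr>))"
    proof -
      have "cmod (\<psi> b) = 1" if "b \<in> N" for b using that PC s \<theta>C(1)[OF _ C1] by (auto simp: \<psi>_def N)
      moreover have "\<psi> (b \<otimes>\<^bsub>V\<^esub> b') = \<psi> b * \<psi> b'" if bb: "b \<in> N" "b' \<in> N" for b b'
      proof -
        obtain f1 f2 where f12: "b = (f1, \<one>)" "b' = (f2, \<one>)" "P f1" "P f2" using bb by (auto simp: N)
        have "b \<otimes>\<^bsub>V\<^esub> b' \<in> N" using P_mult[OF f12(3,4)] by (simp add: f12 multN N)
        then show ?thesis using bb s \<theta>C(2)[OF PC[OF f12(3) s(1)] PC[OF f12(4) s(1)]]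
          by (simp add: \<psi>_def) (simp add: f12 multN)
      qed
      ultimately show ?thesis by (simp add: dual_def) (simp add: \<psi>_def)
    qed
    moreover have "\<psi> a \<noteq> 1" using a(1) \<theta>(3) by (simp add: \<psi>_def f k)
    ultimately show "\<exists>\<theta>\<in>carrier (dual (V\<lparr>carrier := N\<rparr>)). \<theta> a \<noteq> 1" by blast
  qed
  then obtain m where m: "mean (N - {\<one>\<^bsub>V\<^esub>}) m"
    and inv: "\<And>g f. g \<in> carrier V \<Longrightarrow> bounded (f ` (N - {\<one>\<^bsub>V\<^esub>})) \<Longrightarrow>
      m (\<lambda>a. f (g \<otimes>\<^bsub>V\<^esub> a \<otimes>\<^bsub>V\<^esub> inv\<^bsub>V\<^esub> g)) = m f" by blast
  interpret mean "N - {\<one>\<^bsub>V\<^esub>}" m by fact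

  define supp where "supp a = {t\<in>carrier \<Gamma>. fst a t \<noteq> \<one>\<^bsub>\<Lambda>\<^esub>}" for a :: "('b \<Rightarrow> 'a) \<times> 'b"
  have supp: "finite (supp a)" "supp a \<noteq> {}" "supp a \<subseteq> carrier \<Gamma>" if a: "a \<in> N - {\<one>\<^bsub>V\<^esub>}" for a
  proof -
    obtain f where f: "a = (f, \<one>)" "P f" using a by (auto simp: N)
    show "finite (supp a)" using f by (simp add: supp_def P_def)
    show "supp a \<noteq> {}"
    proof
      assume "supp a = {}"
      then have "f = (\<lambda>t\<in>carrier \<Gamma>. \<one>\<^bsub>\<Lambda>\<^esub>)" using Pe[OF f(2)]
        by (intro extensionalityI[of f "carrier \<Gamma>"]) (auto simp: supp_def f)
      then show False using a f by (simp add: oneV)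
    qed
  qed (auto simp: supp_def)
  define av where "av h a = (\<Sum>t\<in>supp a. h t) / card (supp a)" for h :: "'b \<Rightarrow> real" and a
  have av_bound: "\<bar>av h a\<bar> \<le> B" if a: "a \<in> N - {\<one>\<^bsub>V\<^esub>}" and h: "\<forall>t\<in>carrier \<Gamma>. \<bar>h t\<bar> \<le> B" for h a B
  proof -
    have "\<bar>\<Sum>t\<in>supp a. h t\<bar> \<le> (\<Sum>t\<in>supp a. B)"
      using h supp[OF a] by (intro order_trans[OF sum_abs] sum_mono) auto
    moreover have "card (supp a) > 0" using supp[OF a] by (simp add: card_gt_0_iff)
    ultimately show ?thesis by (simp add: av_def pos_divide_le_eq mult.commute)
  qed
  have bav: "bounded (av h ` (N - {\<one>\<^bsub>V\<^esub>}))" if h: "bounded (h ` carrier \<Gamma>)" for h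
  proof -
    obtain B where "\<forall>t\<in>carrier \<Gamma>. \<bar>h t\<bar> \<le> B" using h by (auto simp: bounded_iff)
    then show ?thesis using av_bound[of _ h B] by (intro bounded_fun_leI[of _ _ B]) simp
  qed
  define \<mu> where "\<mu> h = m (av h)" for h
  have "mean (carrier \<Gamma>) \<mu>"
  proof
    fix h :: "'b \<Rightarrow> real" assume h: "bounded (h ` carrier \<Gamma>)"
    show "\<mu> (\<lambda>t. h t + h' t) = \<mu> h + \<mu> h'" if h': "bounded (h' ` carrier \<Gamma>)" for h'
    proof -
      have "av (\<lambda>t. h t + h' t) = (\<lambda>a. av h a + av h' a)" by (auto simp: av_def sum.distrib add_divide_distrib)
      then show ?thesis using add[OF bav[OF h] bav[OF h']] by (simp add: \<mu>_def)
    qed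
    show "\<mu> (\<lambda>t. r * h t) = r * \<mu> h" for r
    proof -
      have "av (\<lambda>t. r * h t) = (\<lambda>a. r * av h a)" by (auto simp: av_def sum_distrib_left)
      then show ?thesis using scale[OF bav[OF h]] by (simp add: \<mu>_def)
    qed
    show "0 \<le> \<mu> h" if h0: "\<And>t. t \<in> carrier \<Gamma> \<Longrightarrow> 0 \<le> h t"
      unfolding \<mu>_def
    proof (rule nonneg[OF bav[OF h]])
      show "0 \<le> av h a" if "a \<in> N - {\<one>\<^bsub>V\<^esub>}" for a
        unfolding av_def using supp[OF that] h0
        by (intro divide_nonneg_nonneg sum_nonneg) auto
    qed
  next
    have "m (av (\<lambda>t. 1)) = m (\<lambda>a. 1)"
    proof (rule cong[OF bav])
      show "av (\<lambda>t. 1) a = 1" if "a \<in> N - {\<one>\<^bsub>V\<^esub>}" for a using supp[OF that] by (simp add: av_def)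
    qed simp
    then show "\<mu> (\<lambda>t. 1) = 1" by (simp add: \<mu>_def one)
  qed
  moreover have "\<mu> (\<lambda>t. h (inv \<gamma> \<otimes> t)) = \<mu> h"
    if \<gamma>: "\<gamma> \<in> carrier \<Gamma>" and h: "bounded (h ` carrier \<Gamma>)" for \<gamma> h
  proof -
    have \<gamma>': "inv \<gamma> \<in> carrier \<Gamma>" using \<gamma> by simp
    have "\<mu> (\<lambda>t. h (inv \<gamma> \<otimes> t)) = m (\<lambda>a. av h (w (inv \<gamma>) \<otimes>\<^bsub>V\<^esub> a \<otimes>\<^bsub>V\<^esub> inv\<^bsub>V\<^esub> (w (inv \<gamma>))))"
      unfolding \<mu>_def
    proof (rule cong)
      show "bounded (av (\<lambda>t. h (inv \<gamma> \<otimes> t)) ` (N - {\<one>\<^bsub>V\<^esub>}))"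
        by (rule bav, rule bounded_fun_reindex[OF h]) (use \<gamma> in simp)
      fix a assume a: "a \<in> N - {\<one>\<^bsub>V\<^esub>}"
      define b where "b = w (inv \<gamma>) \<otimes>\<^bsub>V\<^esub> a \<otimes>\<^bsub>V\<^esub> inv\<^bsub>V\<^esub> (w (inv \<gamma>))"
      have b: "b = (\<lambda>t\<in>carrier \<Gamma>. fst a (\<gamma> \<otimes> t), \<one>)"
        unfolding b_def using conj[OF \<gamma>', of a] a \<gamma> by simp
      have inj: "inj_on (\<lambda>s. inv \<gamma> \<otimes> s) (supp a)"
        using supp(3)[OF a] \<gamma> by (auto simp: inj_on_def subset_iff)
      have "supp b = (\<lambda>s. inv \<gamma> \<otimes> s) ` supp a"
      proof
        show "supp b \<subseteq> (\<lambda>s. inv \<gamma> \<otimes> s) ` supp a"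
        proof
          fix t assume "t \<in> supp b"
          then show "t \<in> (\<lambda>s. inv \<gamma> \<otimes> s) ` supp a"
            using \<gamma> by (intro image_eqI[of _ _ "\<gamma> \<otimes> t"]) (auto simp: supp_def b simp flip: G.m_assoc)
        qed
        show "(\<lambda>s. inv \<gamma> \<otimes> s) ` supp a \<subseteq> supp b"
          using \<gamma> by (auto simp: supp_def b simp flip: G.m_assoc)
      qed
      then show "av (\<lambda>t. h (inv \<gamma> \<otimes> t)) a = av h b"
        unfolding av_def by (simp add: sum.reindex[OF inj] card_image[OF inj])
    qed
    also have "\<dots> = \<mu> h" unfolding \<mu>_def by (rule inv[OF wV[OF \<gamma>'] bav[OF h]])
    finally show ?thesis .
  qed
  ultimately have "amenable \<Gamma>" unfolding amenable_iff_mean by blast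
  with \<open>\<not> amenable \<Gamma>\<close> show False by simp
qed

theorem corollary4:
  shows "(\<forall>(\<Lambda> :: ('a, 'c) monoid_scheme) (\<Gamma> :: ('b, 'd) monoid_scheme).
            group \<Lambda> \<and> group \<Gamma> \<and> carrier \<Lambda> \<noteq> {\<one>\<^bsub>\<Lambda>\<^esub>} \<and> \<not> amenable \<Gamma>
            \<longrightarrow> \<not> weakly_amenable (wreath_product \<Lambda> \<Gamma>))
         \<and> \<not> weakly_amenable SL2Z_Z2"
  using wreath_product_not_weakly_amenable SL2Z_Z2_not_weakly_amenable by blast

end
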